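(* Let $\mathcal{H}$ be a separable infinite-dimensional Hilbert space, and let $\pi:\mathcal{B}(\mathcal{H})\to\mathcal{Q}(\mathcal{H})=\mathcal{B}(\mathcal{H})/\mathcal{K}(\mathcal{H})$ be the canonical quotient map onto the Calkin algebra. There exist essential projections $A,B,C,D$ in $\mathcal{B}(\mathcal{H})$ with $\pi(A)\pi(B)=0$ such that, for any choice of compact operators $K_1,K_2,K_3\in\mathcal{K}(\mathcal{H})$, there exists an $N\in\mathbb{N}$ so that $$W^N(\pi(A)-\pi(B),\pi(C),\pi(D))\neq W^N(A-B+K_1,\,C+K_2,\,D+K_3).$$
   Context: A positive contraction $P\in\mathcal{B}(\mathcal{H})$ is called an essential projection if its image $\pi(P)\in\mathcal{Q}(\mathcal{H})$ is an orthogonal projection. $\mathcal{K}(\mathcal{H})$ is the ideal of compact operators. For elements $A_1,\dots,A_m$ of a unital $C^*$-algebra $\mathcal{A}$ and $n\in\mathbb{N}$, the $n$-th joint matrix range is $$W^n(A_1,\dots,A_m)=\{(\Phi(A_1),\dots,\Phi(A_m)):\Phi\in\mathrm{UCP}(\mathcal{A},M_n)\},$$ where $\mathrm{UCP}(\mathcal{A},M_n)$ is the set of unital completely positive maps from $\mathcal{A}$ to the $n\times n$ complex matrices $M_n$; this set does not depend on the unital $C^*$-algebra $\mathcal{A}$ containing $A_1,\dots,A_m$. *)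

theory Defs
  imports
    "HOL-Analysis.Bounded_Linear_Function"
    "HOL-Library.Nonpos_Ints"
    "Jordan_Normal_Form.Matrix"
begin

section \<open>Complex Hilbert spaces\<close>

class complex_vector = ab_group_add +
  fixes scaleC :: "complex \<Rightarrow> 'a \<Rightarrow> 'a"  (infixr "*\<^sub>C" 75)
  assumes scaleC_add_right: "c *\<^sub>C (x + y) = c *\<^sub>C x + c *\<^sub>C y"
    and scaleC_add_left: "(c + d) *\<^sub>C x = c *\<^sub>C x + d *\<^sub>C x"
    and scaleC_scaleC: "c *\<^sub>C (d *\<^sub>C x) = (c * d) *\<^sub>C x"
    and scaleC_one [simp]: "1 *\<^sub>C x = x"

text \<open>The inner product is linear in its second argument. Definiteness follows from
  \<open>norm_sq_cinner\<close>, completeness from class \<open>banach\<close>.\<close>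

class chilbert_space = banach + complex_vector +
  fixes cinner :: "'a \<Rightarrow> 'a \<Rightarrow> complex"
  assumes scaleR_scaleC: "r *\<^sub>R x = complex_of_real r *\<^sub>C x"
    and cinner_commute: "cinner x y = cnj (cinner y x)"
    and cinner_add_right: "cinner x (y + z) = cinner x y + cinner x z"
    and cinner_scaleC_right: "cinner x (c *\<^sub>C y) = c * cinner x y"
    and norm_sq_cinner: "complex_of_real ((norm x)\<^sup>2) = cinner x x"

definition infinite_dimensional :: "'h::complex_vector itself \<Rightarrow> bool" where
  "infinite_dimensional _ \<longleftrightarrow> \<not> (\<exists>S::'h set. finite S \<and> module.span scaleC S = UNIV)"

definition separable_type :: "'h::topological_space itself \<Rightarrow> bool" where
  "separable_type _ \<longleftrightarrow> (\<exists>S::'h set. countable S \<and> closure S = UNIV)"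

lemma vector_space_scaleC: "vector_space (scaleC :: complex \<Rightarrow> 'a \<Rightarrow> 'a::complex_vector)"
  by unfold_locales
    (simp_all add: scaleC_add_right scaleC_add_left scaleC_scaleC)

lemma scaleC_zero_right [simp]: "c *\<^sub>C (0::'a::complex_vector) = 0"
  by (metis add_cancel_right_right scaleC_add_right)

lemma scaleC_zero_left [simp]: "0 *\<^sub>C (x::'a::complex_vector) = 0"
  by (metis add_cancel_right_right scaleC_add_left)

lemma scaleC_minus_right: "c *\<^sub>C (- (x::'a::complex_vector)) = - (c *\<^sub>C x)"
  by (metis add.right_inverse add_eq_0_iff scaleC_add_right scaleC_zero_right)

lemma scaleC_diff_right: "c *\<^sub>C (x - (y::'a::complex_vector)) = c *\<^sub>C x - c *\<^sub>C y"
  using scaleC_add_right[of c x "- y"] by (simp add: scaleC_minus_right)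

lemma cinner_zero_right [simp]: "cinner x (0::'h::chilbert_space) = 0"
  using cinner_add_right[of x 0 0] by simp

lemma cinner_minus_right: "cinner x (- y::'h::chilbert_space) = - cinner x y"
  using cinner_add_right[of x y "- y"] by (simp add: eq_neg_iff_add_eq_0 add.commute)

lemma cinner_diff_right: "cinner x (y - z::'h::chilbert_space) = cinner x y - cinner x z"
  using cinner_add_right[of x y "- z"] by (simp add: cinner_minus_right)

lemma cinner_zero_left [simp]: "cinner 0 (x::'h::chilbert_space) = 0"
  by (subst cinner_commute) simp

lemma cinner_add_left: "cinner (x + y) (z::'h::chilbert_space) = cinner x z + cinner y z"
  by (simp add: cinner_commute[of _ z] cinner_add_right)

lemma cinner_diff_left: "cinner (x - y) (z::'h::chilbert_space) = cinner x z - cinner y z"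
  by (simp add: cinner_commute[of _ z] cinner_diff_right)

lemma cinner_scaleC_left: "cinner (c *\<^sub>C x) (y::'h::chilbert_space) = cnj c * cinner x y"
  by (simp add: cinner_commute[of _ y] cinner_scaleC_right)

lemma cinner_self_eq_0: "cinner x x = 0 \<longleftrightarrow> (x::'h::chilbert_space) = 0"
  by (simp add: norm_sq_cinner[symmetric])

lemma norm_sq_Re_cinner: "(norm (x::'h::chilbert_space))\<^sup>2 = Re (cinner x x)"
  by (simp only: norm_sq_cinner[symmetric] Re_complex_of_real)

lemma norm_scaleC: "norm (c *\<^sub>C x) = cmod c * norm (x::'h::chilbert_space)"
proof -
  have "complex_of_real ((norm (c *\<^sub>C x))\<^sup>2) = (c * cnj c) * complex_of_real ((norm x)\<^sup>2)"
    by (simp only: norm_sq_cinner cinner_scaleC_right cinner_scaleC_left mult.assoc)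
  also have "\<dots> = complex_of_real ((cmod c * norm x)\<^sup>2)"
    by (simp only: complex_norm_square[symmetric] power_mult_distrib of_real_mult of_real_power)
  finally have "(norm (c *\<^sub>C x))\<^sup>2 = (cmod c * norm x)\<^sup>2"
    by (simp only: of_real_eq_iff)
  then show ?thesis by (simp add: power2_eq_iff_nonneg)
qed

lemma cinner_ext:
  assumes "\<And>x. cinner x y = cinner x (z::'h::chilbert_space)"
  shows "y = z"
  using assms[of "y - z"] cinner_diff_right[of "y - z" y z] cinner_self_eq_0[of "y - z"] by simp

lemma Re_cinner_commute: "Re (cinner x y) = Re (cinner y (x::'h::chilbert_space))"
  by (subst cinner_commute) simp

lemma norm_add_sq:
  "(norm (x + y::'h::chilbert_space))\<^sup>2 = (norm x)\<^sup>2 + 2 * Re (cinner x y) + (norm y)\<^sup>2"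
  by (simp add: norm_sq_Re_cinner cinner_add_left cinner_add_right Re_cinner_commute[of y x])

lemma norm_diff_sq:
  "(norm (x - y::'h::chilbert_space))\<^sup>2 = (norm x)\<^sup>2 - 2 * Re (cinner x y) + (norm y)\<^sup>2"
  using norm_add_sq[of x "- y"] by (simp add: cinner_minus_right)

lemma Cauchy_Schwarz_cinner: "cmod (cinner x y) \<le> norm x * norm (y::'h::chilbert_space)"
proof (cases "x = 0")
  case True
  then show ?thesis by simp
next
  case False
  define a where "a = cinner x y"
  define n where "n = (norm x)\<^sup>2"
  have n: "n > 0" using False by (simp add: n_def)
  have xx: "cinner x x = complex_of_real n" by (simp add: n_def norm_sq_cinner[symmetric])
  define w where "w = complex_of_real n *\<^sub>C y - a *\<^sub>C x"
  have "cinner w w = complex_of_real n * (complex_of_real n * cinner y y - a * cnj a)"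
    unfolding w_def
    by (simp add: cinner_diff_left cinner_diff_right cinner_scaleC_left cinner_scaleC_right xx
        cinner_commute[of y x] a_def[symmetric] algebra_simps)
  also have "\<dots> = complex_of_real (n * (n * (norm y)\<^sup>2 - (cmod a)\<^sup>2))"
    by (simp add: norm_sq_cinner[symmetric] complex_norm_square[symmetric]
        flip: of_real_power of_real_mult of_real_diff)
  finally have "(norm w)\<^sup>2 = n * (n * (norm y)\<^sup>2 - (cmod a)\<^sup>2)"
    by (simp add: norm_sq_Re_cinner[of w])
  then have "0 \<le> n * (n * (norm y)\<^sup>2 - (cmod a)\<^sup>2)" by (metis zero_le_power2)
  then have "(cmod a)\<^sup>2 \<le> (norm x * norm y)\<^sup>2"
    using n by (simp add: zero_le_mult_iff n_def power_mult_distrib)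
  then show ?thesis unfolding a_def by (rule power2_le_imp_le) simp
qed

lemma riesz_exists:
  fixes f :: "'h::chilbert_space \<Rightarrow> complex"
  assumes add: "\<And>x y. f (x + y) = f x + f y"
    and scale: "\<And>c x. f (c *\<^sub>C x) = c * f x"
    and bound: "\<And>x. cmod (f x) \<le> norm x * C"
  shows "\<exists>z. \<forall>x. f x = cinner z x"
proof -
  define J where "J x = (norm x)\<^sup>2 - 2 * Re (f x)" for x
  have f_linear: "bounded_linear f"
    by (rule bounded_linear_intro[where K = C])
      (simp_all add: add bound scaleR_scaleC scale scaleR_conv_of_real)
  have lower: "- C\<^sup>2 \<le> J x" for x
  proof -
    have "Re (f x) \<le> norm x * C" using bound[of x] complex_Re_le_cmod[of "f x"] by linarith
    moreover have "0 \<le> (norm x - C)\<^sup>2" by simp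
    ultimately show ?thesis by (simp add: J_def power2_diff)
  qed
  define m where "m = (INF x. J x)"
  have bdd: "bdd_below (range J)" using lower by (meson bdd_belowI2)
  have m_le: "m \<le> J x" for x unfolding m_def using bdd by (simp add: cINF_lower)
  have "\<exists>x. J x < m + 1 / real (Suc n)" for n
  proof -
    have "m < m + 1 / real (Suc n)" by simp
    then show ?thesis unfolding m_def
      using cInf_lessD[of "range J"] by fastforce
  qed
  then obtain u where u: "\<And>n. J (u n) < m + 1 / real (Suc n)" by metis
  have par: "(norm (x - y))\<^sup>2 \<le> 2 * (J x + J y) - 4 * m" for x y
  proof -
    have half_norm: "(norm ((1/2) *\<^sub>R (x + y)))\<^sup>2 = (norm (x + y))\<^sup>2 / 4"
      by (simp only: norm_scaleR) (simp add: power_divide)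
    have half_f: "f ((1/2) *\<^sub>R (x + y)) = (f x + f y) / 2"
      by (simp only: linear_simps[OF f_linear]) (simp add: scaleR_conv_of_real field_simps)
    have "4 * m \<le> 4 * J ((1/2) *\<^sub>R (x + y))" using m_le by simp
    also have "\<dots> = (norm (x + y))\<^sup>2 - 4 * Re (f x) - 4 * Re (f y)"
      by (simp only: J_def half_norm half_f) (simp add: field_simps)
    finally show ?thesis
      using norm_add_sq[of x y] norm_diff_sq[of x y] by (simp add: J_def)
  qed
  have "Cauchy u"
  proof (rule metric_CauchyI)
    fix e :: real assume e: "e > 0"
    obtain M where M: "4 / e\<^sup>2 < real M" using reals_Archimedean2 by blast
    have "dist (u i) (u j) < e" if ij: "i \<ge> M" "j \<ge> M" for i j
    proof -
      have M0: "real M > 0" using M e by (meson divide_pos_pos zero_less_numeral zero_less_power order_less_trans)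
      have "1 / real (Suc i) \<le> 1 / real M" "1 / real (Suc j) \<le> 1 / real M"
        using ij M0 by (auto intro!: divide_left_mono)
      then have "(norm (u i - u j))\<^sup>2 < 4 / real M"
        using par[of "u i" "u j"] u[of i] u[of j] by simp
      also have "4 / real M < e\<^sup>2"
        using M M0 e by (simp add: field_simps)
      finally show ?thesis using e by (simp add: dist_norm power2_less_imp_less)
    qed
    then show "\<exists>M. \<forall>i\<ge>M. \<forall>j\<ge>M. dist (u i) (u j) < e" by blast
  qed
  then obtain z where z: "u \<longlonglongrightarrow> z" using Cauchy_convergent_iff convergent_def by blast
  have "(\<lambda>n. J (u n)) \<longlonglongrightarrow> J z"
    unfolding J_def using z bounded_linear.tendsto[OF f_linear z] by (intro tendsto_intros)
  moreover have "(\<lambda>n. m + 1 / real (Suc n)) \<longlonglongrightarrow> m"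
    using tendsto_add[OF tendsto_const LIMSEQ_inverse_real_of_nat, of m]
    by (simp add: inverse_eq_divide)
  ultimately have "J z \<le> m"
    using LIMSEQ_le u by (metis (no_types, lifting) less_imp_le)
  then have min: "J z \<le> J x" for x using m_le[of x] by linarith
  have Re_eq: "Re (cinner z x) = Re (f x)" for x
  proof (rule ccontr)
    define b where "b = Re (cinner z x) - Re (f x)"
    assume "\<not> ?thesis"
    then have b: "b \<noteq> 0" by (simp add: b_def)
    define q where "q = (norm x)\<^sup>2 + 1"
    have q: "q > 0" by (simp add: q_def add_nonneg_pos)
    define t where "t = - b / q"
    have "J (z + t *\<^sub>R x) = J z + 2 * t * b + t\<^sup>2 * (norm x)\<^sup>2"
      unfolding J_def norm_add_sq
      by (simp add: linear_simps[OF f_linear] b_def scaleR_scaleC cinner_scaleC_right scale add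
          power_mult_distrib norm_scaleC algebra_simps)
    then have "0 \<le> 2 * t * b + t\<^sup>2 * (norm x)\<^sup>2" using min[of "z + t *\<^sub>R x"] by linarith
    also have "\<dots> \<le> 2 * t * b + t\<^sup>2 * q" by (simp add: q_def mult_left_mono)
    also have "\<dots> = - (b\<^sup>2 / q)" using q by (simp add: t_def power2_eq_square field_simps)
    finally show False using b q by (simp add: divide_le_0_iff)
  qed
  have "f x = cinner z x" for x
  proof (rule complex_eqI)
    show "Re (f x) = Re (cinner z x)" by (simp add: Re_eq)
    show "Im (f x) = Im (cinner z x)"
      using Re_eq[of "\<i> *\<^sub>C x"] by (simp add: scale cinner_scaleC_right)
  qed
  then show ?thesis by blast
qed


section \<open>Unital complex *-algebras\<close>

text \<open>The unit may be zero: this is needed to make the operators on an arbitrary Hilbert space,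
  and their quotient by the compact operators, instances.\<close>

class complex_star_algebra = complex_vector + ring + monoid_mult +
  fixes star :: "'a \<Rightarrow> 'a"
  assumes scaleC_mult_left: "(c *\<^sub>C a) * b = c *\<^sub>C (a * b)"
    and scaleC_mult_right: "a * (c *\<^sub>C b) = c *\<^sub>C (a * b)"
    and star_add: "star (a + b) = star a + star b"
    and star_scaleC: "star (c *\<^sub>C a) = cnj c *\<^sub>C star a"
    and star_mult: "star (a * b) = star b * star a"
    and star_star: "star (star a) = a"

instantiation complex :: complex_star_algebra
begin

definition scaleC_complex :: "complex \<Rightarrow> complex \<Rightarrow> complex" where
  "scaleC_complex c z = c * z"

definition star_complex :: "complex \<Rightarrow> complex" where
  "star_complex z = cnj z"

instance
  by standard (simp_all add: scaleC_complex_def star_complex_def algebra_simps)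

end

definition is_projection :: "'a::complex_star_algebra \<Rightarrow> bool" where
  "is_projection p \<longleftrightarrow> star p = p \<and> p * p = p"


section \<open>Bounded operators\<close>

typedef (overloaded) 'h bop =
  "{A :: 'h::chilbert_space \<Rightarrow>\<^sub>L 'h. \<forall>c x. blinfun_apply A (c *\<^sub>C x) = c *\<^sub>C blinfun_apply A x}"
  morphisms blinfun_of_bop bop_of_blinfun
  by (rule exI[of _ 0]) simp

setup_lifting type_definition_bop

lift_definition bop_apply :: "'h::chilbert_space bop \<Rightarrow> 'h \<Rightarrow> 'h" is blinfun_apply .

lift_definition op_norm :: "'h::chilbert_space bop \<Rightarrow> real" is norm .

lemma bop_eqI: "(\<And>x. bop_apply A x = bop_apply B x) \<Longrightarrow> A = B"
  by transfer (rule blinfun_eqI)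

lemma bop_apply_add: "bop_apply A (x + y) = bop_apply A x + bop_apply A y"
  by transfer (rule blinfun.add_right)

lemma bop_apply_diff: "bop_apply A (x - y) = bop_apply A x - bop_apply A y"
  by transfer (rule blinfun.diff_right)

lemma bop_apply_scaleC: "bop_apply A (c *\<^sub>C x) = c *\<^sub>C bop_apply A x"
  by transfer simp

lemma bop_apply_bound: "norm (bop_apply A x) \<le> op_norm A * norm x"
  by transfer (rule norm_blinfun)

lemma op_norm_nonneg: "0 \<le> op_norm A"
  by transfer simp

lemma bounded_linear_bop_apply: "bounded_linear (bop_apply A)"
  by transfer (rule blinfun.bounded_linear_right)

lemma bop_exists:
  fixes g :: "'h::chilbert_space \<Rightarrow> 'h"
  assumes "\<And>x y. g (x + y) = g x + g y" "\<And>c x. g (c *\<^sub>C x) = c *\<^sub>C g x"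
    "\<And>x. norm (g x) \<le> norm x * K"
  shows "\<exists>A. \<forall>x. bop_apply A x = g x"
proof -
  have bl: "bounded_linear g"
    by (rule bounded_linear_intro[where K = K]) (simp_all add: assms scaleR_scaleC)
  have "bop_apply (bop_of_blinfun (Blinfun g)) x = g x" for x
    unfolding bop_apply_def
    by (simp add: bop_of_blinfun_inverse bounded_linear_Blinfun_apply[OF bl] assms)
  then show ?thesis by blast
qed

instantiation bop :: (chilbert_space) complex_vector
begin

lift_definition zero_bop :: "'a bop" is 0 by simp
lift_definition plus_bop :: "'a bop \<Rightarrow> 'a bop \<Rightarrow> 'a bop" is "(+)"
  by (simp add: blinfun.add_left scaleC_add_right)
lift_definition minus_bop :: "'a bop \<Rightarrow> 'a bop \<Rightarrow> 'a bop" is "(-)"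
  by (simp add: blinfun.diff_left scaleC_diff_right)
lift_definition uminus_bop :: "'a bop \<Rightarrow> 'a bop" is uminus
  by (simp add: blinfun.minus_left scaleC_minus_right)

lemma bounded_linear_scaleC_apply:
  "bounded_linear (\<lambda>x. c *\<^sub>C blinfun_apply (A :: 'a \<Rightarrow>\<^sub>L 'a) x)"
proof (rule bounded_linear_intro[where K = "cmod c * norm A"])
  fix x show "norm (c *\<^sub>C blinfun_apply A x) \<le> norm x * (cmod c * norm A)"
    using mult_left_mono[OF norm_blinfun[of A x], of "cmod c"]
    by (simp add: norm_scaleC mult_ac)
next
  fix r x show "c *\<^sub>C blinfun_apply A (r *\<^sub>R x) = r *\<^sub>R (c *\<^sub>C blinfun_apply A x)"
    by (simp only: blinfun.scaleR_right) (simp add: scaleR_scaleC scaleC_scaleC mult.commute)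
qed (simp add: blinfun.add_right scaleC_add_right)

lift_definition scaleC_bop :: "complex \<Rightarrow> 'a bop \<Rightarrow> 'a bop"
  is "\<lambda>c A. Blinfun (\<lambda>x. c *\<^sub>C blinfun_apply A x)"
  by (simp add: bounded_linear_Blinfun_apply[OF bounded_linear_scaleC_apply] scaleC_scaleC mult.commute)

instance
proof
  fix a b c :: "'a bop" and s t :: complex
  note apply_scaleC [simp] = bounded_linear_Blinfun_apply[OF bounded_linear_scaleC_apply]
  show "a + b + c = a + (b + c)" by transfer (simp add: add.assoc)
  show "a + b = b + a" by transfer (simp add: add.commute)
  show "0 + a = a" by transfer simp
  show "- a + a = 0" by transfer simp
  show "a - b = a + - b" by transfer simp
  show "s *\<^sub>C (a + b) = s *\<^sub>C a + s *\<^sub>C b"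
    by transfer (rule blinfun_eqI, simp only: apply_scaleC, simp add: blinfun.add_left scaleC_add_right)
  show "(s + t) *\<^sub>C a = s *\<^sub>C a + t *\<^sub>C a"
    by transfer (rule blinfun_eqI, simp only: apply_scaleC, simp add: blinfun.add_left scaleC_add_left)
  show "s *\<^sub>C t *\<^sub>C a = (s * t) *\<^sub>C a"
    by transfer (rule blinfun_eqI, simp only: apply_scaleC, simp add: scaleC_scaleC)
  show "1 *\<^sub>C a = a" by transfer (rule blinfun_eqI, simp only: apply_scaleC, simp)
qed

end

lemma bop_apply_simps [simp]:
  "bop_apply 0 x = 0"
  "bop_apply (A + B) x = bop_apply A x + bop_apply B x"
  "bop_apply (A - B) x = bop_apply A x - bop_apply B x"
  "bop_apply (- A) x = - bop_apply A x"
  "bop_apply (c *\<^sub>C A) x = c *\<^sub>C bop_apply A x"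
  by (transfer, simp add: blinfun.bilinear_simps
      bounded_linear_Blinfun_apply[OF bounded_linear_scaleC_apply])+

lemma adjoint_exists:
  fixes A :: "'h::chilbert_space bop"
  shows "\<exists>!B. \<forall>x y. cinner (bop_apply B x) y = cinner x (bop_apply A y)"
proof -
  have "\<exists>z. \<forall>y. cinner x (bop_apply A y) = cinner z y" for x
  proof (rule riesz_exists[where C = "norm x * op_norm A"])
    fix y show "cmod (cinner x (bop_apply A y)) \<le> norm y * (norm x * op_norm A)"
      using Cauchy_Schwarz_cinner[of x "bop_apply A y"]
        mult_left_mono[OF bop_apply_bound[of A y], of "norm x"] by (simp add: mult_ac)
  qed (simp_all add: bop_apply_add bop_apply_scaleC cinner_add_right cinner_scaleC_right)
  then obtain g where g: "\<And>x y. cinner x (bop_apply A y) = cinner (g x) y" by metis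
  have g': "cinner y (g x) = cinner (bop_apply A y) x" for x y
    by (metis g cinner_commute)
  have "\<exists>B. \<forall>x. bop_apply B x = g x"
  proof (rule bop_exists[where K = "op_norm A"])
    show "g (x + y) = g x + g y" for x y
      by (rule cinner_ext) (simp add: g' cinner_add_right)
    show "g (c *\<^sub>C x) = c *\<^sub>C g x" for c x
      by (rule cinner_ext) (simp add: g' cinner_scaleC_right)
    show "norm (g x) \<le> norm x * op_norm A" for x
    proof (cases "g x = 0")
      case False
      have "(norm (g x))\<^sup>2 = Re (cinner x (bop_apply A (g x)))"
        by (simp add: norm_sq_Re_cinner g)
      also have "\<dots> \<le> norm x * norm (bop_apply A (g x))"
        using Cauchy_Schwarz_cinner[of x "bop_apply A (g x)"]
          complex_Re_le_cmod[of "cinner x (bop_apply A (g x))"] by linarith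
      also have "\<dots> \<le> norm x * (op_norm A * norm (g x))"
        by (rule mult_left_mono[OF bop_apply_bound]) simp
      finally show ?thesis using False by (simp add: power2_eq_square)
    qed (simp add: op_norm_nonneg)
  qed
  then obtain B where B: "\<And>x. bop_apply B x = g x" by blast
  show ?thesis
  proof
    show "\<forall>x y. cinner (bop_apply B x) y = cinner x (bop_apply A y)" by (simp add: B g)
  next
    fix B' assume B': "\<forall>x y. cinner (bop_apply B' x) y = cinner x (bop_apply A y)"
    show "B' = B"
    proof (rule bop_eqI, rule cinner_ext)
      fix x y show "cinner y (bop_apply B' x) = cinner y (bop_apply B x)"
        by (metis B' B g cinner_commute)
    qed
  qed
qed

instantiation bop :: (chilbert_space) complex_star_algebra
begin

lift_definition one_bop :: "'a bop" is id_blinfun by simp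
lift_definition times_bop :: "'a bop \<Rightarrow> 'a bop \<Rightarrow> 'a bop" is "(o\<^sub>L)" by simp

definition star_bop :: "'a bop \<Rightarrow> 'a bop" where
  "star_bop A = (THE B. \<forall>x y. cinner (bop_apply B x) y = cinner x (bop_apply A y))"

lemma star_bop_left: "cinner (bop_apply (star A) x) y = cinner x (bop_apply A (y::'a))"
  using theI'[OF adjoint_exists[of A]] unfolding star_bop_def by blast

lemma star_bop_right: "cinner x (bop_apply (star A) y) = cinner (bop_apply A x) (y::'a)"
  by (metis star_bop_left cinner_commute)

lemma bop_apply_one [simp]: "bop_apply 1 x = (x::'a)"
  by transfer simp

lemma bop_apply_times [simp]: "bop_apply (A * B) x = bop_apply A (bop_apply B (x::'a))"
  by transfer simp

instance
proof
  fix a b c :: "'a bop" and s :: complex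
  show "a * b * c = a * (b * c)" by (rule bop_eqI) simp
  show "(a + b) * c = a * c + b * c" by (rule bop_eqI) simp
  show "a * (b + c) = a * b + a * c" by (rule bop_eqI) (simp add: bop_apply_add)
  show "1 * a = a" "a * 1 = a" by (rule bop_eqI, simp)+
  show "(s *\<^sub>C a) * b = s *\<^sub>C (a * b)" by (rule bop_eqI) simp
  show "a * (s *\<^sub>C b) = s *\<^sub>C (a * b)" by (rule bop_eqI) (simp add: bop_apply_scaleC)
  show "star (a + b) = star a + star b"
    by (rule bop_eqI, rule cinner_ext) (simp add: star_bop_right cinner_add_left cinner_add_right)
  show "star (s *\<^sub>C a) = cnj s *\<^sub>C star a"
    by (rule bop_eqI, rule cinner_ext)
      (simp add: star_bop_right cinner_scaleC_left cinner_scaleC_right)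
  show "star (a * b) = star b * star a"
    by (rule bop_eqI, rule cinner_ext) (simp add: star_bop_right)
  show "star (star a) = a"
    by (rule bop_eqI, rule cinner_ext) (simp add: star_bop_right star_bop_left)
qed

end

definition positive_op :: "'h::chilbert_space bop \<Rightarrow> bool" where
  "positive_op A \<longleftrightarrow> (\<forall>x. cinner x (bop_apply A x) \<in> \<real>\<^sub>\<ge>\<^sub>0)"


section \<open>Compact operators and the Calkin algebra\<close>

definition compact_op :: "'h::chilbert_space bop \<Rightarrow> bool" where
  "compact_op A \<longleftrightarrow> compact (closure (bop_apply A ` cball 0 1))"

lemma compact_opI:
  assumes "compact T" "\<And>x. norm x \<le> 1 \<Longrightarrow> bop_apply A x \<in> T"
  shows "compact_op A"
proof -
  have "closure (bop_apply A ` cball 0 1) \<subseteq> T"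
    using assms by (intro closure_minimal) (auto simp: compact_imp_closed)
  then show ?thesis unfolding compact_op_def
    by (metis assms(1) closed_closure closed_Int_compact inf.absorb_iff1)
qed

lemma compact_opE:
  assumes "compact_op A"
  obtains T where "compact T" "\<And>x. norm x \<le> 1 \<Longrightarrow> bop_apply A x \<in> T"
  using assms closure_subset[of "bop_apply A ` cball 0 1"]
  unfolding compact_op_def by (metis image_eqI mem_cball_0 subsetD)

lemma compact_op_0 [simp]: "compact_op 0"
  by (rule compact_opI[of "{0}"]) auto

lemma compact_op_add:
  assumes "compact_op A" "compact_op B"
  shows "compact_op (A + B)"
proof -
  obtain S T where "compact S" "\<And>x. norm x \<le> 1 \<Longrightarrow> bop_apply A x \<in> S"
    "compact T" "\<And>x. norm x \<le> 1 \<Longrightarrow> bop_apply B x \<in> T"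
    using assms by (metis compact_opE)
  then show ?thesis
    by (intro compact_opI[OF compact_sums[of S T]]) auto
qed

lemma compact_op_mult_left:
  assumes "compact_op A"
  shows "compact_op (B * A)"
proof -
  obtain S where "compact S" "\<And>x. norm x \<le> 1 \<Longrightarrow> bop_apply A x \<in> S"
    using assms by (metis compact_opE)
  then show ?thesis
    by (intro compact_opI[of "bop_apply B ` S"] compact_continuous_image
        linear_continuous_on bounded_linear_bop_apply) auto
qed

lemma compact_op_mult_right:
  assumes "compact_op A"
  shows "compact_op (A * B)"
proof -
  obtain S where S: "compact S" "\<And>x. norm x \<le> 1 \<Longrightarrow> bop_apply A x \<in> S"
    using assms by (metis compact_opE)
  define r where "r = op_norm B + 1"
  have r: "r > 0" using op_norm_nonneg[of B] by (simp add: r_def)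
  show ?thesis
  proof (rule compact_opI[of "(\<lambda>y. r *\<^sub>R y) ` S"])
    show "compact ((\<lambda>y. r *\<^sub>R y) ` S)" using S(1) by (rule compact_scaling)
    fix x :: 'a assume x: "norm x \<le> 1"
    have "norm (bop_apply B x) \<le> op_norm B * norm x" by (rule bop_apply_bound)
    also have "\<dots> \<le> op_norm B * 1" using x op_norm_nonneg by (rule mult_left_mono)
    also have "\<dots> \<le> r" by (simp add: r_def)
    finally have "norm ((1 / r) *\<^sub>R bop_apply B x) \<le> 1" using r by simp
    then have "bop_apply A ((1 / r) *\<^sub>R bop_apply B x) \<in> S" by (rule S(2))
    moreover have "bop_apply (A * B) x = r *\<^sub>R bop_apply A ((1 / r) *\<^sub>R bop_apply B x)"
      using r by (simp add: bounded_linear.linear[OF bounded_linear_bop_apply] linear_cmul)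
    ultimately show "bop_apply (A * B) x \<in> (\<lambda>y. r *\<^sub>R y) ` S" by blast
  qed
qed

lemma compact_op_scaleC: "compact_op A \<Longrightarrow> compact_op (c *\<^sub>C A)"
  using compact_op_mult_left[of A "c *\<^sub>C 1"] by (simp add: scaleC_mult_left)

lemma compact_op_uminus: "compact_op A \<Longrightarrow> compact_op (- A)"
  using compact_op_mult_left[of A "- 1"] by simp

lemma compact_op_diff: "compact_op A \<Longrightarrow> compact_op B \<Longrightarrow> compact_op (A - B)"
  using compact_op_add[of A "- B"] compact_op_uminus[of B] by simp

lemma compact_op_star:
  fixes A :: "'h::chilbert_space bop"
  assumes "compact_op A"
  shows "compact_op (star A)"
proof -
  let ?S = "bop_apply (star A) ` cball 0 1"
  have seq: "\<exists>l r. strict_mono r \<and> (s \<circ> r) \<longlonglongrightarrow> l" if s: "\<And>n. s n \<in> ?S" for s :: "nat \<Rightarrow> 'h"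
  proof -
    obtain x where x: "\<And>n. norm (x n) \<le> 1" "\<And>n. s n = bop_apply (star A) (x n)"
      using s unfolding image_iff by (metis mem_cball_0)
    obtain T where T: "compact T" "\<And>x. norm x \<le> 1 \<Longrightarrow> bop_apply (A * star A) x \<in> T"
      using compact_op_mult_right[OF assms, of "star A"] by (metis compact_opE)
    define w where "w n = bop_apply (A * star A) (x n)" for n
    have "\<forall>n. w n \<in> T" using T(2) x(1) by (simp add: w_def del: bop_apply_times)
    then obtain l r where r: "strict_mono r" and l: "(w \<circ> r) \<longlonglongrightarrow> l"
      using T(1) unfolding compact_def by metis
    have "Cauchy (s \<circ> r)"
    proof (rule metric_CauchyI)
      fix e :: real assume e: "e > 0"
      have "Cauchy (w \<circ> r)" using l by (rule LIMSEQ_imp_Cauchy)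
      moreover have "e\<^sup>2 / 2 > 0" using e by simp
      ultimately obtain M where
        M: "\<And>i j. i \<ge> M \<Longrightarrow> j \<ge> M \<Longrightarrow> dist ((w \<circ> r) i) ((w \<circ> r) j) < e\<^sup>2 / 2"
        unfolding Cauchy_def by metis
      have "dist ((s \<circ> r) i) ((s \<circ> r) j) < e" if ij: "i \<ge> M" "j \<ge> M" for i j
      proof -
        define d where "d = x (r i) - x (r j)"
        have d: "norm d \<le> 2"
          unfolding d_def using norm_triangle_ineq4[of "x (r i)" "x (r j)"] x(1)[of "r i"] x(1)[of "r j"]
          by linarith
        have "(norm (bop_apply (star A) d))\<^sup>2 = Re (cinner d (bop_apply A (bop_apply (star A) d)))"
          by (simp add: norm_sq_Re_cinner star_bop_left)
        also have "\<dots> \<le> norm d * norm (bop_apply A (bop_apply (star A) d))"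
          using Cauchy_Schwarz_cinner complex_Re_le_cmod order_trans by blast
        also have "\<dots> \<le> 2 * norm (bop_apply A (bop_apply (star A) d))"
          using d by (rule mult_right_mono) simp
        also have "bop_apply A (bop_apply (star A) d) = w (r i) - w (r j)"
          by (simp add: d_def w_def bop_apply_diff)
        also have "2 * norm (w (r i) - w (r j)) < e\<^sup>2"
          using M[OF ij] by (simp add: dist_norm)
        finally have "norm (bop_apply (star A) d) < e" using e by (simp add: power2_less_imp_less)
        then show ?thesis by (simp add: dist_norm x(2) d_def bop_apply_diff)
      qed
      then show "\<exists>M. \<forall>i\<ge>M. \<forall>j\<ge>M. dist ((s \<circ> r) i) ((s \<circ> r) j) < e" by blast
    qed
    then obtain l' where "(s \<circ> r) \<longlonglongrightarrow> l'" using Cauchy_convergent_iff convergent_def by blast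
    then show ?thesis using r by blast
  qed
  have "compact (closure ?S)"
    unfolding compact_def
  proof (intro allI impI)
    fix s :: "nat \<Rightarrow> 'h" assume s: "\<forall>n. s n \<in> closure ?S"
    have "\<exists>y\<in>?S. dist y (s n) < 1 / real (Suc n)" for n
      using s closure_approachable[of "s n" ?S] by simp
    then obtain t where t: "\<And>n. t n \<in> ?S" "\<And>n. dist (t n) (s n) < 1 / real (Suc n)"
      by metis
    obtain l r where r: "strict_mono r" and l: "(t \<circ> r) \<longlonglongrightarrow> l" using seq[of t] t(1) by blast
    have "(\<lambda>n. s n - t n) \<longlonglongrightarrow> 0"
    proof (rule Lim_null_comparison)
      show "\<forall>\<^sub>F n in sequentially. norm (s n - t n) \<le> 1 / real (Suc n)"
        using t(2) by (intro always_eventually allI) (metis dist_commute dist_norm less_imp_le)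
      show "(\<lambda>n. 1 / real (Suc n)) \<longlonglongrightarrow> 0"
        using LIMSEQ_inverse_real_of_nat by (simp add: inverse_eq_divide)
    qed
    then have "(\<lambda>n. (s \<circ> r) n - (t \<circ> r) n) \<longlonglongrightarrow> 0"
      using LIMSEQ_subseq_LIMSEQ[OF _ r] by (fastforce simp: o_def)
    from tendsto_add[OF this l] have lim: "(s \<circ> r) \<longlonglongrightarrow> l" by (simp add: o_def)
    then have "l \<in> closure ?S"
      using closed_sequentially[OF closed_closure, of "s \<circ> r" ?S l] s by simp
    then show "\<exists>l\<in>closure ?S. \<exists>r. strict_mono r \<and> (s \<circ> r) \<longlonglongrightarrow> l"
      using r lim by blast
  qed
  then show ?thesis by (simp add: compact_op_def)
qed

quotient_type (overloaded) 'h calkin =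
  "'h::chilbert_space bop" / "\<lambda>A B. compact_op (A - B)"
  morphisms rep_calkin calkin_proj
proof (rule equivpI)
  show "reflp (\<lambda>A B::'h bop. compact_op (A - B))" by (rule reflpI) simp
  show "symp (\<lambda>A B::'h bop. compact_op (A - B))"
    by (rule sympI) (metis compact_op_uminus minus_diff_eq)
  show "transp (\<lambda>A B::'h bop. compact_op (A - B))"
    by (rule transpI) (metis compact_op_add diff_add_cancel add_diff_eq)
qed

lemma calkin_proj_eq_iff: "calkin_proj A = calkin_proj B \<longleftrightarrow> compact_op (A - B)"
  by (simp add: calkin.abs_eq_iff)

instantiation calkin :: (chilbert_space) complex_star_algebra
begin

lift_definition zero_calkin :: "'a calkin" is 0 .
lift_definition one_calkin :: "'a calkin" is 1 .
lift_definition plus_calkin :: "'a calkin \<Rightarrow> 'a calkin \<Rightarrow> 'a calkin" is "(+)"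
  by (metis add_diff_add compact_op_add)
lift_definition minus_calkin :: "'a calkin \<Rightarrow> 'a calkin \<Rightarrow> 'a calkin" is "(-)"
proof -
  fix a b c d :: "'a bop" assume "compact_op (a - b)" "compact_op (c - d)"
  then have "compact_op ((a - b) - (c - d))" by (rule compact_op_diff)
  then show "compact_op (a - c - (b - d))" by (simp add: algebra_simps)
qed
lift_definition uminus_calkin :: "'a calkin \<Rightarrow> 'a calkin" is uminus
  by (metis compact_op_uminus minus_diff_minus)
lift_definition times_calkin :: "'a calkin \<Rightarrow> 'a calkin \<Rightarrow> 'a calkin" is "(*)"
proof -
  fix a b c d :: "'a bop" assume "compact_op (a - b)" "compact_op (c - d)"
  then have "compact_op ((a - b) * c + b * (c - d))"
    by (intro compact_op_add compact_op_mult_left compact_op_mult_right)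
  then show "compact_op (a * c - b * d)" by (simp add: algebra_simps)
qed
lift_definition scaleC_calkin :: "complex \<Rightarrow> 'a calkin \<Rightarrow> 'a calkin" is scaleC
  by (metis compact_op_scaleC scaleC_diff_right)
lift_definition star_calkin :: "'a calkin \<Rightarrow> 'a calkin" is star
proof -
  fix a b :: "'a bop" assume "compact_op (a - b)"
  then have "compact_op (star (a - b))" by (rule compact_op_star)
  moreover have "star (a - b) = star a - star b"
    by (metis diff_add_cancel add_diff_cancel star_add)
  ultimately show "compact_op (star a - star b)" by simp
qed

instance
proof
  fix a b c :: "'a calkin" and s t :: complex
  show "a + b + c = a + (b + c)" by transfer (simp add: add.assoc)
  show "a + b = b + a" by transfer (simp add: add.commute)
  show "0 + a = a" by transfer simp
  show "- a + a = 0" by transfer simp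
  show "a - b = a + - b" by transfer simp
  show "s *\<^sub>C (a + b) = s *\<^sub>C a + s *\<^sub>C b" by transfer (simp add: scaleC_add_right)
  show "(s + t) *\<^sub>C a = s *\<^sub>C a + t *\<^sub>C a" by transfer (simp add: scaleC_add_left)
  show "s *\<^sub>C t *\<^sub>C a = (s * t) *\<^sub>C a" by transfer (simp add: scaleC_scaleC)
  show "1 *\<^sub>C a = a" by transfer simp
  show "a * b * c = a * (b * c)" by transfer (simp add: mult.assoc)
  show "(a + b) * c = a * c + b * c" by transfer (simp add: distrib_right)
  show "a * (b + c) = a * b + a * c" by transfer (simp add: distrib_left)
  show "1 * a = a" "a * 1 = a" by (transfer, simp)+
  show "(s *\<^sub>C a) * b = s *\<^sub>C (a * b)" by transfer (simp add: scaleC_mult_left)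
  show "a * (s *\<^sub>C b) = s *\<^sub>C (a * b)" by transfer (simp add: scaleC_mult_right)
  show "star (a + b) = star a + star b" by transfer (simp add: star_add)
  show "star (s *\<^sub>C a) = cnj s *\<^sub>C star a" by transfer (simp add: star_scaleC)
  show "star (a * b) = star b * star a" by transfer (simp add: star_mult)
  show "star (star a) = a" by transfer (simp add: star_star)
qed

end

definition essential_projection :: "'h::chilbert_space bop \<Rightarrow> bool" where
  "essential_projection P \<longleftrightarrow>
     positive_op P \<and> op_norm P \<le> 1 \<and> is_projection (calkin_proj P)"


section \<open>Unital completely positive maps and joint matrix ranges\<close>

text \<open>\<open>mat_star\<close> is the involution of \<open>M\<^sub>k(\<A>)\<close>: \<open>(X\<^sup>*)\<^sub>i\<^sub>j = (X\<^sub>j\<^sub>i)\<^sup>*\<close>. The \<open>mat_adjoint\<close> of the matrix library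
  assumes a multiplicative, not an anti-multiplicative, conjugation on the entries.\<close>

definition mat_star :: "'a::complex_star_algebra mat \<Rightarrow> 'a mat" where
  "mat_star X = map_mat star (transpose_mat X)"

text \<open>Positivity in \<open>M\<^sub>k(\<A>)\<close>. If \<open>\<A>\<close> is a C*-algebra then so is \<open>M\<^sub>k(\<A>)\<close>, and the positive
  elements of a C*-algebra are those of the form \<open>X\<^sup>* X\<close>.\<close>

definition positive_mat :: "nat \<Rightarrow> 'a::complex_star_algebra mat \<Rightarrow> bool" where
  "positive_mat k M \<longleftrightarrow> (\<exists>X \<in> carrier_mat k k. M = mat_star X * X)"

text \<open>The map \<open>[a\<^sub>i\<^sub>j] \<mapsto> [\<Phi>(a\<^sub>i\<^sub>j)]\<close> from \<open>M\<^sub>k(\<A>)\<close> to \<open>M\<^sub>k(M\<^sub>n)\<close>, the latter being identified with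
  \<open>M\<^sub>k\<^sub>n\<close> by erasing the inner brackets: row index \<open>i * n + p\<close> is row \<open>p\<close> of block row \<open>i\<close>.\<close>

definition amplification :: "nat \<Rightarrow> nat \<Rightarrow> ('a \<Rightarrow> complex mat) \<Rightarrow> 'a mat \<Rightarrow> complex mat" where
  "amplification k n \<Phi> M =
     mat (k * n) (k * n) (\<lambda>(r, s). \<Phi> (M $$ (r div n, s div n)) $$ (r mod n, s mod n))"

definition completely_positive ::
  "nat \<Rightarrow> ('a::complex_star_algebra \<Rightarrow> complex mat) \<Rightarrow> bool" where
  "completely_positive n \<Phi> \<longleftrightarrow>
     (\<forall>k M. positive_mat k M \<longrightarrow> positive_mat (k * n) (amplification k n \<Phi> M))"

text \<open>The definitions only use the *-structure and are stated for all unital complex *-algebras;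
  \<open>positive_mat\<close> has its usual meaning when \<open>\<A>\<close> is a C*-algebra, such as the operators on a
  Hilbert space, the Calkin algebra, or \<open>\<complex>\<close>.\<close>

definition UCP :: "nat \<Rightarrow> ('a::complex_star_algebra \<Rightarrow> complex mat) set" where
  "UCP n = {\<Phi>. (\<forall>a. \<Phi> a \<in> carrier_mat n n) \<and>
     (\<forall>a b. \<Phi> (a + b) = \<Phi> a + \<Phi> b) \<and> (\<forall>c a. \<Phi> (c *\<^sub>C a) = c \<cdot>\<^sub>m \<Phi> a) \<and>
     \<Phi> 1 = 1\<^sub>m n \<and> completely_positive n \<Phi>}"

definition matrix_range :: "nat \<Rightarrow> 'a::complex_star_algebra list \<Rightarrow> complex mat list set" where
  "matrix_range n As = {map \<Phi> As | \<Phi>. \<Phi> \<in> UCP n}"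

end

theory Submission
  imports Defs "HOL-Analysis.Analysis"
begin

text \<open>
  The obstruction is that three symmetries (self-adjoint unitaries) generate a representation of
  \<open>\<int>\<^sup>2 \<rtimes> GL\<^sub>2(\<int>)\<close>, and that this group has a form of Kazhdan's property (T) relative to \<open>\<int>\<^sup>2\<close>.

  Index an orthonormal basis by the torsion points \<open>x = (z, w)\<close> of the two-dimensional torus. The
  involutions \<open>(w, z)\<close>, \<open>(w / z, w)\<close> and \<open>(1 / z, w)\<close> of the torus permute the basis. This gives three symmetries
  \<open>U\<close>, \<open>V\<close>, \<open>W\<close>, where \<open>W\<close> also multiplies the basis vector of \<open>(z, w)\<close> by \<open>z\<close>. The projections are \<open>(1 \<plusminus> U) / 2\<close>,
  with difference \<open>U\<close>, and \<open>(1 + V) / 2\<close> and \<open>(1 + W) / 2\<close>. Every orbit of torsion points is finite, so the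
  operators are direct sums of finite blocks.

  Let \<open>K1, K2, K3\<close> be compact. They are small on all but finitely many basis vectors
  (\<open>finite_compact_op_large\<close>), hence on a whole finite invariant set \<open>F\<close> of torsion points
  (\<open>finite_invariant_set_avoiding\<close>). Take \<open>N = card F\<close>. The compression to the span of \<open>F\<close> is unital
  completely positive (\<open>compression_UCP\<close>), and it sends the perturbations of \<open>U\<close>, \<open>V\<close>, \<open>W\<close> almost to the
  restrictions \<open>u\<close>, \<open>v\<close>, \<open>w\<close> of \<open>U\<close>, \<open>V\<close>, \<open>W\<close> to that span. If the two matrix ranges were equal, some unital
  completely positive map on the Calkin algebra would send the images of \<open>U\<close>, \<open>V\<close>, \<open>W\<close> to the same matrices.

  Such a map gives a state on the \<open>N \<times> N\<close> matrices over the operators, vanishing on those with compact entries and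
  almost equal to 1 at the unitaries \<open>U \<otimes> cnj u\<close>, \<open>V \<otimes> cnj v\<close> and \<open>W \<otimes> cnj w\<close>. By the Cauchy-Schwarz inequality the
  state hardly changes under multiplication by these unitaries (\<open>mean_left_mult\<close>). Its restriction to the diagonal
  operators is a finitely additive measure on the pairs \<open>(x, y)\<close> with \<open>y \<in> F\<close>, almost invariant under the
  involutions (\<open>mean_diagonal_invariant\<close>); it has no mass at \<open>x = y\<close>, as there are only finitely many such pairs.
  A product of the unitaries is diagonal with entries depending on \<open>x / y\<close> only, and the state is almost 1
  there (\<open>mean_word\<close>), so the measure is concentrated where that entry is near 1. The image of the measure under
  \<open>x / y\<close> is therefore almost invariant and almost concentrated near the identity of the torus, without mass at the
  identity. There the involutions act linearly, and the linear action of \<open>GL\<^sub>2(\<int>)\<close> on \<open>\<real>\<^sup>2 - {0}\<close> is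
  paradoxical (\<open>no_almost_invariant_measure_near_identity\<close>). The estimates do not depend on \<open>F\<close>, which is why
  no choice of compact operators helps.
\<close>


section \<open>Orthonormal bases\<close>

locale orthonormal_basis =
  fixes e :: "'i \<Rightarrow> 'h::chilbert_space" and I :: "'i set"
  assumes orthonormal: "x \<in> I \<Longrightarrow> y \<in> I \<Longrightarrow> cinner (e x) (e y) = (if x = y then 1 else 0)"
    and complete: "(\<And>x. x \<in> I \<Longrightarrow> cinner (e x) v = 0) \<Longrightarrow> v = 0"

lemma cinner_sum_right: "cinner (x::'h::chilbert_space) (\<Sum>i\<in>S. f i) = (\<Sum>i\<in>S. cinner x (f i))"
  by (induction S rule: infinite_finite_induct) (simp_all add: cinner_add_right)

lemma cinner_sum_left: "cinner (\<Sum>i\<in>S. f i) (x::'h::chilbert_space) = (\<Sum>i\<in>S. cinner (f i) x)"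
  by (induction S rule: infinite_finite_induct) (simp_all add: cinner_add_left)

text \<open>Pythagoras: the subtracted sum is the orthogonal projection of \<open>v\<close> onto the span of \<open>e ` S\<close>.\<close>

lemma norm_diff_projection:
  fixes e :: "'i \<Rightarrow> 'h::chilbert_space"
  assumes S: "finite S"
    and on: "\<And>x y. x \<in> S \<Longrightarrow> y \<in> S \<Longrightarrow> cinner (e x) (e y) = (if x = y then 1 else 0)"
  shows "cinner (v - (\<Sum>x\<in>S. cinner (e x) v *\<^sub>C e x)) (v - (\<Sum>x\<in>S. cinner (e x) v *\<^sub>C e x))
    = complex_of_real ((norm v)\<^sup>2 - (\<Sum>x\<in>S. (cmod (cinner (e x) v))\<^sup>2))"
proof -
  have 1: "cinner (\<Sum>x\<in>S. cinner (e x) v *\<^sub>C e x) (\<Sum>x\<in>S. cinner (e x) v *\<^sub>C e x)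
      = (\<Sum>x\<in>S. (cinner (e x) v) * cnj (cinner (e x) v))"
  proof -
    have "cinner (e y) (\<Sum>x\<in>S. cinner (e x) v *\<^sub>C e x) = cinner (e y) v" if "y \<in> S" for y
    proof -
      have "cinner (e y) (\<Sum>x\<in>S. cinner (e x) v *\<^sub>C e x) = (\<Sum>x\<in>S. if x = y then cinner (e x) v else 0)"
        unfolding cinner_sum_right
        by (rule sum.cong[OF refl]) (auto simp: cinner_scaleC_right on that)
      then show ?thesis using S that by simp
    qed
    then show ?thesis
      by (subst cinner_sum_left) (simp add: cinner_scaleC_left mult.commute)
  qed
  have 2: "cinner v (\<Sum>x\<in>S. cinner (e x) v *\<^sub>C e x) = (\<Sum>x\<in>S. (cinner (e x) v) * cnj (cinner (e x) v))"
    by (simp add: cinner_sum_right cinner_scaleC_right cinner_commute[of v])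
  have 3: "cinner (\<Sum>x\<in>S. cinner (e x) v *\<^sub>C e x) v = (\<Sum>x\<in>S. (cinner (e x) v) * cnj (cinner (e x) v))"
    by (simp add: cinner_sum_left cinner_scaleC_left mult.commute)
  show ?thesis
    unfolding cinner_diff_left cinner_diff_right 1 2 3
    by (simp add: norm_sq_cinner[symmetric] complex_norm_square[symmetric])
qed

text \<open>A maximal orthonormal set is complete, because a nonzero vector orthogonal to it could be
  normalised and added. It is infinite, since otherwise it would span the space, and countable, since
  its points are at mutual distance \<open>\<surd>2\<close> in a separable space.\<close>

lemma orthonormal_basis_exists:
  assumes sep: "separable_type TYPE('h::chilbert_space)"
    and inf: "infinite_dimensional TYPE('h)"
    and J: "countable (J::'i set)" "infinite J"
  shows "\<exists>e::'i \<Rightarrow> 'h. orthonormal_basis e J"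
proof -
  define \<O> where "\<O> = {B::'h set. \<forall>x\<in>B. \<forall>y\<in>B. cinner x y = (if x = y then 1 else 0)}"
  have "\<exists>B\<in>\<O>. \<forall>C\<in>\<O>. B \<subseteq> C \<longrightarrow> C = B"
  proof (rule subset_Zorn')
    fix \<C> assume "subset.chain \<O> \<C>"
    then have sub: "\<C> \<subseteq> \<O>" and ch: "\<And>X Y. X \<in> \<C> \<Longrightarrow> Y \<in> \<C> \<Longrightarrow> X \<subseteq> Y \<or> Y \<subseteq> X"
      by (auto simp: subset_chain_def)
    show "\<Union>\<C> \<in> \<O>"
      unfolding \<O>_def
    proof (clarify)
      fix x y X Y assume xy: "x \<in> X" "X \<in> \<C>" "y \<in> Y" "Y \<in> \<C>"
      then obtain Z where "Z \<in> \<C>" "x \<in> Z" "y \<in> Z" using ch by blast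
      then show "cinner x y = (if x = y then 1 else 0)"
        using sub unfolding \<O>_def by blast
    qed
  qed
  then obtain B where B: "B \<in> \<O>" and max: "\<And>C. C \<in> \<O> \<Longrightarrow> B \<subseteq> C \<Longrightarrow> C = B" by blast
  have on: "cinner x y = (if x = y then 1 else 0)" if "x \<in> B" "y \<in> B" for x y
    using B that by (auto simp: \<O>_def)
  have comp: "v = 0" if v: "\<And>x. x \<in> B \<Longrightarrow> cinner x v = 0" for v
  proof (rule ccontr)
    assume v0: "v \<noteq> 0"
    define u where "u = complex_of_real (1 / norm v) *\<^sub>C v"
    have "norm u = 1" using v0 by (simp add: u_def norm_scaleC norm_divide)
    then have uu: "cinner u u = 1" using norm_sq_cinner[of u] by simp
    have bu: "cinner x u = 0" if "x \<in> B" for x using v[OF that] by (simp add: u_def cinner_scaleC_right)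
    have ub: "cinner u x = 0" if "x \<in> B" for x using bu[OF that] cinner_commute[of u x] by simp
    have "u \<notin> B" using bu uu by force
    moreover have "insert u B \<in> \<O>"
      unfolding \<O>_def using uu bu ub on \<open>u \<notin> B\<close> by auto
    ultimately show False using max by blast
  qed
  have "infinite B"
  proof
    assume fin: "finite B"
    interpret vector_space "scaleC :: complex \<Rightarrow> 'h \<Rightarrow> 'h"
      by (rule vector_space_scaleC)
    have "v \<in> span B" for v
    proof -
      define w where "w = (\<Sum>x\<in>B. cinner x v *\<^sub>C x)"
      have "v - w = 0"
      proof (rule comp)
        fix y assume y: "y \<in> B"
        have "cinner y w = (\<Sum>x\<in>B. if x = y then cinner x v else 0)"
          unfolding w_def cinner_sum_right
          by (rule sum.cong[OF refl]) (auto simp: cinner_scaleC_right on y)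
        then show "cinner y (v - w) = 0" using fin y by (simp add: cinner_diff_right)
      qed
      moreover have "w \<in> span B"
        unfolding w_def by (intro span_sum span_scale span_base)
      ultimately show ?thesis by simp
    qed
    then have "span B = UNIV" by blast
    then show False using inf fin unfolding infinite_dimensional_def by blast
  qed
  moreover have "countable B"
  proof -
    obtain S :: "'h set" where S: "countable S" "closure S = UNIV"
      using sep unfolding separable_type_def by blast
    have "\<exists>s\<in>S. dist s b < 1/2" for b
    proof -
      have "b \<in> closure S" by (simp add: S(2))
      then have "\<forall>\<epsilon>>0. \<exists>s\<in>S. dist s b < \<epsilon>" by (simp only: closure_approachable)
      then show ?thesis by (rule allE[of _ "1/2"]) simp
    qed
    then obtain f where f: "\<And>b. f b \<in> S" "\<And>b. dist (f b) b < 1/2" by metis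
    have "inj_on f B"
    proof (rule inj_onI, rule ccontr)
      fix a b assume ab: "a \<in> B" "b \<in> B" "f a = f b" "a \<noteq> b"
      have "(norm (a - b))\<^sup>2 = 2"
        unfolding norm_diff_sq unfolding norm_sq_Re_cinner using ab on by simp
      moreover have "norm (a - b) < 1"
        using f(2)[of a] f(2)[of b] ab(3) dist_triangle_half_r[of "f a" a 1 b] by (simp add: dist_norm)
      then have "(norm (a - b))\<^sup>2 < 1" by (simp add: power_less_one_iff abs_square_less_1)
      ultimately show False by simp
    qed
    then show ?thesis using f(1) S(1) by (meson countable_image_inj_on countable_subset image_subsetI)
  qed
  ultimately obtain e where e: "bij_betw e J B"
    using J by (meson bij_betw_from_nat_into bij_betw_trans bij_betw_the_inv_into)
  have "orthonormal_basis e J"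
  proof
    fix x y assume "x \<in> J" "y \<in> J"
    then show "cinner (e x) (e y) = (if x = y then 1 else 0)"
      using on[of "e x" "e y"] e by (auto simp: bij_betw_def inj_on_def)
  next
    fix v assume "\<And>x. x \<in> J \<Longrightarrow> cinner (e x) v = 0"
    then show "v = 0" using comp e by (metis bij_betw_iff_bijections)
  qed
  then show ?thesis by blast
qed

lemma bounded_mult_image:
  fixes f g :: "'i \<Rightarrow> complex"
  assumes "bounded (f ` S)" "bounded (g ` S)"
  shows "bounded ((\<lambda>x. f x * g x) ` S)"
proof -
  obtain A B where "\<And>x. x \<in> S \<Longrightarrow> cmod (f x) \<le> A" "\<And>x. x \<in> S \<Longrightarrow> cmod (g x) \<le> B"
    using assms unfolding bounded_iff by auto
  then have "cmod (f x * g x) \<le> A * B" if "x \<in> S" for x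
    unfolding norm_mult using that by (intro mult_mono) (auto intro: order_trans[OF norm_ge_zero])
  then show ?thesis unfolding bounded_iff by blast
qed

lemma bounded_const_image: "bounded ((\<lambda>_. c) ` S)"
  by (rule bounded_subset[of "{c}"]) auto

context orthonormal_basis
begin

lemma norm_basis: "x \<in> I \<Longrightarrow> norm (e x) = 1"
  using norm_sq_Re_cinner[of "e x"]
  by (simp add: orthonormal power2_eq_1_iff) (metis norm_ge_zero neg_0_le_iff_le not_one_le_zero)

lemma bessel:
  assumes "finite S" "S \<subseteq> I"
  shows "(\<Sum>x\<in>S. (cmod (cinner (e x) v))\<^sup>2) \<le> (norm v)\<^sup>2"
proof -
  let ?w = "v - (\<Sum>x\<in>S. cinner (e x) v *\<^sub>C e x)"
  have "complex_of_real ((norm ?w)\<^sup>2) = complex_of_real ((norm v)\<^sup>2 - (\<Sum>x\<in>S. (cmod (cinner (e x) v))\<^sup>2))"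
    unfolding norm_sq_cinner by (rule norm_diff_projection) (use assms orthonormal in blast)+
  then have "(norm ?w)\<^sup>2 = (norm v)\<^sup>2 - (\<Sum>x\<in>S. (cmod (cinner (e x) v))\<^sup>2)"
    by (simp only: of_real_eq_iff)
  then show ?thesis using zero_le_power2[of "norm ?w"] by linarith
qed

lemma cinner_basis_ext:
  assumes "\<And>x. x \<in> I \<Longrightarrow> cinner (e x) v = cinner (e x) w"
  shows "v = w"
  using complete[of "v - w"] assms by (simp add: cinner_diff_right)

lemma cinner_basis_ext_left:
  assumes "\<And>x. x \<in> I \<Longrightarrow> cinner v (e x) = cinner w (e x)"
  shows "v = w"
  using cinner_basis_ext[of v w] assms by (metis cinner_commute)

text \<open>The adjoint turns agreement on the basis into agreement of all basis coefficients of \<open>star S v\<close> and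
  \<open>star T v\<close>, for every \<open>v\<close>.\<close>

lemma bop_basis_ext:
  assumes "\<And>x. x \<in> I \<Longrightarrow> bop_apply S (e x) = bop_apply T (e x)"
  shows "S = T"
proof -
  have "star S = star T"
    by (rule bop_eqI, rule cinner_basis_ext) (simp add: star_bop_right assms)
  then show ?thesis by (metis star_star)
qed

text \<open>The vector represents the functional \<open>w \<mapsto> \<Sum>cnj (c x) \<langle>e x, w\<rangle>\<close>, whose series converges absolutely by the
  Cauchy-Schwarz and Bessel inequalities.\<close>

lemma riesz_fischer:
  assumes B: "B \<ge> 0" and c: "\<And>S. finite S \<Longrightarrow> S \<subseteq> I \<Longrightarrow> (\<Sum>x\<in>S. (cmod (c x))\<^sup>2) \<le> B\<^sup>2"
  shows "\<exists>v. (\<forall>x\<in>I. cinner (e x) v = c x) \<and> norm v \<le> B"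
proof -
  define t where "t w x = cnj (c x) * cinner (e x) w" for w x
  have bound: "(\<Sum>x\<in>S. cmod (t w x)) \<le> norm w * B" if S: "finite S" "S \<subseteq> I" for w S
  proof -
    have "(\<Sum>x\<in>S. cmod (t w x)) = (\<Sum>x\<in>S. \<bar>cmod (c x)\<bar> * \<bar>cmod (cinner (e x) w)\<bar>)"
      by (simp add: t_def norm_mult)
    also have "\<dots> \<le> L2_set (\<lambda>x. cmod (c x)) S * L2_set (\<lambda>x. cmod (cinner (e x) w)) S"
      by (rule L2_set_mult_ineq)
    also have "\<dots> \<le> B * norm w"
      unfolding L2_set_def using c[OF S] bessel[OF S, of w] B
      by (intro mult_mono real_le_lsqrt) (auto intro: sum_nonneg)
    finally show ?thesis by (simp add: mult.commute)
  qed
  have summ: "(\<lambda>x. cmod (t w x)) summable_on I" for w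
    using bound[of _ w] by (intro nonneg_bdd_above_summable_on) (auto intro!: bdd_aboveI2)
  then have summ': "t w summable_on I" for w by (rule abs_summable_summable)
  define f where "f w = infsum (t w) I" for w
  have "\<exists>z. \<forall>w. f w = cinner z w"
  proof (rule riesz_exists[where C = B])
    show "f (x + y) = f x + f y" for x y
    proof -
      have "t (x + y) = (\<lambda>i. t x i + t y i)" by (auto simp: t_def cinner_add_right algebra_simps)
      then show ?thesis unfolding f_def using infsum_add[OF summ' summ'] by simp
    qed
    show "f (a *\<^sub>C x) = a * f x" for a x
    proof -
      have "t (a *\<^sub>C x) = (\<lambda>i. a * t x i)" by (auto simp: t_def cinner_scaleC_right)
      then show ?thesis unfolding f_def using infsum_cmult_right'[of a "t x" I] by simp
    qed
    show "cmod (f w) \<le> norm w * B" for w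
    proof -
      have "cmod (f w) \<le> infsum (\<lambda>x. cmod (t w x)) I"
        unfolding f_def by (rule norm_infsum_bound) (use summ in simp)
      also have "\<dots> \<le> norm w * B"
        by (rule infsum_le_finite_sums[OF summ]) (rule bound)
      finally show ?thesis .
    qed
  qed
  then obtain z where z: "\<And>w. f w = cinner z w" by blast
  have fe: "cinner (e x) z = c x" if x: "x \<in> I" for x
  proof -
    have "t (e x) y = (if y = x then cnj (c x) else 0)" if "y \<in> I" for y
      using that x by (auto simp: t_def orthonormal)
    then have "f (e x) = infsum (\<lambda>y. if y = x then cnj (c x) else 0) I"
      unfolding f_def by (intro infsum_cong) auto
    also have "\<dots> = infsum (\<lambda>y. if y = x then cnj (c x) else 0) {x}"
      using x by (intro infsum_cong_neutral) auto
    also have "\<dots> = cnj (c x)" by simp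
    finally have "cinner z (e x) = cnj (c x)" by (simp add: z)
    then show ?thesis by (metis cinner_commute complex_cnj_cnj)
  qed
  moreover have "norm z \<le> B"
  proof (cases "z = 0")
    case False
    have "cmod (f z) \<le> norm z * B"
    proof -
      have "cmod (f z) \<le> infsum (\<lambda>x. cmod (t z x)) I"
        unfolding f_def by (rule norm_infsum_bound) (use summ in simp)
      also have "\<dots> \<le> norm z * B"
        by (rule infsum_le_finite_sums[OF summ]) (rule bound)
      finally show ?thesis .
    qed
    then have "norm z * norm z \<le> norm z * B"
      by (simp add: z norm_sq_cinner[symmetric] norm_power power2_eq_square[symmetric])
    then show ?thesis using False by simp
  qed (use B in simp)
  ultimately show ?thesis by blast
qed

subsection \<open>Monomial operators\<close>

text \<open>Composing with the inverse of \<open>\<rho>\<close> only permutes the coefficients of a vector, so the image of a vector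
  is given by the Riesz-Fischer lemma.\<close>

lemma monomial_exists:
  assumes \<rho>: "bij_betw \<rho> I I" and g: "bounded (g ` I)"
  shows "\<exists>U. \<forall>x\<in>I. bop_apply U (e x) = g x *\<^sub>C e (\<rho> x)"
proof -
  obtain B where B: "B > 0" "\<And>x. x \<in> I \<Longrightarrow> cmod (g x) \<le> B" using g unfolding bounded_pos by auto
  define r where "r = inv_into I \<rho>"
  have rI: "r y \<in> I" and \<rho>r: "\<rho> (r y) = y" if "y \<in> I" for y
    using that \<rho> unfolding r_def bij_betw_def by (auto simp: inv_into_into f_inv_into_f)
  have r\<rho>: "r (\<rho> x) = x" and \<rho>I: "\<rho> x \<in> I" if "x \<in> I" for x
    using that \<rho> unfolding r_def by (auto simp: bij_betw_def)
  have injr: "inj_on r S" if "S \<subseteq> I" for S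
    using that \<rho>r by (metis inj_onI subsetD)
  have "\<exists>w. (\<forall>y\<in>I. cinner (e y) w = g (r y) * cinner (e (r y)) v) \<and> norm w \<le> norm v * B" for v
  proof (rule riesz_fischer)
    fix S assume S: "finite S" "S \<subseteq> I"
    have "(\<Sum>y\<in>S. (cmod (g (r y) * cinner (e (r y)) v))\<^sup>2) \<le> (\<Sum>y\<in>S. B\<^sup>2 * (cmod (cinner (e (r y)) v))\<^sup>2)"
    proof (rule sum_mono)
      fix y assume "y \<in> S"
      then have "cmod (g (r y)) \<le> B" using B rI S by blast
      then show "(cmod (g (r y) * cinner (e (r y)) v))\<^sup>2 \<le> B\<^sup>2 * (cmod (cinner (e (r y)) v))\<^sup>2"
        unfolding norm_mult power_mult_distrib by (intro mult_right_mono power_mono) auto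
    qed
    also have "\<dots> = B\<^sup>2 * (\<Sum>x\<in>r ` S. (cmod (cinner (e x) v))\<^sup>2)"
      using injr[OF S(2)] by (simp add: sum.reindex sum_distrib_left)
    also have "\<dots> \<le> B\<^sup>2 * (norm v)\<^sup>2" using S rI by (intro mult_left_mono bessel) auto
    finally show "(\<Sum>y\<in>S. (cmod (g (r y) * cinner (e (r y)) v))\<^sup>2) \<le> (norm v * B)\<^sup>2"
      by (simp add: power_mult_distrib mult.commute)
  qed (use B in simp)
  then obtain h where h: "\<And>v y. y \<in> I \<Longrightarrow> cinner (e y) (h v) = g (r y) * cinner (e (r y)) v"
    "\<And>v. norm (h v) \<le> norm v * B" by metis
  have "\<exists>U. \<forall>v. bop_apply U v = h v"
  proof (rule bop_exists[where K = B])
    show "h (x + y) = h x + h y" for x y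
      by (rule cinner_basis_ext) (simp add: h cinner_add_right algebra_simps)
    show "h (c *\<^sub>C x) = c *\<^sub>C h x" for c x
      by (rule cinner_basis_ext) (simp add: h cinner_scaleC_right)
  qed (simp add: h)
  then obtain U where U: "\<And>v. bop_apply U v = h v" by blast
  have "bop_apply U (e x) = g x *\<^sub>C e (\<rho> x)" if x: "x \<in> I" for x
  proof (rule cinner_basis_ext)
    fix y assume y: "y \<in> I"
    have "y = \<rho> x \<longleftrightarrow> r y = x" using x y r\<rho> \<rho>r by auto
    then show "cinner (e y) (bop_apply U (e x)) = cinner (e y) (g x *\<^sub>C e (\<rho> x))"
      using x y by (auto simp: U h cinner_scaleC_right orthonormal rI \<rho>I)
  qed
  then show ?thesis by blast
qed

text \<open>The choice is unique by \<open>bop_basis_ext\<close>, and legitimate if \<open>\<rho>\<close> permutes \<open>I\<close> and \<open>g\<close> is bounded on \<open>I\<close>.\<close>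

definition monomial :: "('i \<Rightarrow> complex) \<Rightarrow> ('i \<Rightarrow> 'i) \<Rightarrow> 'h bop" where
  "monomial g \<rho> = (SOME U. \<forall>x\<in>I. bop_apply U (e x) = g x *\<^sub>C e (\<rho> x))"

lemma monomial_apply:
  assumes "bij_betw \<rho> I I" "bounded (g ` I)" "x \<in> I"
  shows "bop_apply (monomial g \<rho>) (e x) = g x *\<^sub>C e (\<rho> x)"
  using someI_ex[OF monomial_exists[OF assms(1,2)]] assms(3) unfolding monomial_def by simp

lemma monomial_cong:
  assumes "\<And>x. x \<in> I \<Longrightarrow> g x = h x" "\<And>x. x \<in> I \<Longrightarrow> \<rho> x = \<sigma> x"
  shows "monomial g \<rho> = monomial h \<sigma>"
  using assms by (simp add: monomial_def)

lemma monomial_eqI: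
  assumes "bij_betw \<rho> I I" "bounded (g ` I)"
    and "\<And>x. x \<in> I \<Longrightarrow> bop_apply T (e x) = g x *\<^sub>C e (\<rho> x)"
  shows "T = monomial g \<rho>"
  by (rule bop_basis_ext) (simp add: assms monomial_apply)

lemma monomial_times:
  assumes \<rho>: "bij_betw \<rho> I I" "bounded (g ` I)" and \<sigma>: "bij_betw \<sigma> I I" "bounded (h ` I)"
  shows "monomial g \<rho> * monomial h \<sigma> = monomial (\<lambda>x. g (\<sigma> x) * h x) (\<rho> \<circ> \<sigma>)"
proof (rule monomial_eqI)
  show "bij_betw (\<rho> \<circ> \<sigma>) I I" using \<rho>(1) \<sigma>(1) by (rule bij_betw_trans[rotated])
  have "(\<lambda>x. g (\<sigma> x)) ` I = g ` I" using \<sigma>(1) by (metis bij_betw_imp_surj_on image_image)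
  then show "bounded ((\<lambda>x. g (\<sigma> x) * h x) ` I)" using \<rho>(2) \<sigma>(2) by (simp add: bounded_mult_image)
  show "bop_apply (monomial g \<rho> * monomial h \<sigma>) (e x) = (g (\<sigma> x) * h x) *\<^sub>C e ((\<rho> \<circ> \<sigma>) x)" if "x \<in> I" for x
    using that bij_betwE[OF \<sigma>(1)]
    by (simp add: monomial_apply \<rho> \<sigma> bop_apply_scaleC scaleC_scaleC mult.commute)
qed

lemma monomial_one: "monomial (\<lambda>_. 1) id = 1"
  by (rule monomial_eqI[symmetric]) (auto simp: bounded_const_image)

lemma scaleC_monomial:
  assumes "bij_betw \<rho> I I" "bounded (g ` I)"
  shows "c *\<^sub>C monomial g \<rho> = monomial (\<lambda>x. c * g x) \<rho>"
  by (rule monomial_eqI) (auto simp: assms monomial_apply scaleC_scaleC bounded_mult_image bounded_const_image)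

lemma monomial_add:
  assumes "bij_betw \<rho> I I" "bounded (g ` I)" "bounded (h ` I)"
  shows "monomial g \<rho> + monomial h \<rho> = monomial (\<lambda>x. g x + h x) \<rho>"
  by (rule monomial_eqI) (auto simp: assms monomial_apply scaleC_add_left bounded_plus_comp)

lemma star_monomial:
  assumes \<rho>: "bij_betw \<rho> I I" "\<And>x. x \<in> I \<Longrightarrow> \<rho> (\<rho> x) = x" and g: "bounded (g ` I)"
  shows "star (monomial g \<rho>) = monomial (\<lambda>x. cnj (g (\<rho> x))) \<rho>"
proof (rule monomial_eqI[OF \<rho>(1)])
  have I: "\<rho> x \<in> I" if "x \<in> I" for x using bij_betwE[OF \<rho>(1)] that by blast
  show "bounded ((\<lambda>x. cnj (g (\<rho> x))) ` I)"
    using g I by (auto simp: bounded_iff)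
  fix x assume x: "x \<in> I"
  show "bop_apply (star (monomial g \<rho>)) (e x) = cnj (g (\<rho> x)) *\<^sub>C e (\<rho> x)"
  proof (rule cinner_basis_ext_left)
    fix y assume y: "y \<in> I"
    have "x = \<rho> y \<longleftrightarrow> \<rho> x = y" using x y \<rho>(2) by auto
    then show "cinner (bop_apply (star (monomial g \<rho>)) (e x)) (e y) = cinner (cnj (g (\<rho> x)) *\<^sub>C e (\<rho> x)) (e y)"
      using x y I by (auto simp: star_bop_left monomial_apply \<rho> g cinner_scaleC_left cinner_scaleC_right orthonormal)
  qed
qed

lemma star_monomial_times_self:
  assumes \<rho>: "bij_betw \<rho> I I" and g: "bounded (g ` I)"
  shows "star (monomial g \<rho>) * monomial g \<rho> = monomial (\<lambda>x. cnj (g x) * g x) id"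
proof (rule monomial_eqI)
  show "bounded ((\<lambda>x. cnj (g x) * g x) ` I)"
    using g by (intro bounded_mult_image) (auto simp: bounded_iff)
  fix x assume x: "x \<in> I"
  show "bop_apply (star (monomial g \<rho>) * monomial g \<rho>) (e x) = (cnj (g x) * g x) *\<^sub>C e (id x)"
  proof (rule cinner_basis_ext_left)
    fix y assume y: "y \<in> I"
    have "\<rho> x = \<rho> y \<longleftrightarrow> x = y" "\<rho> x \<in> I" "\<rho> y \<in> I"
      using x y \<rho> by (auto simp: bij_betw_def inj_on_eq_iff)
    then show "cinner (bop_apply (star (monomial g \<rho>) * monomial g \<rho>) (e x)) (e y)
        = cinner ((cnj (g x) * g x) *\<^sub>C e (id x)) (e y)"
      using x y by (auto simp: star_bop_left monomial_apply \<rho> g cinner_scaleC_left cinner_scaleC_right orthonormal)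
  qed
qed auto

text \<open>A diagonal operator supported at one basis vector has rank one.\<close>

lemma compact_op_monomial_at:
  assumes y: "y \<in> I"
  shows "compact_op (monomial (\<lambda>x. if x = y then 1 else 0) id)"
proof -
  let ?D = "monomial (\<lambda>x. if x = y then 1 else 0) id"
  have D: "bop_apply ?D v = cinner (e y) v *\<^sub>C e y" for v
  proof (rule cinner_basis_ext)
    fix x assume x: "x \<in> I"
    have b: "bounded ((\<lambda>x. if x = y then 1 else 0 :: complex) ` I)" by (auto simp: bounded_iff intro: exI[of _ 1])
    have "star ?D = ?D"
      using star_monomial[OF _ _ b, of id] by (auto intro!: monomial_cong)
    then have "cinner (e x) (bop_apply ?D v) = cinner (bop_apply ?D (e x)) v" by (metis star_bop_right)
    also have "\<dots> = cinner ((if x = y then 1 else 0) *\<^sub>C e x) v"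
      using x by (subst monomial_apply[OF _ b]) auto
    finally show "cinner (e x) (bop_apply ?D v) = cinner (e x) (cinner (e y) v *\<^sub>C e y)"
      using x y by (simp add: cinner_scaleC_right orthonormal)
  qed
  note ney = norm_basis[OF y]
  have lin: "bounded_linear (\<lambda>c. c *\<^sub>C e y)"
    by (rule bounded_linear_intro[where K = 1])
      (simp_all add: scaleC_add_left scaleR_scaleC scaleC_scaleC norm_scaleC ney scaleR_conv_of_real)
  show ?thesis
  proof (rule compact_opI)
    show "compact ((\<lambda>c. c *\<^sub>C e y) ` cball 0 1)"
      using lin by (intro compact_continuous_image linear_continuous_on) auto
    fix v :: 'h assume "norm v \<le> 1"
    then have "cmod (cinner (e y) v) \<le> 1" using Cauchy_Schwarz_cinner[of "e y" v] ney by simp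
    then show "bop_apply ?D v \<in> (\<lambda>c. c *\<^sub>C e y) ` cball 0 1" unfolding D by (auto simp: mem_cball_0)
  qed
qed

text \<open>Vectors of an orthonormal sequence converge weakly to zero, and a compact operator turns weak
  into norm convergence.\<close>

lemma finite_compact_op_large:
  assumes K: "compact_op K" and \<delta>: "\<delta> > 0"
  shows "finite {x \<in> I. norm (bop_apply K (e x)) \<ge> \<delta>}"
proof (rule ccontr)
  let ?L = "{x \<in> I. norm (bop_apply K (e x)) \<ge> \<delta>}"
  assume "infinite ?L"
  then obtain s :: "nat \<Rightarrow> 'i" where s: "inj s" "range s \<subseteq> ?L"
    using infinite_countable_subset by blast
  obtain T where T: "compact T" "\<And>x. norm x \<le> 1 \<Longrightarrow> bop_apply K x \<in> T"
    using compact_opE[OF K] by metis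
  have sI: "s n \<in> I" and sd: "norm (bop_apply K (e (s n))) \<ge> \<delta>" for n using s(2) by auto
  have "\<forall>n. bop_apply K (e (s n)) \<in> T" using T(2) sI by (simp add: norm_basis)
  then obtain v r where r: "strict_mono r" and lim: "((\<lambda>n. bop_apply K (e (s n))) \<circ> r) \<longlonglongrightarrow> v"
    using T(1) unfolding compact_def by metis
  have "(\<lambda>n. norm (bop_apply K (e (s (r n))))) \<longlonglongrightarrow> norm v"
    using tendsto_norm[OF lim] by (simp add: o_def)
  then have nv: "\<delta> \<le> norm v" using sd by (intro LIMSEQ_le_const) auto
  have "\<forall>\<^sub>F n in sequentially. dist (bop_apply K (e (s (r n)))) v < norm v / 2"
  proof -
    have "norm v / 2 > 0" using nv \<delta> by linarith
    from tendstoD[OF lim this] show ?thesis by (simp only: o_def)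
  qed
  then obtain n0 where n0: "\<And>n. n \<ge> n0 \<Longrightarrow> norm (bop_apply K (e (s (r n))) - v) < norm v / 2"
    by (auto simp: eventually_sequentially dist_norm)
  define w where "w = bop_apply (star K) v"
  have big: "(norm v)\<^sup>2 / 2 \<le> cmod (cinner (e (s (r n))) w)" if "n \<ge> n0" for n
  proof -
    let ?k = "bop_apply K (e (s (r n)))"
    have "cinner (e (s (r n))) w = cinner ?k v" by (simp add: w_def star_bop_right)
    also have "\<dots> = cinner v v + cinner (?k - v) v" by (simp add: cinner_diff_left)
    finally have eq: "cinner (e (s (r n))) w = complex_of_real ((norm v)\<^sup>2) + cinner (?k - v) v"
      by (simp only: norm_sq_cinner)
    have "cmod (cinner (?k - v) v) \<le> norm (?k - v) * norm v" by (rule Cauchy_Schwarz_cinner)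
    also have "\<dots> \<le> norm v / 2 * norm v"
      using n0[OF that] by (intro mult_right_mono) auto
    finally have "cmod (cinner (?k - v) v) \<le> (norm v)\<^sup>2 / 2" by (simp add: power2_eq_square)
    moreover have "(norm v)\<^sup>2 - cmod (cinner (?k - v) v) \<le> cmod (complex_of_real ((norm v)\<^sup>2) + cinner (?k - v) v)"
      using norm_diff_ineq[of "complex_of_real ((norm v)\<^sup>2)" "cinner (?k - v) v"]
      by (simp add: norm_power)
    ultimately show ?thesis unfolding eq by linarith
  qed
  define a where "a = ((norm v)\<^sup>2 / 2)\<^sup>2"
  have "v \<noteq> 0" using nv \<delta> by auto
  then have a: "a > 0" by (simp add: a_def)
  obtain m where m: "(norm w)\<^sup>2 < real m * a" using a by (metis reals_Archimedean3)
  let ?S = "(\<lambda>n. s (r n)) ` {n0..<n0+m}"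
  have inj: "inj_on (\<lambda>n. s (r n)) {n0..<n0+m}"
    by (rule inj_onI) (metis injD s(1) strict_mono_eq r)
  have "real m * a = (\<Sum>n\<in>{n0..<n0+m}. a)" by simp
  also have "\<dots> \<le> (\<Sum>n\<in>{n0..<n0+m}. (cmod (cinner (e (s (r n))) w))\<^sup>2)"
    unfolding a_def using big by (intro sum_mono power_mono) auto
  also have "\<dots> = (\<Sum>x\<in>?S. (cmod (cinner (e x) w))\<^sup>2)" using inj by (simp add: sum.reindex)
  also have "\<dots> \<le> (norm w)\<^sup>2" using sI by (intro bessel) auto
  finally show False using m by simp
qed

end

lemma cnj_mult_self_nonneg: "cnj w * w \<in> \<real>\<^sub>\<ge>\<^sub>0"
  by (simp add: complex_nonneg_Reals_iff)

lemma sum_nonneg_Reals: "(\<And>i. i \<in> S \<Longrightarrow> f i \<in> \<real>\<^sub>\<ge>\<^sub>0) \<Longrightarrow> (\<Sum>i\<in>S. f i) \<in> (\<real>\<^sub>\<ge>\<^sub>0 :: complex set)"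
  by (induction S rule: infinite_finite_induct) (auto intro: nonneg_Reals_add_I)

text \<open>For a positive sesquilinear form, the hypothesis is positivity on the vectors \<open>x + cy\<close>, with \<open>a = \<langle>x, x\<rangle>\<close>,
  \<open>b = \<langle>x, y\<rangle>\<close>, \<open>b' = \<langle>y, x\<rangle>\<close> and \<open>d = \<langle>y, y\<rangle>\<close>. The first conclusion comes from \<open>c = 1\<close> and \<open>c = \<i>\<close>, the second
  from the minimum over the multiples \<open>c\<close> of \<open>cnj b\<close>.\<close>

lemma positive_form_hermitian_Cauchy_Schwarz:
  fixes a b b' d :: complex
  assumes pos: "\<And>c. a + c * b + cnj c * b' + cnj c * c * d \<in> \<real>\<^sub>\<ge>\<^sub>0" and d: "d \<in> \<real>\<^sub>\<ge>\<^sub>0"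
  shows "b' = cnj b" and "(cmod b)\<^sup>2 \<le> Re a * Re d"
proof -
  have a: "Re a \<ge> 0" "Im a = 0" using pos[of 0] by (simp_all add: complex_nonneg_Reals_iff)
  have d': "Re d \<ge> 0" "Im d = 0" using d by (simp_all add: complex_nonneg_Reals_iff)
  show b': "b' = cnj b"
    using pos[of 1] pos[of \<i>] a d' by (simp add: complex_nonneg_Reals_iff complex_eq_iff)
  have Re: "Re a + 2 * Re (c * b) + (cmod c)\<^sup>2 * Re d \<ge> 0" for c
  proof -
    have "Re (a + c * b + cnj c * b' + cnj c * c * d) = Re a + 2 * Re (c * b) + (cmod c)\<^sup>2 * Re d"
    proof -
      have "cnj c * c = complex_of_real ((cmod c)\<^sup>2)" by (simp only: complex_norm_square mult.commute)
      moreover have "Re (cnj c * cnj b) = Re (c * b)" by simp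
      ultimately show ?thesis by (simp only: b' plus_complex.sel Re_complex_of_real times_complex.sel Im_complex_of_real, simp)
    qed
    then show ?thesis using pos[of c] by (metis complex_nonneg_Reals_iff)
  qed
  have bb: "Re (complex_of_real t * cnj b * b) = t * (cmod b)\<^sup>2" for t
    unfolding cmod_power2 by (simp add: power2_eq_square algebra_simps)
  show "(cmod b)\<^sup>2 \<le> Re a * Re d"
  proof (cases "Re d = 0")
    case True
    have "b = 0"
    proof (rule ccontr)
      assume "b \<noteq> 0"
      define t where "t = - (Re a + 1) / (cmod b)\<^sup>2"
      have "t * (cmod b)\<^sup>2 = - (Re a + 1)" using \<open>b \<noteq> 0\<close> by (simp add: t_def)
      then show False using Re[of "complex_of_real t * cnj b"] a True unfolding bb by simp
    qed
    then show ?thesis using a d' by simp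
  next
    case False
    then have d0: "Re d > 0" using d' by simp
    define t where "t = - 1 / Re d"
    have "(cmod (complex_of_real t * cnj b))\<^sup>2 * Re d = - t * (cmod b)\<^sup>2"
    proof -
      have "t\<^sup>2 * Re d = - t" using d0 by (simp add: t_def power2_eq_square)
      moreover have "(cmod (complex_of_real t * cnj b))\<^sup>2 = t\<^sup>2 * (cmod b)\<^sup>2"
        by (simp add: norm_mult power_mult_distrib)
      ultimately show ?thesis by (metis mult.assoc mult.commute)
    qed
    then have "Re a + t * (cmod b)\<^sup>2 \<ge> 0"
      using Re[of "complex_of_real t * cnj b"] unfolding bb by linarith
    then show ?thesis using d0 by (simp add: t_def field_simps)
  qed
qed


section \<open>Compressions are completely positive\<close>

text \<open>Cholesky decomposition: the last row and column of a positive matrix are removed by subtracting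
  a rank one matrix, and what remains is the Schur complement, which is again positive.\<close>

lemma positive_semidefinite_factorization:
  fixes G :: "nat \<Rightarrow> nat \<Rightarrow> complex"
  assumes "\<And>c. (\<Sum>r<m. \<Sum>s<m. cnj (c r) * G r s * c s) \<in> \<real>\<^sub>\<ge>\<^sub>0"
  shows "\<exists>Y. \<forall>r<m. \<forall>s<m. G r s = (\<Sum>l<m. cnj (Y l r) * Y l s)"
  using assms
proof (induction m arbitrary: G)
  case 0
  then show ?case by simp
next
  case (Suc m)
  note pos = Suc.prems
  have diag: "G r r \<in> \<real>\<^sub>\<ge>\<^sub>0" if "r < Suc m" for r
  proof -
    have "(\<Sum>i<Suc m. \<Sum>j<Suc m. cnj (if i = r then 1 else 0) * G i j * (if j = r then 1 else 0)) = G r r"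
      using that by (simp add: if_distrib[of cnj] if_distrib[of "\<lambda>x. x * _"] if_distrib[of "\<lambda>x. _ * x"]
          sum.delta cong: if_cong del: sum.lessThan_Suc)
    then show ?thesis using pos[of "\<lambda>i. if i = r then 1 else 0"] by simp
  qed
  have two: "G r r + c * G r s + cnj c * G s r + cnj c * c * G s s \<in> \<real>\<^sub>\<ge>\<^sub>0"
    if rs: "r < Suc m" "s < Suc m" "r \<noteq> s" for r s c
  proof -
    define x where "x i = (if i = r then 1 else if i = s then c else 0)" for i
    have "(\<Sum>j<Suc m. cnj (x i) * G i j * x j) = (\<Sum>j\<in>{r,s}. cnj (x i) * G i j * x j)" for i
      using rs by (intro sum.mono_neutral_right) (auto simp: x_def)
    then have "(\<Sum>i<Suc m. \<Sum>j<Suc m. cnj (x i) * G i j * x j) = (\<Sum>i<Suc m. \<Sum>j\<in>{r,s}. cnj (x i) * G i j * x j)"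
      by (simp only:)
    also have "\<dots> = (\<Sum>i\<in>{r,s}. \<Sum>j\<in>{r,s}. cnj (x i) * G i j * x j)"
      using rs by (intro sum.mono_neutral_right) (auto simp: x_def)
    also have "\<dots> = G r r + c * G r s + cnj c * G s r + cnj c * c * G s s"
      using rs by (simp add: x_def algebra_simps)
    finally show ?thesis using pos[of x] by simp
  qed
  have herm: "G s r = cnj (G r s)" if "r < Suc m" "s < Suc m" for r s
  proof (cases "r = s")
    case True
    then show ?thesis using diag[OF that(1)] by (simp add: complex_nonneg_Reals_iff complex_eq_iff)
  qed (use positive_form_hermitian_Cauchy_Schwarz(1)[OF two[OF that] diag[OF that(2)]] in simp)
  define d where "d = Re (G m m)"
  have d: "d \<ge> 0" "G m m = complex_of_real d"
    using diag[of m] by (auto simp: d_def complex_nonneg_Reals_iff complex_eq_iff)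
  have col0: "G m s = 0" if "s < Suc m" "d = 0" for s
  proof (cases "s = m")
    case False
    have "(cmod (G s m))\<^sup>2 \<le> Re (G s s) * Re (G m m)"
      using positive_form_hermitian_Cauchy_Schwarz(2)[OF two[of s m] diag[of m]] that False by simp
    then have "G s m = 0" using that(2) by (simp add: d)
    then show ?thesis using herm[of s m] that by simp
  qed (use d that in simp)
  \<comment> \<open>If \<open>d = 0\<close> then the quotients are 0 by convention, and correct because the last row vanishes.\<close>
  define G' where "G' r s = G r s - G r m * G m s / complex_of_real d" for r s
  have "(\<Sum>r<m. \<Sum>s<m. cnj (c r) * G' r s * c s) \<in> \<real>\<^sub>\<ge>\<^sub>0" for c
  proof -
    define S where "S = (\<Sum>s<m. G m s * c s)"
    have S': "(\<Sum>r<m. cnj (c r) * G r m) = cnj S"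
      unfolding S_def by (auto intro!: sum.cong simp: herm[of m])
    define x where "x i = (if i = m then - S / complex_of_real d else c i)" for i
    have "(\<Sum>r<Suc m. \<Sum>s<Suc m. cnj (x r) * G r s * x s)
      = (\<Sum>r<m. \<Sum>s<m. cnj (c r) * G r s * c s) + (\<Sum>r<m. cnj (c r) * G r m) * x m
        + cnj (x m) * S + cnj (x m) * G m m * x m"
    proof -
      have xc: "x s = c s" if "s < m" for s using that by (simp add: x_def)
      have "(\<Sum>r<Suc m. \<Sum>s<Suc m. cnj (x r) * G r s * x s)
        = (\<Sum>r<m. (\<Sum>s<m. cnj (c r) * G r s * c s) + cnj (c r) * G r m * x m)
          + ((\<Sum>s<m. cnj (x m) * G m s * c s) + cnj (x m) * G m m * x m)"
        by (simp add: xc cong: sum.cong_simp)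
      then show ?thesis
        by (simp add: sum.distrib sum_distrib_right S_def sum_distrib_left mult.assoc)
    qed
    also have "\<dots> = (\<Sum>r<m. \<Sum>s<m. cnj (c r) * G r s * c s) - cnj S * S / complex_of_real d"
      by (cases "d = 0") (simp_all add: S' x_def d)
    also have "cnj S * S / complex_of_real d = (\<Sum>r<m. \<Sum>s<m. cnj (c r) * (G r m * G m s / complex_of_real d) * c s)"
      unfolding S'[symmetric] unfolding S_def sum_product
      by (simp add: sum_divide_distrib algebra_simps)
    also have "(\<Sum>r<m. \<Sum>s<m. cnj (c r) * G r s * c s) - \<dots> = (\<Sum>r<m. \<Sum>s<m. cnj (c r) * G' r s * c s)"
      by (simp add: G'_def sum_subtractf[symmetric] algebra_simps)
    finally show ?thesis using pos[of x] by simp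
  qed
  then have "\<exists>Y. \<forall>r<m. \<forall>s<m. G' r s = (\<Sum>l<m. cnj (Y l r) * Y l s)"
    by (rule Suc.IH)
  then obtain Y where Y: "\<And>r s. r < m \<Longrightarrow> s < m \<Longrightarrow> G' r s = (\<Sum>l<m. cnj (Y l r) * Y l s)"
    by metis
  define Z where "Z l s = (if l = m then G m s / complex_of_real (sqrt d) else if s = m then 0 else Y l s)" for l s
  have sq: "complex_of_real (sqrt d) * complex_of_real (sqrt d) = complex_of_real d"
    using d by (simp flip: of_real_mult)
  have "G r s = (\<Sum>l<Suc m. cnj (Z l r) * Z l s)" if rs: "r < Suc m" "s < Suc m" for r s
  proof -
    have last: "cnj (Z m r) * Z m s = G r m * G m s / complex_of_real d"
      using herm[of m r] rs sq by (simp add: Z_def)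
    have rest: "(\<Sum>l<m. cnj (Z l r) * Z l s) = (if r < m \<and> s < m then G' r s else 0)"
      using rs by (auto simp: Z_def Y intro!: sum.cong sum.neutral)
    show ?thesis
    proof (cases "r < m \<and> s < m")
      case True
      then show ?thesis using last rest by (simp add: G'_def)
    next
      case False
      have "G r s = G r m * G m s / complex_of_real d"
      proof (cases "d = 0")
        case True
        then show ?thesis using False rs col0[of r] col0[of s] herm[of m r] by (cases "r = m") (auto simp: less_Suc_eq)
      next
        case d0: False
        then show ?thesis using False rs by (cases "r = m") (auto simp: d less_Suc_eq)
      qed
      moreover have "(\<Sum>l<m. cnj (Z l r) * Z l s) = 0" using False rest by (simp only: if_False)
      ultimately show ?thesis using last by simp
    qed
  qed
  then show ?case by blast
qed

lemma index_mat_star_times_self: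
  fixes X :: "'a::complex_star_algebra mat"
  assumes "X \<in> carrier_mat k k" "i < k" "j < k"
  shows "(mat_star X * X) $$ (i, j) = (\<Sum>l<k. star (X $$ (l, i)) * X $$ (l, j))"
  using assms by (simp add: mat_star_def scalar_prod_def atLeast0LessThan)

lemma bop_apply_sum: "bop_apply (\<Sum>i\<in>S. T i) x = (\<Sum>i\<in>S. bop_apply (T i) x)"
  by (induction S rule: infinite_finite_induct) simp_all

definition compression :: "nat \<Rightarrow> (nat \<Rightarrow> 'h) \<Rightarrow> 'h::chilbert_space bop \<Rightarrow> complex mat" where
  "compression n f T = mat n n (\<lambda>(i, j). cinner (f i) (bop_apply T (f j)))"

lemma compression_UCP:
  fixes f :: "nat \<Rightarrow> 'h::chilbert_space"
  assumes on: "\<And>i j. i < n \<Longrightarrow> j < n \<Longrightarrow> cinner (f i) (f j) = (if i = j then 1 else 0)"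
  shows "compression n f \<in> UCP n"
proof -
  have "completely_positive n (compression n f)"
    unfolding completely_positive_def
  proof (intro allI impI)
    fix k and M :: "'h bop mat" assume "positive_mat k M"
    then obtain X where X: "X \<in> carrier_mat k k" and M: "M = mat_star X * X"
      unfolding positive_mat_def by blast
    define v where "v l r = bop_apply (X $$ (l, r div n)) (f (r mod n))" for l r
    define G where "G r s = (\<Sum>l<k. cinner (v l r) (v l s))" for r s
    have "\<exists>Y. \<forall>r<k*n. \<forall>s<k*n. G r s = (\<Sum>l<k*n. cnj (Y l r) * Y l s)"
    proof (rule positive_semidefinite_factorization)
      fix c :: "nat \<Rightarrow> complex"
      have "(\<Sum>r<k*n. \<Sum>s<k*n. cnj (c r) * G r s * c s)
        = (\<Sum>r<k*n. \<Sum>s<k*n. \<Sum>l<k. cnj (c r) * cinner (v l r) (v l s) * c s)"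
        by (simp add: G_def sum_distrib_left sum_distrib_right)
      also have "\<dots> = (\<Sum>r<k*n. \<Sum>l<k. \<Sum>s<k*n. cnj (c r) * cinner (v l r) (v l s) * c s)"
        by (rule sum.cong[OF refl], rule sum.swap)
      also have "\<dots> = (\<Sum>l<k. \<Sum>r<k*n. \<Sum>s<k*n. cnj (c r) * cinner (v l r) (v l s) * c s)"
        by (rule sum.swap)
      also have "\<dots> = (\<Sum>l<k. cinner (\<Sum>r<k*n. c r *\<^sub>C v l r) (\<Sum>s<k*n. c s *\<^sub>C v l s))"
        unfolding cinner_sum_left
        by (simp add: cinner_sum_right cinner_scaleC_left cinner_scaleC_right sum_distrib_left algebra_simps)
      also have "\<dots> \<in> \<real>\<^sub>\<ge>\<^sub>0"
        by (rule sum_nonneg_Reals) (simp only: norm_sq_cinner[symmetric] nonneg_Reals_of_real_iff, simp)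
      finally show "(\<Sum>r<k*n. \<Sum>s<k*n. cnj (c r) * G r s * c s) \<in> \<real>\<^sub>\<ge>\<^sub>0" .
    qed
    then obtain Y where Y: "\<And>r s. r < k*n \<Longrightarrow> s < k*n \<Longrightarrow> G r s = (\<Sum>l<k*n. cnj (Y l r) * Y l s)" by metis
    define Z where "Z = mat (k*n) (k*n) (\<lambda>(l, s). Y l s)"
    have Z: "Z \<in> carrier_mat (k*n) (k*n)" by (simp add: Z_def)
    have "amplification k n (compression n f) M = mat_star Z * Z"
    proof (rule eq_matI)
      fix r s assume "r < dim_row (mat_star Z * Z)" "s < dim_col (mat_star Z * Z)"
      then have rs: "r < k*n" "s < k*n" by (simp_all add: mat_star_def Z_def)
      then have n: "n > 0" by (cases n) auto
      have div: "r div n < k" "s div n < k" using rs n by (simp_all add: less_mult_imp_div_less)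
      have "amplification k n (compression n f) M $$ (r, s) = G r s"
        using rs n by (simp add: amplification_def compression_def M index_mat_star_times_self[OF X div]
            bop_apply_sum cinner_sum_right star_bop_right G_def v_def)
      also have "\<dots> = (mat_star Z * Z) $$ (r, s)"
        using rs by (simp add: index_mat_star_times_self[OF Z rs] Y) (simp add: Z_def star_complex_def)
      finally show "amplification k n (compression n f) M $$ (r, s) = (mat_star Z * Z) $$ (r, s)" .
    qed (simp_all add: amplification_def mat_star_def Z_def)
    then show "positive_mat (k * n) (amplification k n (compression n f) M)"
      unfolding positive_mat_def using Z by blast
  qed
  moreover have "compression n f T \<in> carrier_mat n n" for T
    by (simp add: compression_def)
  moreover have "compression n f (S + T) = compression n f S + compression n f T" for S T
    by (rule eq_matI) (auto simp: compression_def cinner_add_right)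
  moreover have "compression n f (c *\<^sub>C T) = c \<cdot>\<^sub>m compression n f T" for c T
    by (rule eq_matI) (auto simp: compression_def cinner_scaleC_right)
  moreover have "compression n f 1 = 1\<^sub>m n"
    by (rule eq_matI) (auto simp: compression_def on)
  ultimately show ?thesis by (simp add: UCP_def)
qed

text \<open>This is positivity of the functional \<open>[a\<^sub>i\<^sub>j] \<mapsto> \<Sum>\<Psi>(a\<^sub>i\<^sub>j)\<^sub>i\<^sub>j\<close> on the \<open>n \<times> n\<close> matrices, which is the
  \<open>n\<close>-th amplification of \<open>\<Psi>\<close> followed by the vector functional of \<open>\<Sum>e\<^sub>i \<otimes> e\<^sub>i\<close>.\<close>

lemma UCP_diagonal_functional_positive:
  fixes X :: "nat \<Rightarrow> nat \<Rightarrow> 'a::complex_star_algebra"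
  assumes \<Psi>: "\<Psi> \<in> UCP n"
  shows "(\<Sum>i<n. \<Sum>j<n. \<Psi> (\<Sum>l<n. star (X l i) * X l j) $$ (i, j)) \<in> \<real>\<^sub>\<ge>\<^sub>0"
proof -
  define XM where "XM = mat n n (\<lambda>(l, i). X l i)"
  have XM: "XM \<in> carrier_mat n n" by (simp add: XM_def)
  define M where "M = mat_star XM * XM"
  have Mij: "M $$ (i, j) = (\<Sum>l<n. star (X l i) * X l j)" if "i < n" "j < n" for i j
    using that by (simp add: M_def index_mat_star_times_self[OF XM that]) (simp add: XM_def)
  have "positive_mat n M" unfolding positive_mat_def M_def using XM by blast
  then have "positive_mat (n * n) (amplification n n \<Psi> M)"
    using \<Psi> unfolding UCP_def completely_positive_def by blast
  then obtain Y where Y: "Y \<in> carrier_mat (n*n) (n*n)" and YY: "amplification n n \<Psi> M = mat_star Y * Y"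
    unfolding positive_mat_def by blast
  have lt: "i * n + i < n * n" if "i < n" for i
  proof -
    have "i * n + i < Suc i * n" using that by simp
    also have "\<dots> \<le> n * n" using that by (intro mult_right_mono) auto
    finally show ?thesis .
  qed
  have entry: "\<Psi> (\<Sum>l<n. star (X l i) * X l j) $$ (i, j)
      = (\<Sum>l<n*n. cnj (Y $$ (l, i*n+i)) * Y $$ (l, j*n+j))" if "i < n" "j < n" for i j
  proof -
    have "amplification n n \<Psi> M $$ (i*n+i, j*n+j) = \<Psi> (M $$ (i, j)) $$ (i, j)"
      using that lt by (simp add: amplification_def)
    then show ?thesis
      unfolding YY Mij[OF that] index_mat_star_times_self[OF Y lt[OF that(1)] lt[OF that(2)]]
      by (simp add: star_complex_def)
  qed
  have "(\<Sum>i<n. \<Sum>j<n. \<Psi> (\<Sum>l<n. star (X l i) * X l j) $$ (i, j))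
      = (\<Sum>i<n. \<Sum>j<n. \<Sum>l<n*n. cnj (Y $$ (l, i*n+i)) * Y $$ (l, j*n+j))"
    by (intro sum.cong refl) (simp add: entry)
  also have "\<dots> = (\<Sum>i<n. \<Sum>l<n*n. \<Sum>j<n. cnj (Y $$ (l, i*n+i)) * Y $$ (l, j*n+j))"
    by (rule sum.cong[OF refl], rule sum.swap)
  also have "\<dots> = (\<Sum>l<n*n. \<Sum>i<n. \<Sum>j<n. cnj (Y $$ (l, i*n+i)) * Y $$ (l, j*n+j))"
    by (rule sum.swap)
  also have "\<dots> = (\<Sum>l<n*n. cnj (\<Sum>i<n. Y $$ (l, i*n+i)) * (\<Sum>j<n. Y $$ (l, j*n+j)))"
    by (simp add: sum_product)
  also have "\<dots> \<in> \<real>\<^sub>\<ge>\<^sub>0" by (intro sum_nonneg_Reals cnj_mult_self_nonneg)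
  finally show ?thesis .
qed

lemma scaleC_sum_right: "c *\<^sub>C (\<Sum>i\<in>S. f i) = (\<Sum>i\<in>S. c *\<^sub>C (f i :: 'a::complex_vector))"
  by (induction S rule: infinite_finite_induct) (simp_all add: scaleC_add_right)

lemma minus_eq_plus_scaleC: "a - b = a + (- 1) *\<^sub>C (b :: 'a::complex_vector)"
  by (metis diff_conv_add_uminus scaleC_add_left scaleC_one scaleC_zero_left add.right_inverse add_eq_0_iff)

section \<open>Functionals on a matrix amplification\<close>

text \<open>Here \<open>\<psi> y z T\<close> stands for the entry \<open>(y, z)\<close> of a unital completely positive image of \<open>T\<close>. The last
  assumption says that \<open>[T\<^sub>y\<^sub>z] \<mapsto> \<Sum>\<psi> y z T\<^sub>y\<^sub>z\<close> is a positive functional on the matrices over the operators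
  with indices in \<open>F\<close>. It is not normalised: its value at the unit is \<open>card F\<close>.\<close>

locale amplified_functional = orthonormal_basis e I
  for e :: "'i \<Rightarrow> 'h::chilbert_space" and I +
  fixes F :: "'i set" and \<psi> :: "'i \<Rightarrow> 'i \<Rightarrow> 'h bop \<Rightarrow> complex"
  assumes F: "finite F" "F \<noteq> {}" "F \<subseteq> I"
    and \<psi>_add: "y \<in> F \<Longrightarrow> z \<in> F \<Longrightarrow> \<psi> y z (S + T) = \<psi> y z S + \<psi> y z T"
    and \<psi>_scaleC: "y \<in> F \<Longrightarrow> z \<in> F \<Longrightarrow> \<psi> y z (c *\<^sub>C T) = c * \<psi> y z T"
    and \<psi>_one: "y \<in> F \<Longrightarrow> z \<in> F \<Longrightarrow> \<psi> y z 1 = (if y = z then 1 else 0)"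
    and \<psi>_pos: "(\<Sum>y\<in>F. \<Sum>z\<in>F. \<psi> y z (\<Sum>l\<in>F. star (X l y) * X l z)) \<in> \<real>\<^sub>\<ge>\<^sub>0"
begin

lemma \<psi>_zero: "y \<in> F \<Longrightarrow> z \<in> F \<Longrightarrow> \<psi> y z 0 = 0"
  using \<psi>_scaleC[of y z 0 0] by simp

text \<open>The semi-inner product \<open>S, T \<mapsto> \<phi>(S\<^sup>* T)\<close> of the GNS construction for the functional \<open>\<phi>\<close>.\<close>

definition form :: "('i \<Rightarrow> 'i \<Rightarrow> 'h bop) \<Rightarrow> ('i \<Rightarrow> 'i \<Rightarrow> 'h bop) \<Rightarrow> complex" where
  "form S T = (\<Sum>y\<in>F. \<Sum>z\<in>F. \<psi> y z (\<Sum>l\<in>F. star (S l y) * T l z))"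

lemma form_nonneg: "form S S \<in> \<real>\<^sub>\<ge>\<^sub>0"
  unfolding form_def by (rule \<psi>_pos)

lemma form_add_right: "form S (\<lambda>l z. T l z + U l z) = form S T + form S U"
  by (simp add: form_def distrib_left sum.distrib \<psi>_add)

lemma form_add_left: "form (\<lambda>l z. S l z + T l z) U = form S U + form T U"
  by (simp add: form_def distrib_right star_add sum.distrib \<psi>_add)

lemma form_scaleC_right: "form S (\<lambda>l z. c *\<^sub>C T l z) = c * form S T"
  by (simp add: form_def scaleC_mult_right scaleC_sum_right[symmetric] \<psi>_scaleC sum_distrib_left)

lemma form_scaleC_left: "form (\<lambda>l z. c *\<^sub>C S l z) T = cnj c * form S T"
  by (simp add: form_def star_scaleC scaleC_mult_left scaleC_sum_right[symmetric] \<psi>_scaleC sum_distrib_left)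

lemma form_diff_right: "form S (\<lambda>l z. T l z - U l z) = form S T - form S U"
  using form_add_right[of S T "\<lambda>l z. (- 1) *\<^sub>C U l z"]
  by (simp add: form_scaleC_right flip: minus_eq_plus_scaleC)

lemma form_diff_left: "form (\<lambda>l z. S l z - T l z) U = form S U - form T U"
  using form_add_left[of S "\<lambda>l z. (- 1) *\<^sub>C T l z" U]
  by (simp add: form_scaleC_left flip: minus_eq_plus_scaleC)

lemma form_pos: "form S S + c * form S T + cnj c * form T S + cnj c * c * form T T \<in> \<real>\<^sub>\<ge>\<^sub>0"
  using form_nonneg[of "\<lambda>l z. S l z + c *\<^sub>C T l z"]
  by (simp add: form_add_left form_add_right form_scaleC_left form_scaleC_right algebra_simps)

lemma form_commute: "form T S = cnj (form S T)"
  by (rule positive_form_hermitian_Cauchy_Schwarz(1)[OF form_pos form_nonneg])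

lemma form_Cauchy_Schwarz: "(cmod (form S T))\<^sup>2 \<le> Re (form S S) * Re (form T T)"
  by (rule positive_form_hermitian_Cauchy_Schwarz(2)[OF form_pos form_nonneg])

definition admissible :: "('i \<Rightarrow> 'i \<Rightarrow> complex) \<Rightarrow> ('i \<Rightarrow> 'i) \<Rightarrow> bool" where
  "admissible g \<rho> \<longleftrightarrow> bij_betw \<rho> I I \<and> \<rho> ` F \<subseteq> F \<and> (\<forall>z\<in>F. bounded ((\<lambda>x. g x z) ` I))"

text \<open>Operator matrices over \<open>F\<close> act on the space with basis \<open>e x \<otimes> z\<close>, for \<open>x \<in> I\<close> and \<open>z \<in> F\<close>. This is the matrix
  of \<open>e x \<otimes> z \<mapsto> g x z (e (\<rho> x) \<otimes> \<rho> z)\<close>, and \<open>mean\<close> is the value of the functional at it. In particular,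
  \<open>mean g id\<close> is, up to normalisation, the value at \<open>g\<close> of a finitely additive measure on \<open>I \<times> F\<close>.\<close>

definition tensor_monomial :: "('i \<Rightarrow> 'i \<Rightarrow> complex) \<Rightarrow> ('i \<Rightarrow> 'i) \<Rightarrow> 'i \<Rightarrow> 'i \<Rightarrow> 'h bop" where
  "tensor_monomial g \<rho> l z = (if l = \<rho> z then monomial (\<lambda>x. g x z) \<rho> else 0)"

definition mean :: "('i \<Rightarrow> 'i \<Rightarrow> complex) \<Rightarrow> ('i \<Rightarrow> 'i) \<Rightarrow> complex" where
  "mean g \<rho> = (\<Sum>z\<in>F. \<psi> (\<rho> z) z (monomial (\<lambda>x. g x z) \<rho>))"

lemma mean_cong:
  assumes "\<And>x z. x \<in> I \<Longrightarrow> z \<in> F \<Longrightarrow> g x z = h x z" "\<And>x. x \<in> I \<Longrightarrow> \<rho> x = \<sigma> x"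
  shows "mean g \<rho> = mean h \<sigma>"
proof -
  have "monomial (\<lambda>x. g x z) \<rho> = monomial (\<lambda>x. h x z) \<sigma>" if "z \<in> F" for z
    by (rule monomial_cong) (use assms that in auto)
  moreover have "\<rho> z = \<sigma> z" if "z \<in> F" for z using assms(2) F that by auto
  ultimately show ?thesis unfolding mean_def by (intro sum.cong) auto
qed

lemma mean_one: "mean (\<lambda>_ _. 1) id = of_nat (card F)"
  using F by (simp add: mean_def monomial_one[unfolded id_def] id_def \<psi>_one)

text \<open>The adjoint of a monomial matrix over an involution \<open>\<sigma>\<close> is one over \<open>\<sigma>\<close>, so that the product under the
  functional is a single monomial matrix.\<close>

lemma form_tensor_monomial:
  assumes \<sigma>: "bij_betw \<sigma> I I" "\<And>x. x \<in> I \<Longrightarrow> \<sigma> (\<sigma> x) = x" "\<sigma> ` F \<subseteq> F"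
    and bh: "\<And>z. z \<in> F \<Longrightarrow> bounded ((\<lambda>x. h x z) ` I)" and g: "admissible g \<rho>"
  shows "form (tensor_monomial h \<sigma>) (tensor_monomial g \<rho>)
    = mean (\<lambda>x z. cnj (h (\<sigma> (\<rho> x)) (\<sigma> (\<rho> z))) * g x z) (\<sigma> \<circ> \<rho>)"
proof -
  have \<rho>: "bij_betw \<rho> I I" "\<rho> ` F \<subseteq> F" and bg: "\<And>z. z \<in> F \<Longrightarrow> bounded ((\<lambda>x. g x z) ` I)"
    using g by (auto simp: admissible_def)
  have \<sigma>I: "\<sigma> x \<in> I" if "x \<in> I" for x using \<sigma>(1) that by (rule bij_betw_apply)
  have \<rho>I: "\<rho> x \<in> I" if "x \<in> I" for x using \<rho>(1) that by (rule bij_betw_apply)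
  define P where "P y z = star (monomial (\<lambda>x. h x y) \<sigma>) * monomial (\<lambda>x. g x z) \<rho>" for y z
  have inner: "(\<Sum>l\<in>F. star (tensor_monomial h \<sigma> l y) * tensor_monomial g \<rho> l z)
      = (if y = \<sigma> (\<rho> z) then P y z else 0)" if yz: "y \<in> F" "z \<in> F" for y z
  proof -
    have star0: "star 0 = (0 :: 'h bop)" by (metis scaleC_zero_left complex_cnj_zero star_scaleC)
    have "(\<Sum>l\<in>F. star (tensor_monomial h \<sigma> l y) * tensor_monomial g \<rho> l z)
        = (\<Sum>l\<in>F. if l = \<rho> z then (if \<sigma> y = \<rho> z then P y z else 0) else 0)"
      by (rule sum.cong[OF refl]) (auto simp: tensor_monomial_def P_def star0)
    also have "\<dots> = (if \<sigma> y = \<rho> z then P y z else 0)" using F \<rho>(2) yz by auto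
    also have "\<sigma> y = \<rho> z \<longleftrightarrow> y = \<sigma> (\<rho> z)" using \<sigma>(2) F yz \<rho>I by (metis subsetD)
    finally show ?thesis .
  qed
  have "form (tensor_monomial h \<sigma>) (tensor_monomial g \<rho>)
      = (\<Sum>y\<in>F. \<Sum>z\<in>F. if y = \<sigma> (\<rho> z) then \<psi> y z (P y z) else 0)"
    unfolding form_def by (intro sum.cong refl) (simp add: inner \<psi>_zero)
  also have "\<dots> = (\<Sum>z\<in>F. \<Sum>y\<in>F. if y = \<sigma> (\<rho> z) then \<psi> y z (P y z) else 0)" by (rule sum.swap)
  also have "\<dots> = (\<Sum>z\<in>F. \<psi> (\<sigma> (\<rho> z)) z (P (\<sigma> (\<rho> z)) z))"
    using F \<rho>(2) \<sigma>(3) by (intro sum.cong refl) (auto simp: image_subset_iff)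
  also have "\<dots> = mean (\<lambda>x z. cnj (h (\<sigma> (\<rho> x)) (\<sigma> (\<rho> z))) * g x z) (\<sigma> \<circ> \<rho>)"
    unfolding mean_def
  proof (rule sum.cong[OF refl])
    fix z assume z: "z \<in> F"
    let ?y = "\<sigma> (\<rho> z)"
    have y: "?y \<in> F" using z \<rho>(2) \<sigma>(3) by auto
    have b: "bounded ((\<lambda>x. cnj (h (\<sigma> x) ?y)) ` I)" using bh[OF y] \<sigma>I by (auto simp: bounded_iff)
    have "P ?y z = monomial (\<lambda>x. cnj (h (\<sigma> x) ?y)) \<sigma> * monomial (\<lambda>x. g x z) \<rho>"
      unfolding P_def by (simp only: star_monomial[OF \<sigma>(1,2) bh[OF y]])
    also have "\<dots> = monomial (\<lambda>x. cnj (h (\<sigma> (\<rho> x)) ?y) * g x z) (\<sigma> \<circ> \<rho>)"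
      by (rule monomial_times[OF \<sigma>(1) b \<rho>(1) bg[OF z]])
    finally show "\<psi> (\<sigma> (\<rho> z)) z (P (\<sigma> (\<rho> z)) z)
        = \<psi> ((\<sigma> \<circ> \<rho>) z) z (monomial (\<lambda>x. cnj (h (\<sigma> (\<rho> x)) (\<sigma> (\<rho> z))) * g x z) (\<sigma> \<circ> \<rho>))" by simp
  qed
  finally show ?thesis .
qed

lemma form_tensor_monomial_self:
  assumes g: "admissible g \<rho>"
  shows "form (tensor_monomial g \<rho>) (tensor_monomial g \<rho>) = mean (\<lambda>x z. cnj (g x z) * g x z) id"
proof -
  have \<rho>: "bij_betw \<rho> I I" "\<rho> ` F \<subseteq> F" and bg: "\<And>z. z \<in> F \<Longrightarrow> bounded ((\<lambda>x. g x z) ` I)"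
    using g by (auto simp: admissible_def)
  have inj: "\<rho> y = \<rho> z \<longleftrightarrow> y = z" if "y \<in> F" "z \<in> F" for y z
    using \<rho>(1) that F unfolding bij_betw_def by (meson inj_on_eq_iff subsetD)
  have star0: "star 0 = (0 :: 'h bop)" by (metis scaleC_zero_left complex_cnj_zero star_scaleC)
  have inner: "(\<Sum>l\<in>F. star (tensor_monomial g \<rho> l y) * tensor_monomial g \<rho> l z)
      = (if y = z then monomial (\<lambda>x. cnj (g x z) * g x z) id else 0)" if yz: "y \<in> F" "z \<in> F" for y z
  proof -
    have "(\<Sum>l\<in>F. star (tensor_monomial g \<rho> l y) * tensor_monomial g \<rho> l z)
        = (\<Sum>l\<in>F. if l = \<rho> z then (if y = z then monomial (\<lambda>x. cnj (g x z) * g x z) id else 0) else 0)"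
      by (rule sum.cong[OF refl])
        (use inj yz in \<open>auto simp: tensor_monomial_def star0 star_monomial_times_self[OF \<rho>(1) bg]\<close>)
    also have "\<dots> = (if y = z then monomial (\<lambda>x. cnj (g x z) * g x z) id else 0)" using F \<rho>(2) yz by auto
    finally show ?thesis .
  qed
  have "form (tensor_monomial g \<rho>) (tensor_monomial g \<rho>)
      = (\<Sum>y\<in>F. \<Sum>z\<in>F. if y = z then \<psi> z z (monomial (\<lambda>x. cnj (g x z) * g x z) id) else 0)"
    unfolding form_def by (intro sum.cong refl) (auto simp: inner \<psi>_zero)
  then show ?thesis using F by (simp add: mean_def)
qed

lemma mean_diagonal_add:
  assumes "\<And>z. z \<in> F \<Longrightarrow> bounded ((\<lambda>x. f x z) ` I)" "\<And>z. z \<in> F \<Longrightarrow> bounded ((\<lambda>x. g x z) ` I)"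
  shows "mean (\<lambda>x z. f x z + g x z) id = mean f id + mean g id"
proof -
  have "monomial (\<lambda>x. f x z + g x z) id = monomial (\<lambda>x. f x z) id + monomial (\<lambda>x. g x z) id" if "z \<in> F" for z
    using assms that by (intro monomial_add[symmetric]) auto
  then show ?thesis by (simp add: mean_def \<psi>_add sum.distrib)
qed

lemma mean_diagonal_scale:
  assumes "\<And>z. z \<in> F \<Longrightarrow> bounded ((\<lambda>x. f x z) ` I)"
  shows "mean (\<lambda>x z. c * f x z) id = c * mean f id"
proof -
  have "monomial (\<lambda>x. c * f x z) id = c *\<^sub>C monomial (\<lambda>x. f x z) id" if "z \<in> F" for z
    using assms that by (intro scaleC_monomial[symmetric]) auto
  then show ?thesis by (simp add: mean_def \<psi>_scaleC sum_distrib_left)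
qed

text \<open>A nonnegative diagonal matrix is the square of its square root.\<close>

lemma mean_diagonal_nonneg:
  assumes b: "\<And>z. z \<in> F \<Longrightarrow> bounded ((\<lambda>x. complex_of_real (f x z)) ` I)"
    and f: "\<And>x z. x \<in> I \<Longrightarrow> z \<in> F \<Longrightarrow> f x z \<ge> 0"
  shows "mean (\<lambda>x z. complex_of_real (f x z)) id \<in> \<real>\<^sub>\<ge>\<^sub>0"
proof -
  define g where "g x z = complex_of_real (sqrt (f x z))" for x z
  have "admissible g id"
    unfolding admissible_def
  proof (intro conjI ballI)
    fix z assume z: "z \<in> F"
    obtain B where B: "\<And>x. x \<in> I \<Longrightarrow> \<bar>f x z\<bar> \<le> B" using b[OF z] by (auto simp: bounded_iff)
    have "cmod (g x z) \<le> sqrt B" if "x \<in> I" for x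
      using B[OF that] f[OF that z] by (simp add: g_def)
    then show "bounded ((\<lambda>x. g x z) ` I)" unfolding bounded_iff by blast
  qed auto
  from form_tensor_monomial_self[OF this]
  have "form (tensor_monomial g id) (tensor_monomial g id) = mean (\<lambda>x z. complex_of_real (f x z)) id"
    using f by (simp add: g_def flip: of_real_mult cong: mean_cong)
  then show ?thesis by (metis form_nonneg)
qed

text \<open>Both sides are values of the form at the unit and \<open>g\<close>, in either order.\<close>

lemma mean_diagonal_cnj:
  assumes b: "\<And>z. z \<in> F \<Longrightarrow> bounded ((\<lambda>x. g x z) ` I)"
  shows "mean (\<lambda>x z. cnj (g x z)) id = cnj (mean g id)"
proof -
  have adm: "admissible g id" "admissible (\<lambda>_ _. 1) id"
    using b by (auto simp: admissible_def bounded_const_image)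
  have "form (tensor_monomial (\<lambda>_ _. 1) id) (tensor_monomial g id) = mean g id"
    using form_tensor_monomial[OF _ _ _ _ adm(1), of id "\<lambda>_ _. 1"] by (simp add: bounded_const_image)
  moreover have "form (tensor_monomial g id) (tensor_monomial (\<lambda>_ _. 1) id) = mean (\<lambda>x z. cnj (g x z)) id"
    using form_tensor_monomial[OF _ _ _ _ adm(2), of id g] b by simp
  ultimately show ?thesis by (metis form_commute)
qed

lemma Re_mean_diagonal:
  assumes b: "\<And>z. z \<in> F \<Longrightarrow> bounded ((\<lambda>x. g x z) ` I)"
  shows "Re (mean (\<lambda>x z. complex_of_real (Re (g x z))) id) = Re (mean g id)"
proof -
  have b': "bounded ((\<lambda>x. cnj (g x z)) ` I)" if "z \<in> F" for z
    using b[OF that] by (auto simp: bounded_iff)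
  have bs: "bounded ((\<lambda>x. g x z + cnj (g x z)) ` I)" if "z \<in> F" for z
    using b[OF that] b'[OF that] by (rule bounded_plus_comp)
  have "Re (mean (\<lambda>x z. complex_of_real (Re (g x z))) id) = Re (mean (\<lambda>x z. (1/2) * (g x z + cnj (g x z))) id)"
    by (rule arg_cong[of _ _ Re], rule mean_cong) (auto simp: complex_eq_iff)
  also have "\<dots> = Re ((1/2) * (mean g id + cnj (mean g id)))"
    by (simp only: mean_diagonal_scale[OF bs] mean_diagonal_add[OF b b'] mean_diagonal_cnj[OF b])
  also have "Re ((1/2) * (mean g id + cnj (mean g id))) = Re (mean g id)" by simp
  finally show ?thesis .
qed

lemma mean_diagonal_mono:
  assumes f: "\<And>z. z \<in> F \<Longrightarrow> bounded ((\<lambda>x. complex_of_real (f x z)) ` I)"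
    and g: "\<And>z. z \<in> F \<Longrightarrow> bounded ((\<lambda>x. complex_of_real (g x z)) ` I)"
    and le: "\<And>x z. x \<in> I \<Longrightarrow> z \<in> F \<Longrightarrow> f x z \<le> g x z"
  shows "Re (mean (\<lambda>x z. complex_of_real (f x z)) id) \<le> Re (mean (\<lambda>x z. complex_of_real (g x z)) id)"
proof -
  have f': "bounded ((\<lambda>x. (- 1) * complex_of_real (f x z)) ` I)" if "z \<in> F" for z
    using f[OF that] by (intro bounded_mult_image bounded_const_image)
  have s: "mean (\<lambda>x z. complex_of_real (g x z) + (- 1) * complex_of_real (f x z)) id
    = mean (\<lambda>x z. complex_of_real (g x z)) id + (- 1) * mean (\<lambda>x z. complex_of_real (f x z)) id"
    by (simp only: mean_diagonal_add[OF g f'] mean_diagonal_scale[OF f])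
  have "mean (\<lambda>x z. complex_of_real (g x z - f x z)) id \<in> \<real>\<^sub>\<ge>\<^sub>0"
  proof (rule mean_diagonal_nonneg)
    fix z assume z: "z \<in> F"
    have "(\<lambda>x. complex_of_real (g x z - f x z)) = (\<lambda>x. complex_of_real (g x z) + (- 1) * complex_of_real (f x z))" by auto
    then show "bounded ((\<lambda>x. complex_of_real (g x z - f x z)) ` I)"
      using g[OF z] f'[OF z] by (simp only: bounded_plus_comp)
  qed (use le in simp)
  then show ?thesis using s by (simp add: complex_nonneg_Reals_iff)
qed

subsection \<open>Symmetries that almost fix the functional\<close>

text \<open>The condition on \<open>\<kappa> (R x)\<close> makes the monomial operator with data \<open>\<kappa>\<close> and \<open>R\<close> a self-adjoint unitary.\<close>

definition symmetry :: "('i \<Rightarrow> complex) \<Rightarrow> ('i \<Rightarrow> 'i) \<Rightarrow> bool" where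
  "symmetry \<kappa> R \<longleftrightarrow> bij_betw R I I \<and> (\<forall>x\<in>I. R (R x) = x) \<and> R ` F \<subseteq> F \<and>
     (\<forall>x\<in>I. cmod (\<kappa> x) = 1 \<and> \<kappa> (R x) = cnj (\<kappa> x))"

text \<open>If \<open>U\<close> is the monomial operator with data \<open>\<kappa>\<close> and \<open>R\<close>, and \<open>u\<close> its restriction to the span of \<open>e ` F\<close>, then
  \<open>tensor_monomial (relative_phase \<kappa>) R\<close> is \<open>U \<otimes> cnj u\<close>.\<close>

definition relative_phase :: "('i \<Rightarrow> complex) \<Rightarrow> 'i \<Rightarrow> 'i \<Rightarrow> complex" where
  "relative_phase \<kappa> x z = \<kappa> x * cnj (\<kappa> z)"

lemma bounded_if_le_1: "(\<And>x. x \<in> I \<Longrightarrow> cmod (g x) \<le> 1) \<Longrightarrow> bounded (g ` I)"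
  by (auto simp: bounded_iff)

lemma symmetry_relative_phase:
  assumes s: "symmetry \<kappa> R" and x: "x \<in> I" "z \<in> F"
  shows "cmod (relative_phase \<kappa> x z) = 1"
    and "cnj (relative_phase \<kappa> x z) * relative_phase \<kappa> x z = 1"
    and "relative_phase \<kappa> (R x) (R z) = cnj (relative_phase \<kappa> x z)"
proof -
  have z: "z \<in> I" using x F by auto
  show 1: "cmod (relative_phase \<kappa> x z) = 1"
    using s x z by (simp add: symmetry_def relative_phase_def norm_mult)
  show "cnj (relative_phase \<kappa> x z) * relative_phase \<kappa> x z = 1"
    using complex_norm_square[of "relative_phase \<kappa> x z"] 1 by (simp add: mult.commute)
  show "relative_phase \<kappa> (R x) (R z) = cnj (relative_phase \<kappa> x z)"
    using s x z by (simp add: symmetry_def relative_phase_def)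
qed

lemma admissible_symmetry:
  assumes "symmetry \<kappa> R"
  shows "admissible (relative_phase \<kappa>) R"
  using assms symmetry_relative_phase(1)[OF assms]
  by (auto simp: admissible_def symmetry_def intro!: bounded_if_le_1)

text \<open>What is missing to equality is the value at the nonnegative diagonal matrix with entries \<open>1 - \<bar>g x z\<bar>\<^sup>2\<close>.\<close>

lemma form_self_le:
  assumes g: "admissible g \<rho>" and le: "\<And>x z. x \<in> I \<Longrightarrow> z \<in> F \<Longrightarrow> cmod (g x z) \<le> 1"
  shows "Re (form (tensor_monomial g \<rho>) (tensor_monomial g \<rho>)) \<le> real (card F)"
proof -
  have "form (tensor_monomial g \<rho>) (tensor_monomial g \<rho>) = mean (\<lambda>x z. complex_of_real ((cmod (g x z))\<^sup>2)) id"
    unfolding form_tensor_monomial_self[OF g] by (rule mean_cong) (simp_all add: complex_norm_square mult.commute del: of_real_power)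
  also have "Re \<dots> \<le> Re (mean (\<lambda>x z. complex_of_real 1) id)"
  proof (rule mean_diagonal_mono)
    show "(cmod (g x z))\<^sup>2 \<le> 1" if "x \<in> I" "z \<in> F" for x z
      using le[OF that] by (simp add: power_le_one)
    then show "bounded ((\<lambda>x. complex_of_real ((cmod (g x z))\<^sup>2)) ` I)" if "z \<in> F" for z
      using that by (intro bounded_if_le_1) (simp add: norm_power)
  qed (rule bounded_const_image)
  finally show ?thesis by (simp only: of_real_1 mean_one complex_Re_of_nat)
qed

text \<open>The functional nearly attains its norm at the unitary \<open>W = U \<otimes> cnj u\<close>, so \<open>W\<close> nearly fixes the cyclic vector
  \<open>\<Omega>\<close> of the GNS representation. The next lemmas let \<open>W\<close> be absorbed on either side of a contraction.\<close>

lemma form_symmetry_diff_le: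
  assumes s: "symmetry \<kappa> R"
    and near: "Re (mean (relative_phase \<kappa>) R) \<ge> (1 - \<delta>) * real (card F)"
    and S: "Re (form S S) \<le> real (card F)"
  shows "cmod (form S (\<lambda>l z. tensor_monomial (relative_phase \<kappa>) R l z - tensor_monomial (\<lambda>_ _. 1) id l z))
    \<le> sqrt (2 * \<delta>) * real (card F)"
proof -
  let ?n = "real (card F)"
  let ?W = "tensor_monomial (relative_phase \<kappa>) R" and ?E = "tensor_monomial (\<lambda>_ _. 1) id"
  let ?D = "\<lambda>l z. ?W l z - ?E l z"
  have adm: "admissible (\<lambda>_ _. 1) id" by (auto simp: admissible_def bounded_const_image)
  have "mean (\<lambda>x z. cnj (relative_phase \<kappa> x z) * relative_phase \<kappa> x z) id = mean (\<lambda>_ _. 1) id"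
    by (rule mean_cong) (simp_all add: symmetry_relative_phase(2)[OF s])
  then have WW: "form ?W ?W = of_nat (card F)"
    by (simp only: form_tensor_monomial_self[OF admissible_symmetry[OF s]] mean_one)
  have EE: "form ?E ?E = of_nat (card F)"
    unfolding form_tensor_monomial_self[OF adm] by (simp add: mean_one)
  have EW: "form ?E ?W = mean (relative_phase \<kappa>) R"
    using form_tensor_monomial[OF _ _ _ _ admissible_symmetry[OF s], of id "\<lambda>_ _. 1"] by (simp add: bounded_const_image)
  have "Re (form ?D ?D) = 2 * ?n - 2 * Re (mean (relative_phase \<kappa>) R)"
    by (simp add: form_diff_left form_diff_right WW EE EW form_commute[of ?W ?E])
  also have "\<dots> \<le> 2 * \<delta> * ?n" using near by (simp add: algebra_simps)
  finally have D: "Re (form ?D ?D) \<le> 2 * \<delta> * ?n" .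
  have "(cmod (form S ?D))\<^sup>2 \<le> Re (form S S) * Re (form ?D ?D)" by (rule form_Cauchy_Schwarz)
  also have "\<dots> \<le> ?n * (2 * \<delta> * ?n)"
    using S D form_nonneg[of ?D] form_nonneg[of S]
    by (intro mult_mono) (auto simp: complex_nonneg_Reals_iff)
  finally have "cmod (form S ?D) \<le> sqrt (2 * \<delta> * ?n\<^sup>2)" by (intro real_le_rsqrt) (simp add: power2_eq_square mult_ac)
  then show ?thesis by (simp add: real_sqrt_mult)
qed

lemma mean_left_mult:
  assumes s: "symmetry \<kappa> R"
    and near: "Re (mean (relative_phase \<kappa>) R) \<ge> (1 - \<delta>) * real (card F)"
    and g: "admissible g \<rho>" and le: "\<And>x z. x \<in> I \<Longrightarrow> z \<in> F \<Longrightarrow> cmod (g x z) \<le> 1"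
  shows "cmod (mean (\<lambda>x z. relative_phase \<kappa> (\<rho> x) (\<rho> z) * g x z) (R \<circ> \<rho>) - mean g \<rho>) \<le> sqrt (2 * \<delta>) * real (card F)"
proof -
  let ?W = "tensor_monomial (relative_phase \<kappa>) R" and ?E = "tensor_monomial (\<lambda>_ _. 1) id"
  let ?X = "tensor_monomial g \<rho>"
  have R: "bij_betw R I I" "\<And>x. x \<in> I \<Longrightarrow> R (R x) = x" "R ` F \<subseteq> F" using s by (auto simp: symmetry_def)
  have \<rho>: "\<rho> x \<in> I" if "x \<in> I" for x using g that by (auto simp: admissible_def bij_betw_apply)
  have \<rho>F: "\<rho> z \<in> F" if "z \<in> F" for z using g that by (auto simp: admissible_def)
  have bW: "bounded ((\<lambda>x. relative_phase \<kappa> x z) ` I)" if "z \<in> F" for z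
    using admissible_symmetry[OF s] that by (auto simp: admissible_def)
  have "form ?W ?X = mean (\<lambda>x z. cnj (relative_phase \<kappa> (R (\<rho> x)) (R (\<rho> z))) * g x z) (R \<circ> \<rho>)"
    by (rule form_tensor_monomial[OF R bW g])
  also have "\<dots> = mean (\<lambda>x z. relative_phase \<kappa> (\<rho> x) (\<rho> z) * g x z) (R \<circ> \<rho>)"
    by (rule mean_cong) (auto simp: symmetry_relative_phase(3)[OF s] \<rho> \<rho>F)
  finally have WX: "form ?W ?X = mean (\<lambda>x z. relative_phase \<kappa> (\<rho> x) (\<rho> z) * g x z) (R \<circ> \<rho>)" .
  have EX: "form ?E ?X = mean g \<rho>"
    using form_tensor_monomial[OF _ _ _ _ g, of id "\<lambda>_ _. 1"] by (simp add: bounded_const_image)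
  have "form (\<lambda>l z. ?W l z - ?E l z) ?X = cnj (form ?X (\<lambda>l z. ?W l z - ?E l z))" by (rule form_commute)
  then have "cmod (form (\<lambda>l z. ?W l z - ?E l z) ?X) = cmod (form ?X (\<lambda>l z. ?W l z - ?E l z))" by simp
  also have "\<dots> \<le> sqrt (2 * \<delta>) * real (card F)"
    by (rule form_symmetry_diff_le[OF s near form_self_le[OF g le]])
  finally show ?thesis by (simp only: form_diff_left WX EX)
qed

text \<open>If the entries of the image of \<open>U\<close> are close to those of \<open>u\<close>, then the functional nearly attains its norm at
  \<open>W = U \<otimes> cnj u\<close>: the contribution of column \<open>z\<close> is close to \<open>cnj (\<kappa> z) \<kappa> z = 1\<close>.\<close>

lemma mean_symmetry_ge:
  assumes s: "symmetry \<kappa> R"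
    and near: "\<And>y z. y \<in> F \<Longrightarrow> z \<in> F \<Longrightarrow>
      cmod (\<psi> y z (monomial \<kappa> R) - cinner (e y) (bop_apply (monomial \<kappa> R) (e z))) \<le> \<delta>"
  shows "Re (mean (relative_phase \<kappa>) R) \<ge> (1 - \<delta>) * real (card F)"
proof -
  have R: "bij_betw R I I" "R ` F \<subseteq> F" using s by (auto simp: symmetry_def)
  have b: "bounded (\<kappa> ` I)" using s by (intro bounded_if_le_1) (simp add: symmetry_def)
  have "Re (\<psi> (R z) z (monomial (\<lambda>x. relative_phase \<kappa> x z) R)) \<ge> 1 - \<delta>" if z: "z \<in> F" for z
  proof -
    have zI: "z \<in> I" and Rz: "R z \<in> F" "R z \<in> I" using z R F by auto
    have k1: "cmod (\<kappa> z) = 1" using s zI by (simp add: symmetry_def)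
    then have k: "cnj (\<kappa> z) * \<kappa> z = 1"
      by (metis complex_norm_square mult.commute of_real_1 power_one)
    have "monomial (\<lambda>x. relative_phase \<kappa> x z) R = cnj (\<kappa> z) *\<^sub>C monomial \<kappa> R"
      by (simp add: scaleC_monomial[OF R(1) b] relative_phase_def mult.commute)
    then have eq: "\<psi> (R z) z (monomial (\<lambda>x. relative_phase \<kappa> x z) R) = cnj (\<kappa> z) * \<psi> (R z) z (monomial \<kappa> R)"
      using z Rz by (simp add: \<psi>_scaleC)
    have "cinner (e (R z)) (bop_apply (monomial \<kappa> R) (e z)) = \<kappa> z"
      using zI Rz by (simp add: monomial_apply[OF R(1) b] cinner_scaleC_right orthonormal)
    then have "cmod (\<psi> (R z) z (monomial \<kappa> R) - \<kappa> z) \<le> \<delta>" using near[OF Rz(1) z] by simp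
    moreover have "cnj (\<kappa> z) * \<psi> (R z) z (monomial \<kappa> R) - 1 = cnj (\<kappa> z) * (\<psi> (R z) z (monomial \<kappa> R) - \<kappa> z)"
      by (simp add: right_diff_distrib k)
    ultimately have "cmod (cnj (\<kappa> z) * \<psi> (R z) z (monomial \<kappa> R) - 1) \<le> \<delta>"
      using k1 by (simp add: norm_mult)
    then show ?thesis unfolding eq using abs_Re_le_cmod[of "cnj (\<kappa> z) * \<psi> (R z) z (monomial \<kappa> R) - 1"] by (simp del: times_complex.sel)
  qed
  then have "(\<Sum>z\<in>F. 1 - \<delta>) \<le> (\<Sum>z\<in>F. Re (\<psi> (R z) z (monomial (\<lambda>x. relative_phase \<kappa> x z) R)))" by (rule sum_mono)
  then show ?thesis by (simp add: mean_def mult.commute)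
qed

text \<open>For diagonal \<open>D\<close>, both factors of \<open>W D W\<close> are absorbed by \<open>\<Omega>\<close>, and the phases in \<open>W\<close> cancel. Hence the measure
  on \<open>I \<times> F\<close> is almost invariant under the permutation \<open>R\<close> acting on both coordinates.\<close>

lemma mean_diagonal_invariant:
  fixes f :: "'i \<Rightarrow> 'i \<Rightarrow> real"
  assumes s: "symmetry \<kappa> R"
    and near: "Re (mean (relative_phase \<kappa>) R) \<ge> (1 - \<delta>) * real (card F)"
    and f: "\<And>x z. x \<in> I \<Longrightarrow> z \<in> F \<Longrightarrow> \<bar>f x z\<bar> \<le> 1"
  shows "cmod (mean (\<lambda>x z. complex_of_real (f (R x) (R z))) id - mean (\<lambda>x z. complex_of_real (f x z)) id)
    \<le> 2 * sqrt (2 * \<delta>) * real (card F)"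
proof -
  let ?W = "tensor_monomial (relative_phase \<kappa>) R" and ?E = "tensor_monomial (\<lambda>_ _. 1) id"
  let ?f = "\<lambda>x z. complex_of_real (f x z)"
  let ?g = "\<lambda>x z. complex_of_real (f (R x) (R z)) * relative_phase \<kappa> x z"
  have R: "bij_betw R I I" "\<And>x. x \<in> I \<Longrightarrow> R (R x) = x" "R ` F \<subseteq> F" using s by (auto simp: symmetry_def)
  have RI: "R x \<in> I" if "x \<in> I" for x using R(1) that by (rule bij_betw_apply)
  have RF: "R z \<in> F" if "z \<in> F" for z using R(3) that by auto
  have FI: "z \<in> I" if "z \<in> F" for z using that F by auto
  have bf: "bounded ((\<lambda>x. ?f x z) ` I)" if "z \<in> F" for z
    using f that by (intro bounded_if_le_1) auto
  have admf: "admissible ?f id" using bf by (auto simp: admissible_def)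
  have adm1: "admissible (\<lambda>_ _. 1) id" by (auto simp: admissible_def bounded_const_image)
  have g1: "cmod (?g x z) \<le> 1" if "x \<in> I" "z \<in> F" for x z
    using f[OF RI RF, OF that] symmetry_relative_phase(1)[OF s that] by (simp add: norm_mult)
  then have admg: "admissible ?g R" using R by (auto simp: admissible_def intro!: bounded_if_le_1)
  have fW: "form (tensor_monomial ?f id) ?W = mean ?g R"
    using form_tensor_monomial[OF _ _ _ _ admissible_symmetry[OF s], of id ?f] bf by simp
  have fE: "form (tensor_monomial ?f id) ?E = mean ?f id"
    using form_tensor_monomial[OF _ _ _ _ adm1, of id ?f] bf by simp
  have "cmod (form (tensor_monomial ?f id) (\<lambda>l z. ?W l z - ?E l z)) \<le> sqrt (2 * \<delta>) * real (card F)"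
    by (rule form_symmetry_diff_le[OF s near form_self_le[OF admf]]) (use f in simp)
  then have 1: "cmod (mean ?g R - mean ?f id) \<le> sqrt (2 * \<delta>) * real (card F)"
    by (simp only: form_diff_right fW fE)
  have "cmod (mean (\<lambda>x z. relative_phase \<kappa> (R x) (R z) * ?g x z) (R \<circ> R) - mean ?g R) \<le> sqrt (2 * \<delta>) * real (card F)"
    by (rule mean_left_mult[OF s near admg g1])
  moreover have "mean (\<lambda>x z. relative_phase \<kappa> (R x) (R z) * ?g x z) (R \<circ> R)
      = mean (\<lambda>x z. complex_of_real (f (R x) (R z))) id"
    by (rule mean_cong)
      (auto simp: symmetry_relative_phase(3)[OF s] R(2) mult.left_commute[of "cnj _"] symmetry_relative_phase(2)[OF s])
  ultimately have 2: "cmod (mean (\<lambda>x z. complex_of_real (f (R x) (R z))) id - mean ?g R) \<le> sqrt (2 * \<delta>) * real (card F)"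
    by simp
  show ?thesis
    using norm_triangle_ineq[of "mean (\<lambda>x z. complex_of_real (f (R x) (R z))) id - mean ?g R" "mean ?g R - mean ?f id"] 1 2
    by simp
qed

text \<open>The coefficient and the permutation of a product of symmetries; the head of the list acts last.\<close>

fun word :: "(('i \<Rightarrow> complex) \<times> ('i \<Rightarrow> 'i)) list \<Rightarrow> ('i \<Rightarrow> 'i \<Rightarrow> complex) \<times> ('i \<Rightarrow> 'i)" where
  "word [] = (\<lambda>_ _. 1, id)"
| "word ((\<kappa>, R) # w) = (\<lambda>x z. relative_phase \<kappa> (snd (word w) x) (snd (word w) z) * fst (word w) x z, R \<circ> snd (word w))"

lemma mean_word:
  assumes "\<And>\<kappa> R. (\<kappa>, R) \<in> set w \<Longrightarrow> symmetry \<kappa> R"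
    and "\<And>\<kappa> R. (\<kappa>, R) \<in> set w \<Longrightarrow> Re (mean (relative_phase \<kappa>) R) \<ge> (1 - \<delta>) * real (card F)"
  shows "admissible (fst (word w)) (snd (word w))
    \<and> (\<forall>x\<in>I. \<forall>z\<in>F. cmod (fst (word w) x z) \<le> 1)
    \<and> cmod (mean (fst (word w)) (snd (word w)) - of_nat (card F)) \<le> real (length w) * (sqrt (2 * \<delta>) * real (card F))"
  using assms
proof (induction w)
  case Nil
  have "admissible (\<lambda>_ _. 1) id" by (auto simp: admissible_def bounded_const_image)
  then show ?case by (simp add: mean_one del: id_apply)
next
  case (Cons a w)
  obtain \<kappa> R where a: "a = (\<kappa>, R)" by (cases a)
  let ?g = "fst (word w)" and ?\<rho> = "snd (word w)"
  have IH: "admissible ?g ?\<rho>" "\<And>x z. x \<in> I \<Longrightarrow> z \<in> F \<Longrightarrow> cmod (?g x z) \<le> 1"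
    "cmod (mean ?g ?\<rho> - of_nat (card F)) \<le> real (length w) * (sqrt (2 * \<delta>) * real (card F))"
    using Cons by auto
  have s: "symmetry \<kappa> R" and near: "Re (mean (relative_phase \<kappa>) R) \<ge> (1 - \<delta>) * real (card F)"
    using Cons.prems a by auto
  let ?h = "\<lambda>x z. relative_phase \<kappa> (?\<rho> x) (?\<rho> z) * ?g x z"
  have \<rho>: "?\<rho> x \<in> I" if "x \<in> I" for x using IH(1) that by (auto simp: admissible_def bij_betw_apply)
  have \<rho>F: "?\<rho> z \<in> F" if "z \<in> F" for z using IH(1) that by (auto simp: admissible_def)
  have h1: "cmod (?h x z) \<le> 1" if "x \<in> I" "z \<in> F" for x z
    using IH(2)[OF that] symmetry_relative_phase(1)[OF s \<rho> \<rho>F] that by (simp add: norm_mult)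
  have R: "bij_betw R I I" "R ` F \<subseteq> F" using s by (auto simp: symmetry_def)
  have "admissible ?h (R \<circ> ?\<rho>)"
    unfolding admissible_def
  proof (intro conjI ballI)
    show "bij_betw (R \<circ> ?\<rho>) I I" using IH(1) R(1) by (auto simp: admissible_def intro: bij_betw_trans)
    show "(R \<circ> ?\<rho>) ` F \<subseteq> F" using R(2) \<rho>F by (auto simp: image_subset_iff)
  qed (use h1 in \<open>auto intro!: bounded_if_le_1\<close>)
  moreover have "cmod (mean ?h (R \<circ> ?\<rho>) - of_nat (card F)) \<le> real (length (a # w)) * (sqrt (2 * \<delta>) * real (card F))"
    using mean_left_mult[OF s near IH(1,2)] IH(3)
      norm_triangle_ineq[of "mean ?h (R \<circ> ?\<rho>) - mean ?g ?\<rho>" "mean ?g ?\<rho> - of_nat (card F)"]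
    by (simp add: algebra_simps)
  ultimately show ?case using h1 unfolding a word.simps fst_conv snd_conv by blast
qed

end

section \<open>Almost invariant measures on the torus\<close>

definition torus_swap :: "complex \<times> complex \<Rightarrow> complex \<times> complex" where
  "torus_swap = (\<lambda>(z, w). (w, z))"

definition torus_shear :: "complex \<times> complex \<Rightarrow> complex \<times> complex" where
  "torus_shear = (\<lambda>(z, w). (w / z, w))"

definition torus_flip :: "complex \<times> complex \<Rightarrow> complex \<times> complex" where
  "torus_flip = (\<lambda>(z, w). (inverse z, w))"

text \<open>On the unit circle \<open>\<bar>u - 1\<bar>\<^sup>2 = 2 - 2 Re u\<close>.\<close>

lemma unit_circle_chord_less:
  assumes "cmod u = 1" "Re u > 17/18"
  shows "cmod (u - 1) < 1/3"
proof -
  have "(cmod (u - 1))\<^sup>2 = (Re u - 1)\<^sup>2 + (Im u)\<^sup>2" by (simp add: cmod_power2)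
  also have "\<dots> = (Re u)\<^sup>2 + (Im u)\<^sup>2 + 1 - 2 * Re u" by (simp add: power2_diff)
  also have "(Re u)\<^sup>2 + (Im u)\<^sup>2 = 1" using assms(1) by (metis cmod_power2 power_one)
  finally have "(cmod (u - 1))\<^sup>2 < (1/3)\<^sup>2" using assms(2) by (simp add: power2_eq_square)
  then show ?thesis by (rule power2_less_imp_less) simp
qed

lemma Re_pos_if_chord_less_1:
  assumes "cmod (u - 1) < 1"
  shows "Re u > 0"
  using abs_Re_le_cmod[of "u - 1"] assms by simp

text \<open>If \<open>zw\<close>, \<open>w / z\<close> and \<open>w\<^sup>2 / z\<close> are close to 1 then so are \<open>w\<close>, the quotient of the last two, and \<open>z\<close>.\<close>

lemma Re_pos_if_products_near_1:
  assumes c: "cmod z = 1" "cmod w = 1"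
    and r: "Re (z * w) > 17/18" "Re (w / z) > 17/18" "Re (w / z * w) > 17/18"
  shows "Re z > 0" "Re w > 0"
proof -
  have z0: "z \<noteq> 0" "w \<noteq> 0" using c by auto
  have d: "cmod (z * w - 1) < 1/3" "cmod (w / z - 1) < 1/3" "cmod (w / z * w - 1) < 1/3"
    using r c by (intro unit_circle_chord_less; simp add: norm_mult norm_divide)+
  have "cmod (w - 1) = cmod ((w - 1) * (w / z))" using c by (simp add: norm_mult norm_divide)
  also have "(w - 1) * (w / z) = (w / z * w - 1) - (w / z - 1)" by (simp add: algebra_simps diff_divide_distrib)
  also have "cmod \<dots> \<le> cmod (w / z * w - 1) + cmod (w / z - 1)" by (rule norm_triangle_ineq4)
  finally have w: "cmod (w - 1) < 2/3" using d by linarith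
  have "cmod (z - 1) = cmod ((z - 1) * w)" using c by (simp add: norm_mult)
  also have "(z - 1) * w = (z * w - 1) - (w - 1)" by (simp add: algebra_simps)
  also have "cmod \<dots> \<le> cmod (z * w - 1) + cmod (w - 1)" by (rule norm_triangle_ineq4)
  finally have z: "cmod (z - 1) < 1" using d w by linarith
  show "Re z > 0" "Re w > 0" using z w by (auto intro!: Re_pos_if_chord_less_1)
qed

lemma Arg_mult_right_half_plane:
  assumes "Re z > 0" "Re w > 0"
  shows "Arg (z * w) = Arg z + Arg w"
proof -
  have "z \<noteq> 0" "w \<noteq> 0" using assms by auto
  moreover have "\<bar>Arg z\<bar> < pi / 2" "\<bar>Arg w\<bar> < pi / 2" using assms by (auto simp only: Arg_Re_pos)
  ultimately show ?thesis by (intro Arg_times) auto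
qed

lemma Arg_inverse_right_half_plane:
  assumes "Re z > 0"
  shows "Arg (inverse z) = - Arg z"
proof (cases "z \<in> \<real>")
  case True
  then have "Arg z = 0" using assms by (auto simp: Arg_eq_0)
  then show ?thesis using True by (simp add: Arg_inverse)
qed (simp add: Arg_inverse)

text \<open>The three maps generate an action of \<open>GL\<^sub>2(\<int>)\<close> on the torus. A finitely additive measure that is almost
  invariant and almost concentrated where \<open>zw\<close> is near 1 is almost concentrated near the
  identity, where the action looks like the linear one. Let \<open>t\<close> be the quotient of the two
  angles. The maps act on \<open>t\<close> by \<open>1 / t\<close>, \<open>1 - t\<close> and \<open>- t\<close>, so that translation by 1 is
  available: \<open>(0, 1)\<close> has the same measure as \<open>(1, \<infinity>)\<close> and as \<open>(1, 2)\<close>, whence \<open>[2, \<infinity>)\<close> has measure almost 0,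
  and its images under the maps cover every value of \<open>t\<close>. Only the identity itself has no quotient \<open>t\<close>.\<close>

lemma no_almost_invariant_measure_near_identity:
  fixes \<nu> :: "(complex \<times> complex) set \<Rightarrow> real"
  assumes nonneg: "\<And>E. \<nu> E \<ge> 0"
    and add: "\<And>E F. E \<inter> F = {} \<Longrightarrow> \<nu> (E \<union> F) = \<nu> E + \<nu> F"
    and total: "\<nu> UNIV = 1"
    and circle: "\<nu> {(z, w). \<not> (cmod z = 1 \<and> cmod w = 1)} = 0"
    and identity: "\<nu> {(1, 1)} = 0"
    and inv: "\<And>R E. R \<in> {torus_swap, torus_shear, torus_flip} \<Longrightarrow> \<bar>\<nu> (R -` E) - \<nu> E\<bar> \<le> \<epsilon>"
    and phase: "\<nu> {(z, w). cmod z = 1 \<and> cmod w = 1 \<and> Re (z * w) \<le> 17/18} \<le> 180 * \<epsilon>"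
    and \<epsilon>: "\<epsilon> \<le> 1/10000"
  shows False
proof -
  have mono: "\<nu> E \<le> \<nu> F" if "E \<subseteq> F" for E F
    using add[of E "F - E"] nonneg[of "F - E"] that by (simp add: Un_absorb1)
  have sub: "\<nu> (E \<union> F) \<le> \<nu> E + \<nu> F" for E F
    using add[of E "F - E"] mono[of "F - E" F] by simp
  define N where "N = {(z, w). cmod z = 1 \<and> cmod w = 1 \<and> Re (z * w) \<le> 17/18}"
  define G where "G = {(z, w). cmod z = 1 \<and> cmod w = 1 \<and> Re z > 0 \<and> Re w > 0}"
  define \<eta> where "\<eta> = \<nu> (- G)"
  have \<eta>: "\<eta> \<le> 542 * \<epsilon>"
  proof -
    have "- G \<subseteq> {(z, w). \<not> (cmod z = 1 \<and> cmod w = 1)} \<union> (N \<union> (torus_flip -` N \<union> torus_shear -` N))"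
    proof
      fix x :: "complex \<times> complex" assume x: "x \<in> - G"
      obtain z w where zw: "x = (z, w)" by (cases x)
      show "x \<in> {(z, w). \<not> (cmod z = 1 \<and> cmod w = 1)} \<union> (N \<union> (torus_flip -` N \<union> torus_shear -` N))"
      proof (cases "cmod z = 1 \<and> cmod w = 1")
        case True
        then have c: "cmod z = 1" "cmod w = 1" by simp_all
        have "\<not> (Re z > 0 \<and> Re w > 0)" using x c by (simp add: zw G_def)
        then consider "Re (z * w) \<le> 17/18" | "Re (inverse z * w) \<le> 17/18" | "Re (w / z * w) \<le> 17/18"
          using Re_pos_if_products_near_1[OF c] by (metis divide_inverse mult.commute not_le)
        then show ?thesis
        proof cases
          case 1 then have "x \<in> N" unfolding zw N_def mem_Collect_eq prod.case using c by blast
          then show ?thesis by blast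
        next
          case 2 then have "torus_flip x \<in> N"
            unfolding zw N_def torus_flip_def mem_Collect_eq prod.case using c by (metis inverse_1 norm_inverse)
          then show ?thesis by blast
        next
          case 3 then have "torus_shear x \<in> N"
            unfolding zw N_def torus_shear_def mem_Collect_eq prod.case using c by (metis div_by_1 norm_divide)
          then show ?thesis by blast
        qed
      qed (simp add: zw)
    qed
    from order_trans[OF mono[OF this] sub]
    have "\<eta> \<le> \<nu> (N \<union> (torus_flip -` N \<union> torus_shear -` N))" using circle by (simp add: \<eta>_def)
    also have "\<dots> \<le> \<nu> N + (\<nu> (torus_flip -` N) + \<nu> (torus_shear -` N))"
      by (meson sub order_trans add_left_mono)
    \<comment> \<open>Three sets of measure \<open>180 \<epsilon>\<close>, two of them moved once.\<close>
    also have "\<dots> \<le> 542 * \<epsilon>"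
      using phase inv[of torus_flip N] inv[of torus_shear N] unfolding N_def[symmetric] by simp
    finally show ?thesis .
  qed
  define S where "S P = {(z, w). (z, w) \<in> G \<and> P (Arg z) (Arg w)}" for P :: "real \<Rightarrow> real \<Rightarrow> bool"
  have G_move: "\<nu> (S P) \<le> \<nu> E + \<epsilon>"
    if "R \<in> {torus_swap, torus_shear, torus_flip}" "S P \<subseteq> R -` E" for P R E
    using mono[OF that(2)] inv[OF that(1), of E] by linarith
  have swap: "\<nu> (S P) \<le> \<nu> (S Q) + \<epsilon>" if "\<And>a b. P a b \<Longrightarrow> Q b a" for P Q
    by (rule G_move[of torus_swap]) (auto simp: S_def torus_swap_def G_def that)
  have flip: "\<nu> (S P) \<le> \<nu> (S Q) + \<epsilon>" if "\<And>a b. P a b \<Longrightarrow> Q (- a) b" for P Q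
  proof (rule G_move[of torus_flip])
    show "S P \<subseteq> torus_flip -` S Q"
    proof
      fix x assume "x \<in> S P"
      then obtain z w where x: "x = (z, w)" and zw: "(z, w) \<in> G" "P (Arg z) (Arg w)" by (auto simp: S_def)
      then have z: "cmod z = 1" "Re z > 0" by (auto simp: G_def)
      have "inverse z = cnj z"
        using z complex_norm_square[of z] by (intro inverse_unique) simp
      then have "Re (inverse z) > 0" using z by simp
      then have "(inverse z, w) \<in> S Q"
        using zw that by (simp add: S_def G_def norm_inverse Arg_inverse_right_half_plane)
      then show "x \<in> torus_flip -` S Q" by (simp add: x torus_flip_def)
    qed
  qed simp
  have translate: "\<nu> (S P) \<le> \<nu> (S Q) + \<eta> + 2 * \<epsilon>" if "\<And>a b. P a b \<Longrightarrow> Q (a + b) b" for P Q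
  proof -
    have "S P \<subseteq> torus_flip -` (torus_shear -` (S Q \<union> - G))"
    proof
      fix x assume "x \<in> S P"
      then obtain z w where x: "x = (z, w)" and zw: "(z, w) \<in> G" "P (Arg z) (Arg w)" by (auto simp: S_def)
      have "(z * w, w) \<in> S Q \<union> - G"
        using zw that Arg_mult_right_half_plane[of z w] by (auto simp: S_def G_def)
      then show "x \<in> torus_flip -` (torus_shear -` (S Q \<union> - G))"
        by (simp add: x torus_flip_def torus_shear_def divide_inverse mult.commute)
    qed
    from mono[OF this] have "\<nu> (S P) \<le> \<nu> (S Q \<union> - G) + 2 * \<epsilon>"
      using inv[of torus_flip "torus_shear -` (S Q \<union> - G)"] inv[of torus_shear "S Q \<union> - G"] by simp
    also have "\<nu> (S Q \<union> - G) \<le> \<nu> (S Q) + \<eta>" using sub by (simp add: \<eta>_def)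
    finally show ?thesis by simp
  qed
  \<comment> \<open>In terms of \<open>t = a / b\<close>: \<open>(0, 1)\<close>, \<open>(1, \<infinity>)\<close>, \<open>(1, 2)\<close>, \<open>[2, \<infinity>)\<close>, \<open>[1, \<infinity>)\<close>, \<open>t > 0\<close>, \<open>t < 0\<close>, \<open>0\<close> and \<open>\<infinity>\<close>.\<close>
  let ?i = "\<lambda>a b::real. a * b > 0 \<and> \<bar>a\<bar> < \<bar>b\<bar>" and ?o = "\<lambda>a b::real. a * b > 0 \<and> \<bar>a\<bar> > \<bar>b\<bar>"
  let ?m = "\<lambda>a b::real. a * b > 0 \<and> \<bar>b\<bar> < \<bar>a\<bar> \<and> \<bar>a\<bar> < 2 * \<bar>b\<bar>"
  let ?t = "\<lambda>a b::real. a * b > 0 \<and> 2 * \<bar>b\<bar> \<le> \<bar>a\<bar>" and ?u = "\<lambda>a b::real. a * b > 0 \<and> \<bar>b\<bar> \<le> \<bar>a\<bar>"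
  let ?p = "\<lambda>a b::real. a * b > 0" and ?n = "\<lambda>a b::real. a * b < 0"
  let ?z = "\<lambda>a b::real. a = 0 \<and> b \<noteq> 0" and ?y = "\<lambda>a b::real. a \<noteq> 0 \<and> b = 0"
  have "\<nu> (S ?i) \<le> \<nu> (S ?m) + \<eta> + 2 * \<epsilon>"
    by (rule translate) (auto simp: zero_less_mult_iff)
  moreover have "\<nu> (S ?o) \<le> \<nu> (S ?i) + \<epsilon>"
    by (rule swap) (auto simp: mult.commute)
  moreover have "\<nu> (S ?o) = \<nu> (S ?m) + \<nu> (S ?t)"
  proof -
    have "S ?o = S ?m \<union> S ?t" by (auto simp: S_def zero_less_mult_iff)
    moreover have "S ?m \<inter> S ?t = {}" by (auto simp: S_def)
    ultimately show ?thesis using add by simp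
  qed
  ultimately have t: "\<nu> (S ?t) \<le> \<eta> + 3 * \<epsilon>" by linarith
  have "\<nu> (S ?u) \<le> \<nu> (S ?t) + \<eta> + 2 * \<epsilon>"
    by (rule translate) (auto simp: zero_less_mult_iff)
  with t have u: "\<nu> (S ?u) \<le> 2 * \<eta> + 5 * \<epsilon>" by linarith
  have "\<nu> (S ?i) \<le> \<nu> (S ?u) + \<epsilon>"
    by (rule swap) (auto simp: mult.commute)
  with u have i: "\<nu> (S ?i) \<le> 2 * \<eta> + 6 * \<epsilon>" by linarith
  have "S ?p \<subseteq> S ?u \<union> S ?i" by (auto simp: S_def)
  from order_trans[OF mono[OF this] sub] u i have p: "\<nu> (S ?p) \<le> 4 * \<eta> + 11 * \<epsilon>" by linarith
  have "\<nu> (S ?n) \<le> \<nu> (S ?p) + \<epsilon>"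
    by (rule flip) (auto simp: mult_less_0_iff zero_less_mult_iff)
  with p have n: "\<nu> (S ?n) \<le> 4 * \<eta> + 12 * \<epsilon>" by linarith
  have "\<nu> (S ?z) \<le> \<nu> (S ?u) + \<eta> + 2 * \<epsilon>"
    by (rule translate) (auto simp: zero_less_mult_iff)
  with u have z: "\<nu> (S ?z) \<le> 3 * \<eta> + 7 * \<epsilon>" by linarith
  have "\<nu> (S ?y) \<le> \<nu> (S ?z) + \<epsilon>"
    by (rule swap) auto
  with z have y: "\<nu> (S ?y) \<le> 3 * \<eta> + 8 * \<epsilon>" by linarith
  have "UNIV \<subseteq> - G \<union> ({(1, 1)} \<union> (S ?p \<union> (S ?n \<union> (S ?z \<union> S ?y))))"
  proof
    fix x :: "complex \<times> complex"
    obtain a b where x: "x = (a, b)" by (cases x)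
    have one: "c = 1" if "cmod c = 1" "Arg c = 0" for c
      using that complex_eq_iff Arg_eq_0[of c] by (metis Arg_eq_0 Re_complex_of_real abs_of_nonneg complex_is_Real_iff norm_of_real of_real_1 of_real_Re)
    show "x \<in> - G \<union> ({(1, 1)} \<union> (S ?p \<union> (S ?n \<union> (S ?z \<union> S ?y))))"
    proof (cases "x \<in> G")
      case True
      then have c: "cmod a = 1" "cmod b = 1" by (auto simp: G_def x)
      consider "Arg a * Arg b > 0" | "Arg a * Arg b < 0" | "Arg a = 0" "Arg b \<noteq> 0"
        | "Arg a \<noteq> 0" "Arg b = 0" | "Arg a = 0" "Arg b = 0"
        by (metis linorder_neqE_linordered_idom mult_eq_0_iff)
      then show ?thesis
        by cases (use True one[OF c(1)] one[OF c(2)] in \<open>auto simp: S_def x\<close>)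
    qed simp
  qed
  from mono[OF this] have "1 \<le> \<nu> (- G \<union> ({(1, 1)} \<union> (S ?p \<union> (S ?n \<union> (S ?z \<union> S ?y)))))"
    by (simp add: total)
  also have "\<dots> \<le> \<nu> (- G) + (\<nu> {(1, 1)} + (\<nu> (S ?p) + (\<nu> (S ?n) + (\<nu> (S ?z) + \<nu> (S ?y)))))"
    by (meson sub order_trans add_left_mono)
  also have "\<dots> \<le> 15 * \<eta> + 38 * \<epsilon>"
    using p n z y identity unfolding \<eta>_def[symmetric] by linarith
  also have "\<dots> < 1" using \<eta> \<epsilon> by linarith
  finally show False by simp
qed

section \<open>Torsion points of the torus\<close>

definition torsion :: "nat \<Rightarrow> (complex \<times> complex) set" where
  "torsion n = {(z, w). z ^ n = 1 \<and> w ^ n = 1}"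

definition torsion_points :: "(complex \<times> complex) set" where
  "torsion_points = (\<Union>n\<in>{0<..}. torsion n)"

lemma torsion_points_unit:
  assumes "(z, w) \<in> torsion_points"
  shows "cmod z = 1" "cmod w = 1" "z \<noteq> 0" "w \<noteq> 0" "cnj z = inverse z" "cnj w = inverse w"
proof -
  obtain n where n: "n > 0" "z ^ n = 1" "w ^ n = 1"
    using assms by (auto simp: torsion_points_def torsion_def)
  show 1: "cmod z = 1" "cmod w = 1" using n power_eq_1_iff[of z n] power_eq_1_iff[of w n] by auto
  then show "z \<noteq> 0" "w \<noteq> 0" by auto
  show "cnj z = inverse z" "cnj w = inverse w"
    using 1 complex_norm_square[of z] complex_norm_square[of w] by (auto intro!: inverse_unique[symmetric])
qed

lemma finite_torsion: "n > 0 \<Longrightarrow> finite (torsion n)"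
proof -
  assume n: "n > 0"
  have "torsion n = {z. z ^ n = 1} \<times> {w. w ^ n = 1}" by (auto simp: torsion_def)
  then show ?thesis using finite_roots_unity[of n, where 'a = complex] n by simp
qed

lemma torsion_mult: "torsion m \<union> torsion n \<subseteq> torsion (m * n)"
  by (auto simp: torsion_def power_mult) (simp_all add: power_mult[symmetric] mult.commute[of m n], simp_all add: power_mult)

lemma finite_subset_torsion:
  assumes "finite S" "S \<subseteq> torsion_points"
  shows "\<exists>n>0. S \<subseteq> torsion n"
  using assms
proof (induction S rule: finite_induct)
  case empty
  then show ?case by auto
next
  case (insert x S)
  then obtain m n where "m > 0" "S \<subseteq> torsion m" "n > 0" "x \<in> torsion n"
    by (auto simp: torsion_points_def)
  then show ?case using torsion_mult[of m n] by (intro exI[of _ "m * n"]) auto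
qed

definition torus_involutions :: "(complex \<times> complex \<Rightarrow> complex \<times> complex) set" where
  "torus_involutions = {torus_swap, torus_shear, torus_flip}"

lemma torus_involution_torsion:
  assumes "R \<in> torus_involutions" "x \<in> torsion n"
  shows "R x \<in> torsion n"
  using assms by (auto simp: torus_involutions_def torus_swap_def torus_shear_def torus_flip_def
      torsion_def power_divide power_inverse)

lemma torus_involution_involutive:
  assumes "R \<in> torus_involutions" "x \<in> torsion_points"
  shows "R (R x) = x"
proof (cases x)
  case (Pair z w)
  then show ?thesis
    using assms torsion_points_unit[of z w]
    by (auto simp: torus_involutions_def torus_swap_def torus_shear_def torus_flip_def)
qed

lemma torus_involution_torsion_points:
  "R \<in> torus_involutions \<Longrightarrow> x \<in> torsion_points \<Longrightarrow> R x \<in> torsion_points"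
  using torus_involution_torsion by (fastforce simp: torsion_points_def)

lemma bij_betw_torus_involution:
  assumes "R \<in> torus_involutions"
  shows "bij_betw R torsion_points torsion_points"
  by (rule bij_betw_byWitness[where f' = R])
    (use assms torus_involution_involutive torus_involution_torsion_points in auto)

text \<open>The points whose order divides \<open>2n\<close> but not \<open>n\<close>, where \<open>n\<close> kills the given finite set.\<close>

lemma finite_invariant_set_avoiding:
  assumes "finite S" "S \<subseteq> torsion_points"
  shows "\<exists>F. finite F \<and> F \<noteq> {} \<and> F \<subseteq> torsion_points \<and> S \<inter> F = {} \<and> (\<forall>R\<in>torus_involutions. R ` F \<subseteq> F)"
proof -
  obtain n where n: "n > 0" "S \<subseteq> torsion n" using finite_subset_torsion[OF assms] by blast
  define F where "F = torsion (2 * n) - torsion n"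
  have F: "F \<subseteq> torsion_points" using n(1) unfolding F_def torsion_points_def by (auto intro!: bexI[of _ "2 * n"])
  moreover have "finite F" using n(1) by (simp add: F_def finite_torsion)
  moreover have "(cis (pi / n), 1) \<in> F"
  proof -
    have "cis (pi / n) ^ n = - 1" using n(1) by (simp add: Complex.DeMoivre)
    then show ?thesis by (simp add: F_def torsion_def power_mult mult.commute[of 2])
  qed
  then have "F \<noteq> {}" by blast
  moreover have "R ` F \<subseteq> F" if R: "R \<in> torus_involutions" for R
  proof
    fix y assume "y \<in> R ` F"
    then obtain x where x: "x \<in> F" "y = R x" by blast
    then have "R y = x" using R F torus_involution_involutive[of R x] by (simp add: subsetD)
    then show "y \<in> F" using torus_involution_torsion[OF R] x \<open>R y = x\<close> unfolding F_def by (metis DiffD1 DiffD2 DiffI)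
  qed
  ultimately show ?thesis using n(2) by (intro exI[of _ F]) (auto simp: F_def)
qed

lemma infinite_torsion_points: "infinite torsion_points"
  using finite_invariant_set_avoiding[of torsion_points] by auto

lemma countable_torsion_points: "countable torsion_points"
  unfolding torsion_points_def by (rule countable_UN) (auto intro: countable_finite finite_torsion)

definition quotient :: "complex \<times> complex \<Rightarrow> complex \<times> complex \<Rightarrow> complex \<times> complex" where
  "quotient x y = (fst x / fst y, snd x / snd y)"

lemma quotient_torus_involution:
  assumes "R \<in> torus_involutions"
  shows "quotient (R x) (R y) = R (quotient x y)"
  using assms by (auto simp: torus_involutions_def torus_swap_def torus_shear_def torus_flip_def quotient_def
      split: prod.splits simp: divide_simps)

section \<open>The obstruction\<close>

text \<open>The phase of the third symmetry makes a suitable product of the three a nontrivial diagonal operator.\<close>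

definition torus_symmetries :: "((complex \<times> complex \<Rightarrow> complex) \<times> (complex \<times> complex \<Rightarrow> complex \<times> complex)) set" where
  "torus_symmetries = {(\<lambda>_. 1, torus_swap), (\<lambda>_. 1, torus_shear), (fst, torus_flip)}"

text \<open>The functional yields a finitely additive measure on pairs of torsion points, the second in \<open>F\<close>, and its
  image under \<open>quotient\<close> is a measure on the torus. That is almost invariant because the involutions commute
  with \<open>quotient\<close>. It has no mass at the identity, since for each \<open>z\<close> the quotient is the identity for just one \<open>x\<close>, and the
  functional vanishes on operators of rank one. It is concentrated where \<open>zw\<close> is near 1, because the
  word \<open>(s\<^sub>1 s\<^sub>3)\<^sup>2 (s\<^sub>1 s\<^sub>2)\<^sup>3\<close> in the symmetries is diagonal, with entry \<open>1 / (zw)\<close> at pairs of quotient \<open>(z, w)\<close>.\<close>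

lemma no_functional_on_torus:
  assumes "amplified_functional e torsion_points F \<psi>"
    and inv: "\<And>R. R \<in> torus_involutions \<Longrightarrow> R ` F \<subseteq> F"
    and compact: "\<And>y z T. y \<in> F \<Longrightarrow> z \<in> F \<Longrightarrow> compact_op T \<Longrightarrow> \<psi> y z T = 0"
    and near: "\<And>\<kappa> R y z. (\<kappa>, R) \<in> torus_symmetries \<Longrightarrow>
      y \<in> F \<Longrightarrow> z \<in> F \<Longrightarrow>
      cmod (\<psi> y z (orthonormal_basis.monomial e torsion_points \<kappa> R)
        - cinner (e y) (bop_apply (orthonormal_basis.monomial e torsion_points \<kappa> R) (e z))) \<le> 1/800000000"
  shows False
proof -
  interpret amplified_functional e torsion_points F \<psi> by fact
  define n where "n = real (card F)"
  have n: "n > 0" using F by (simp add: n_def card_gt_0_iff)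
  define \<delta> :: real where "\<delta> = 1/800000000"
  \<comment> \<open>The invariance error \<open>2 \<surd>(2 \<delta>)\<close> then equals the bound \<open>1/10000\<close> of \<open>no_almost_invariant_measure_near_identity\<close>.\<close>
  have sq: "sqrt (2 * \<delta>) = 1/20000"
    by (rule real_sqrt_unique) (simp_all add: \<delta>_def power2_eq_square)
  have sym: "symmetry \<kappa> R" if "(\<kappa>, R) \<in> torus_symmetries" for \<kappa> R
  proof -
    have R: "R \<in> torus_involutions" using that by (auto simp: torus_symmetries_def torus_involutions_def)
    have "cmod (\<kappa> x) = 1 \<and> \<kappa> (R x) = cnj (\<kappa> x)" if x: "x \<in> torsion_points" for x
      using torsion_points_unit[of "fst x" "snd x"] x \<open>(\<kappa>, R) \<in> torus_symmetries\<close>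
      by (auto simp: torus_symmetries_def torus_flip_def split: prod.splits)
    then show ?thesis
      using bij_betw_torus_involution[OF R] torus_involution_involutive[OF R] inv[OF R]
      by (auto simp: symmetry_def)
  qed
  have near': "Re (mean (relative_phase \<kappa>) R) \<ge> (1 - \<delta>) * real (card F)"
    if "(\<kappa>, R) \<in> torus_symmetries" for \<kappa> R
    by (rule mean_symmetry_ge[OF sym[OF that]]) (use near[OF that] in \<open>simp add: \<delta>_def\<close>)
  define ind where "ind E x z = (if quotient x z \<in> E then 1 else 0 :: real)" for E x z
  have b: "bounded ((\<lambda>x. complex_of_real (ind E x z)) ` torsion_points)" for E z
    by (rule bounded_if_le_1) (simp add: ind_def)
  define \<nu> where "\<nu> E = Re (mean (\<lambda>x z. complex_of_real (ind E x z)) id) / n" for E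
  have unit: "cmod (fst (quotient x z)) = 1" "cmod (snd (quotient x z)) = 1"
    if "x \<in> torsion_points" "z \<in> F" for x z
    using torsion_points_unit[of "fst x" "snd x"] torsion_points_unit[of "fst z" "snd z"] that F
    by (auto simp: quotient_def norm_divide)
  have ind_cong: "\<nu> E = \<nu> E'" if "\<And>x z. x \<in> torsion_points \<Longrightarrow> z \<in> F \<Longrightarrow> quotient x z \<in> E \<longleftrightarrow> quotient x z \<in> E'" for E E'
    unfolding \<nu>_def using mean_cong[of "\<lambda>x z. complex_of_real (ind E x z)" "\<lambda>x z. complex_of_real (ind E' x z)" id id] that
    by (simp add: ind_def)
  show False
  proof (rule no_almost_invariant_measure_near_identity[of \<nu> "1/10000"])
    show "\<nu> E \<ge> 0" for E
    proof -
      have "mean (\<lambda>x z. complex_of_real (ind E x z)) id \<in> \<real>\<^sub>\<ge>\<^sub>0"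
        by (rule mean_diagonal_nonneg[OF b]) (simp add: ind_def)
      then show ?thesis using n by (simp add: \<nu>_def complex_nonneg_Reals_iff)
    qed
    show "\<nu> (A \<union> B) = \<nu> A + \<nu> B" if AB: "A \<inter> B = {}" for A B
    proof -
      have "mean (\<lambda>x z. complex_of_real (ind (A \<union> B) x z)) id
          = mean (\<lambda>x z. complex_of_real (ind A x z) + complex_of_real (ind B x z)) id"
        by (rule mean_cong) (use AB in \<open>auto simp: ind_def\<close>)
      also have "\<dots> = mean (\<lambda>x z. complex_of_real (ind A x z)) id + mean (\<lambda>x z. complex_of_real (ind B x z)) id"
        by (rule mean_diagonal_add[OF b b])
      finally show ?thesis by (simp add: \<nu>_def add_divide_distrib)
    qed
    have "mean (\<lambda>x z. complex_of_real (ind UNIV x z)) id = mean (\<lambda>_ _. 1) id"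
      by (rule mean_cong) (auto simp: ind_def)
    then show "\<nu> UNIV = 1" using n unfolding \<nu>_def mean_one by (simp add: n_def)
    have empty: "\<nu> {} = 0"
    proof -
      have "mean (\<lambda>x z. complex_of_real (ind {} x z)) id = mean (\<lambda>x z. 0 * complex_of_real (ind {} x z)) id"
        by (rule mean_cong) (auto simp: ind_def)
      then show ?thesis by (simp only: \<nu>_def mean_diagonal_scale[OF b]) simp
    qed
    show "\<nu> {(z, w). \<not> (cmod z = 1 \<and> cmod w = 1)} = 0"
      unfolding empty[symmetric] by (rule ind_cong) (use unit in \<open>force simp: split_beta\<close>)
    show "\<nu> {(1, 1)} = 0"
    proof -
      have "quotient x z = (1, 1) \<longleftrightarrow> x = z" if "x \<in> torsion_points" "z \<in> F" for x z
        using torsion_points_unit[of "fst z" "snd z"] that F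
        by (auto simp: quotient_def prod_eq_iff)
      then have "mean (\<lambda>x z. complex_of_real (ind {(1, 1)} x z)) id = mean (\<lambda>x z. if x = z then 1 else 0) id"
        by (intro mean_cong) (auto simp: ind_def)
      also have "\<dots> = 0"
        unfolding mean_def using F by (intro sum.neutral ballI compact) (auto intro: compact_op_monomial_at)
      finally show ?thesis by (simp add: \<nu>_def)
    qed
    show "\<bar>\<nu> (R -` E) - \<nu> E\<bar> \<le> 1/10000" if R: "R \<in> {torus_swap, torus_shear, torus_flip}" for R E
    proof -
      obtain \<kappa> where \<kappa>: "(\<kappa>, R) \<in> torus_symmetries" using R by (auto simp: torus_symmetries_def)
      have R': "R \<in> torus_involutions" using R by (simp add: torus_involutions_def)
      have "cmod (mean (\<lambda>x z. complex_of_real (ind E (R x) (R z))) id - mean (\<lambda>x z. complex_of_real (ind E x z)) id)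
          \<le> 2 * sqrt (2 * \<delta>) * real (card F)"
        by (rule mean_diagonal_invariant[OF sym[OF \<kappa>] near'[OF \<kappa>]]) (simp add: ind_def)
      moreover have "(\<lambda>x z. complex_of_real (ind E (R x) (R z))) = (\<lambda>x z. complex_of_real (ind (R -` E) x z))"
        by (intro ext) (simp add: ind_def quotient_torus_involution[OF R'])
      ultimately have "cmod (mean (\<lambda>x z. complex_of_real (ind (R -` E) x z)) id - mean (\<lambda>x z. complex_of_real (ind E x z)) id)
          \<le> n / 10000"
        by (simp add: sq n_def)
      from order_trans[OF abs_Re_le_cmod this]
      have "\<bar>Re (mean (\<lambda>x z. complex_of_real (ind (R -` E) x z)) id) - Re (mean (\<lambda>x z. complex_of_real (ind E x z)) id)\<bar>
          \<le> n / 10000"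
        by (simp only: minus_complex.sel)
      then show ?thesis using n by (simp add: \<nu>_def diff_divide_distrib[symmetric] divide_simps)
    qed
    show "\<nu> {(z, w). cmod z = 1 \<and> cmod w = 1 \<and> Re (z * w) \<le> 17/18} \<le> 180 * (1/10000)"
    proof -
      let ?N = "{(z, w). cmod z = 1 \<and> cmod w = 1 \<and> Re (z * w) \<le> (17/18 :: real)}"
      let ?s1 = "(\<lambda>_ :: complex \<times> complex. 1 :: complex, torus_swap)" and ?s2 = "(\<lambda>_ :: complex \<times> complex. 1 :: complex, torus_shear)"
        and ?s3 = "(fst :: complex \<times> complex \<Rightarrow> complex, torus_flip)"
      \<comment> \<open>As permutations, \<open>(s\<^sub>1 s\<^sub>2)\<^sup>3\<close> and \<open>(s\<^sub>1 s\<^sub>3)\<^sup>2\<close> both invert the torus; only the latter picks up phases.\<close>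
      define w where "w = [?s1, ?s3, ?s1, ?s3, ?s1, ?s2, ?s1, ?s2, ?s1, ?s2]"
      define g where "g x z = cnj (fst (quotient x z) * snd (quotient x z))" for x z
      have w: "(\<kappa>, R) \<in> torus_symmetries" if "(\<kappa>, R) \<in> set w" for \<kappa> R
        using that by (auto simp: w_def torus_symmetries_def)
      have "cmod (mean (fst (word w)) (snd (word w)) - of_nat (card F)) \<le> real (length w) * (sqrt (2 * \<delta>) * real (card F))"
        by (rule mean_word[OF sym[OF w] near'[OF w], THEN conjunct2, THEN conjunct2])
      moreover have "length w = 10" by (simp add: w_def)
      ultimately have close: "cmod (mean (fst (word w)) (snd (word w)) - of_nat (card F)) \<le> n / 2000"
        by (simp add: sq n_def)
      have cons: "snd (word ((\<kappa>, R) # v)) x = R (snd (word v) x)"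
        "fst (word ((\<kappa>, R) # v)) x z = relative_phase \<kappa> (snd (word v) x) (snd (word v) z) * fst (word v) x z" for \<kappa> R v x z
        by simp_all
      have trivial: "relative_phase (\<lambda>_. 1) x z = 1" for x z :: "complex \<times> complex" by (simp add: relative_phase_def)
      have inversion: "snd (word [?s1, ?s2, ?s1, ?s2, ?s1, ?s2]) (a, b) = (inverse a, inverse b)"
        if "a \<noteq> 0" "b \<noteq> 0" for a b
        unfolding cons word.simps(1) using that by (simp add: torus_swap_def torus_shear_def field_simps)
      have phase: "fst (word [?s1, ?s2, ?s1, ?s2, ?s1, ?s2]) x z = 1" for x z
        unfolding cons trivial word.simps(1) by simp
      have "mean (fst (word w)) (snd (word w)) = mean g id"
      proof (rule mean_cong)
        fix x assume x: "x \<in> torsion_points"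
        obtain a b where ab: "x = (a, b)" by (cases x)
        note a = torsion_points_unit[of a b, OF x[unfolded ab]]
        show "snd (word w) x = id x"
          unfolding w_def cons(1)[of _ _ "_ # _ # _ # _ # _ # _ # _"] ab inversion[OF a(3,4)]
          by (simp add: torus_swap_def torus_flip_def)
        fix z assume "z \<in> F"
        then have z: "z \<in> torsion_points" using F by auto
        obtain c d where cd: "z = (c, d)" by (cases z)
        note c = torsion_points_unit[of c d, OF z[unfolded cd]]
        show "fst (word w) x z = g x z"
          unfolding w_def cons(1)[of _ _ "_ # _ # _ # _ # _ # _ # _"] cons(2)[of _ _ "_ # _ # _ # _ # _ # _ # _"]
            cons[of _ _ "[?s1, ?s2, ?s1, ?s2, ?s1, ?s2]"] trivial ab cd
            inversion[OF a(3,4)] inversion[OF c(3,4)] phase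
          by (simp add: torus_swap_def torus_flip_def relative_phase_def g_def quotient_def a c divide_inverse)
      qed
      then have "Re (mean g id) \<ge> n - n / 2000"
        using close abs_Re_le_cmod[of "mean g id - of_nat (card F)"] by (simp add: n_def)
      have g1: "cmod (g x z) \<le> 1" if "x \<in> torsion_points" "z \<in> F" for x z
        using unit[OF that] by (simp add: g_def norm_mult)
      have bg: "bounded ((\<lambda>x. g x z) ` torsion_points)" if "z \<in> F" for z
        using g1 that by (intro bounded_if_le_1)
      have bRe: "bounded ((\<lambda>x. complex_of_real (Re (g x z))) ` torsion_points)" if "z \<in> F" for z
      proof (rule bounded_if_le_1)
        show "cmod (complex_of_real (Re (g x z))) \<le> 1" if "x \<in> torsion_points" for x
          using order_trans[OF abs_Re_le_cmod g1[OF that \<open>z \<in> F\<close>]] by simp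
      qed
      have bsum: "bounded ((\<lambda>x. complex_of_real (Re (g x z)) + (1/18) * complex_of_real (ind ?N x z)) ` torsion_points)"
        if "z \<in> F" for z
        using bRe[OF that] b by (intro bounded_plus_comp bounded_mult_image bounded_const_image)
      \<comment> \<open>Chebyshev's inequality for \<open>1 - Re g\<close>, which is at least \<open>1/18\<close> on the set.\<close>
      have "Re (mean (\<lambda>x z. complex_of_real (Re (g x z) + (1/18) * ind ?N x z)) id) \<le> Re (mean (\<lambda>x z. complex_of_real 1) id)"
      proof (rule mean_diagonal_mono)
        show "bounded ((\<lambda>x. complex_of_real (Re (g x z) + (1/18) * ind ?N x z)) ` torsion_points)" if "z \<in> F" for z
          using bsum[OF that] by simp
        show "Re (g x z) + (1/18) * ind ?N x z \<le> 1" if "x \<in> torsion_points" "z \<in> F" for x z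
          using g1[OF that] complex_Re_le_cmod[of "g x z"]
          by (auto simp: ind_def g_def split_beta)
      qed (rule bounded_const_image)
      moreover have "mean (\<lambda>x z. complex_of_real (Re (g x z) + (1/18) * ind ?N x z)) id
          = mean (\<lambda>x z. complex_of_real (Re (g x z))) id + (1/18) * mean (\<lambda>x z. complex_of_real (ind ?N x z)) id"
      proof -
        have "bounded ((\<lambda>x. (1/18) * complex_of_real (ind ?N x z)) ` torsion_points)" for z
          using b by (intro bounded_mult_image bounded_const_image)
        from mean_diagonal_add[OF bRe this] mean_diagonal_scale[OF b, where c = "1/18"]
        show ?thesis by simp
      qed
      ultimately have "Re (mean g id) + (1/18) * (\<nu> ?N * n) \<le> n"
        using n Re_mean_diagonal[OF bg] by (simp add: \<nu>_def n_def mean_one del: id_apply)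
      then have "\<nu> ?N * n \<le> (18/2000) * n" using \<open>Re (mean g id) \<ge> n - n / 2000\<close> by simp
      then have "\<nu> ?N \<le> 18/2000" using n by (simp only: mult_le_cancel_right_pos)
      then show ?thesis by simp
    qed
  qed simp
qed

section \<open>The essential projections\<close>

lemma op_norm_le: "b \<ge> 0 \<Longrightarrow> (\<And>x. norm (bop_apply A x) \<le> b * norm x) \<Longrightarrow> op_norm A \<le> b"
  by transfer (rule norm_blinfun_bound)

lemma essential_projection_if_projection:
  fixes P :: "'h::chilbert_space bop"
  assumes P: "star P = P" "P * P = P"
  shows "essential_projection P"
proof -
  have sq: "cinner x (bop_apply P x) = complex_of_real ((norm (bop_apply P x))\<^sup>2)" for x
  proof -
    have "cinner x (bop_apply P x) = cinner x (bop_apply (P * P) x)" by (simp only: P(2))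
    also have "\<dots> = cinner (bop_apply P x) (bop_apply P x)"
      by (metis P(1) bop_apply_times star_bop_right)
    finally show ?thesis by (simp only: norm_sq_cinner)
  qed
  have "norm (bop_apply P x) \<le> 1 * norm x" for x
  proof (cases "bop_apply P x = 0")
    case False
    have "norm (bop_apply P x) * norm (bop_apply P x) = cmod (cinner x (bop_apply P x))"
      unfolding sq by (simp add: norm_mult power2_eq_square)
    also have "\<dots> \<le> norm x * norm (bop_apply P x)" by (rule Cauchy_Schwarz_cinner)
    finally show ?thesis using False by simp
  qed simp
  then have "op_norm P \<le> 1" by (intro op_norm_le) auto
  moreover have "positive_op P" unfolding positive_op_def sq by (simp only: nonneg_Reals_of_real_iff) simp
  moreover have "is_projection (calkin_proj P)"
    by (simp add: is_projection_def star_calkin.abs_eq times_calkin.abs_eq P)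
  ultimately show ?thesis by (simp add: essential_projection_def)
qed

lemma calkin_proj_sum: "calkin_proj (\<Sum>i\<in>S. f i) = (\<Sum>i\<in>S. calkin_proj (f i))"
  by (induction S rule: infinite_finite_induct)
    (simp_all add: zero_calkin_def plus_calkin.abs_eq[symmetric])

lemma star_half_one_plus: "star U = U \<Longrightarrow> star ((1/2) *\<^sub>C (1 + U)) = (1/2) *\<^sub>C (1 + U :: 'h::chilbert_space bop)"
proof -
  assume U: "star U = U"
  have "star (1 :: 'h bop) = 1" by (metis mult_1_left mult_1_right star_mult star_star)
  then show ?thesis by (simp add: star_scaleC star_add U)
qed

lemma idem_half_one_plus:
  fixes U :: "'h::chilbert_space bop"
  assumes "U * U = 1"
  shows "((1/2) *\<^sub>C (1 + U)) * ((1/2) *\<^sub>C (1 + U)) = (1/2) *\<^sub>C (1 + U)"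
proof (rule bop_eqI)
  fix x
  have "bop_apply U (bop_apply U x) = x" by (metis assms bop_apply_one bop_apply_times)
  then have "bop_apply (((1/2) *\<^sub>C (1 + U)) * ((1/2) *\<^sub>C (1 + U))) x
      = (1/4) *\<^sub>C ((1 + 1) *\<^sub>C (x + bop_apply U x))"
    by (simp only: scaleC_add_left scaleC_one)
      (simp add: bop_apply_add bop_apply_scaleC scaleC_scaleC scaleC_add_right algebra_simps)
  also have "\<dots> = bop_apply ((1/2) *\<^sub>C (1 + U)) x" by (simp add: scaleC_scaleC)
  finally show "bop_apply (((1/2) *\<^sub>C (1 + U)) * ((1/2) *\<^sub>C (1 + U))) x = bop_apply ((1/2) *\<^sub>C (1 + U)) x" .
qed

context orthonormal_basis
begin

text \<open>Composition with \<open>calkin_proj\<close>; the bijection \<open>h\<close> labels rows and columns by the points of \<open>F\<close>.\<close>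

lemma amplified_functional_of_UCP:
  assumes F: "finite F" "F \<noteq> {}" "F \<subseteq> I" and h: "bij_betw h {..<card F} F"
    and \<Psi>: "\<Psi> \<in> UCP (card F)"
  shows "amplified_functional e I F
    (\<lambda>y z T. \<Psi> (calkin_proj T) $$ (inv_into {..<card F} h y, inv_into {..<card F} h z))"
proof -
  let ?n = "card F"
  let ?k = "inv_into {..<?n} h"
  have kF: "?k y < ?n" if "y \<in> F" for y
    using that h bij_betw_inv_into[OF h] by (auto dest: bij_betwE)
  have hk: "?k (h i) = i" if "i < ?n" for i
    using that h by (auto simp: bij_betw_def)
  have inj: "?k y = ?k z \<longleftrightarrow> y = z" if "y \<in> F" "z \<in> F" for y z
    using that bij_betw_inv_into[OF h] by (auto simp: bij_betw_def inj_on_eq_iff)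
  have carr: "\<Psi> a \<in> carrier_mat ?n ?n" and add: "\<Psi> (a + b) = \<Psi> a + \<Psi> b"
    and scale: "\<Psi> (c *\<^sub>C a) = c \<cdot>\<^sub>m \<Psi> a" and one: "\<Psi> 1 = 1\<^sub>m ?n" for a b c
    using \<Psi> by (auto simp: UCP_def)
  show ?thesis
  proof
    fix y z S T assume yz: "y \<in> F" "z \<in> F"
    show "\<Psi> (calkin_proj (S + T)) $$ (?k y, ?k z) = \<Psi> (calkin_proj S) $$ (?k y, ?k z) + \<Psi> (calkin_proj T) $$ (?k y, ?k z)"
      using carr[THEN carrier_matD(1)] carr[THEN carrier_matD(2)] kF yz
      by (simp add: plus_calkin.abs_eq[symmetric] add)
    show "\<Psi> (calkin_proj (c *\<^sub>C T)) $$ (?k y, ?k z) = c * \<Psi> (calkin_proj T) $$ (?k y, ?k z)" for c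
      using carr[THEN carrier_matD(1)] carr[THEN carrier_matD(2)] kF yz
      by (simp add: scaleC_calkin.abs_eq[symmetric] scale)
    show "\<Psi> (calkin_proj 1) $$ (?k y, ?k z) = (if y = z then 1 else 0)"
      using kF yz inj by (simp add: one_calkin_def[symmetric] one)
  next
    fix X :: "'i \<Rightarrow> 'i \<Rightarrow> 'h bop"
    define X' where "X' l i = calkin_proj (X (h l) (h i))" for l i
    have re: "(\<Sum>y\<in>F. f y) = (\<Sum>i<?n. f (h i))" for f :: "'i \<Rightarrow> 'z::comm_monoid_add"
      using sum.reindex_bij_betw[OF h, of f] by simp
    have "calkin_proj (\<Sum>l\<in>F. star (X l (h i)) * X l (h j)) = (\<Sum>l<?n. star (X' l i) * X' l j)" for i j
      unfolding re calkin_proj_sum X'_def by (simp add: star_calkin.abs_eq times_calkin.abs_eq)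
    then have "(\<Sum>y\<in>F. \<Sum>z\<in>F. \<Psi> (calkin_proj (\<Sum>l\<in>F. star (X l y) * X l z)) $$ (?k y, ?k z))
        = (\<Sum>i<?n. \<Sum>j<?n. \<Psi> (\<Sum>l<?n. star (X' l i) * X' l j) $$ (i, j))"
      by (simp add: re[of "\<lambda>y. \<Sum>z\<in>F. _ y z"] re[of "\<lambda>z. _ z"] hk cong: sum.cong_simp)
    then show "(\<Sum>y\<in>F. \<Sum>z\<in>F. \<Psi> (calkin_proj (\<Sum>l\<in>F. star (X l y) * X l z)) $$ (?k y, ?k z)) \<in> \<real>\<^sub>\<ge>\<^sub>0"
      using UCP_diagonal_functional_positive[OF \<Psi>, of X'] by simp
  qed (use F in auto)
qed

end

theorem corollary9:
  assumes "separable_type TYPE('h::chilbert_space)"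
    and "infinite_dimensional TYPE('h)"
  shows "\<exists>A B C D :: 'h bop.
    essential_projection A \<and> essential_projection B \<and>
    essential_projection C \<and> essential_projection D \<and>
    calkin_proj A * calkin_proj B = 0 \<and>
    (\<forall>K1 K2 K3. compact_op K1 \<and> compact_op K2 \<and> compact_op K3 \<longrightarrow>
      (\<exists>N\<ge>1. matrix_range N [calkin_proj A - calkin_proj B, calkin_proj C, calkin_proj D]
            \<noteq> matrix_range N [A - B + K1, C + K2, D + K3]))"
proof -
  obtain e :: "complex \<times> complex \<Rightarrow> 'h" where e: "orthonormal_basis e torsion_points"
    using orthonormal_basis_exists[OF assms countable_torsion_points infinite_torsion_points] by blast
  interpret orthonormal_basis e torsion_points by (rule e)
  define U where "U = monomial (\<lambda>_. 1) torus_swap"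
  define V where "V = monomial (\<lambda>_. 1) torus_shear"
  define W where "W = monomial fst torus_flip"
  have selfadjoint: "star (monomial \<kappa> R) = monomial \<kappa> R" and involution: "monomial \<kappa> R * monomial \<kappa> R = 1"
    if "(\<kappa>, R) \<in> torus_symmetries" for \<kappa> R
  proof -
    have R: "R \<in> torus_involutions" using that by (auto simp: torus_symmetries_def torus_involutions_def)
    note bij = bij_betw_torus_involution[OF R] and inv = torus_involution_involutive[OF R]
    have \<kappa>: "cmod (\<kappa> x) = 1 \<and> cnj (\<kappa> (R x)) = \<kappa> x" if x: "x \<in> torsion_points" for x
      using torsion_points_unit[of "fst x" "snd x"] x \<open>(\<kappa>, R) \<in> torus_symmetries\<close>
      by (auto simp: torus_symmetries_def torus_flip_def split: prod.splits)
    have b: "bounded (\<kappa> ` torsion_points)" using \<kappa> by (auto simp: bounded_iff intro: exI[of _ 1])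
    have "star (monomial \<kappa> R) = monomial (\<lambda>x. cnj (\<kappa> (R x))) R"
      by (rule star_monomial[OF bij inv b])
    also have "\<dots> = monomial \<kappa> R" by (rule monomial_cong) (simp_all add: \<kappa>)
    finally show s: "star (monomial \<kappa> R) = monomial \<kappa> R" .
    have "monomial \<kappa> R * monomial \<kappa> R = star (monomial \<kappa> R) * monomial \<kappa> R" by (simp only: s)
    also have "\<dots> = monomial (\<lambda>_. 1) id"
      unfolding star_monomial_times_self[OF bij b]
    proof (rule monomial_cong)
      show "cnj (\<kappa> x) * \<kappa> x = 1" if "x \<in> torsion_points" for x
        using \<kappa>[OF that] complex_norm_square[of "\<kappa> x"] by (simp add: mult.commute)
    qed simp
    finally show "monomial \<kappa> R * monomial \<kappa> R = 1" by (simp only: monomial_one)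
  qed
  have U: "star U = U" "U * U = 1" and V: "star V = V" "V * V = 1" and W: "star W = W" "W * W = 1"
    unfolding U_def V_def W_def by (intro selfadjoint involution; simp add: torus_symmetries_def)+
  define A where "A = (1/2) *\<^sub>C (1 + U)"
  define B where "B = (1/2) *\<^sub>C (1 + - U)"
  define C where "C = (1/2) *\<^sub>C (1 + V)"
  define D where "D = (1/2) *\<^sub>C (1 + W)"
  have mU: "star (- U) = - U" "(- U) * (- U) = 1"
  proof -
    have "- U = (- 1) *\<^sub>C U" using minus_eq_plus_scaleC[of 0 U] by simp
    then show "star (- U) = - U" by (simp add: star_scaleC U)
  qed (simp add: U)
  have proj: "essential_projection A" "essential_projection B" "essential_projection C" "essential_projection D"
    unfolding A_def B_def C_def D_def
    by (intro essential_projection_if_projection star_half_one_plus idem_half_one_plus U V W mU)+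
  have two: "(1/2) *\<^sub>C x + (1/2) *\<^sub>C x = x" for x :: "'h bop"
    by (simp flip: scaleC_add_left)
  have AB: "A - B = U"
    unfolding A_def B_def using two[of U] by (simp add: scaleC_add_right scaleC_diff_right)
  have CV: "V = 2 *\<^sub>C C + (- 1) *\<^sub>C 1" and DW: "W = 2 *\<^sub>C D + (- 1) *\<^sub>C 1"
    unfolding C_def D_def using minus_eq_plus_scaleC[of "1 + V" 1] minus_eq_plus_scaleC[of "1 + W" 1]
    by (simp_all add: scaleC_scaleC)
  have "A * B = 0"
  proof -
    have "(1 + U) * (1 + - U) = 0" by (simp add: algebra_simps U)
    then show ?thesis by (simp add: A_def B_def scaleC_mult_left scaleC_mult_right)
  qed
  then have orth: "calkin_proj A * calkin_proj B = 0"
    by (simp add: times_calkin.abs_eq zero_calkin_def)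
  have "\<exists>N\<ge>1. matrix_range N [calkin_proj A - calkin_proj B, calkin_proj C, calkin_proj D]
        \<noteq> matrix_range N [A - B + K1, C + K2, D + K3]"
    if K: "compact_op K1" "compact_op K2" "compact_op K3" for K1 K2 K3
  proof -
    \<comment> \<open>Half of the tolerance of \<open>no_functional_on_torus\<close>, because \<open>V = 2C - 1\<close> doubles the perturbation of \<open>C\<close>.\<close>
    define \<delta> :: real where "\<delta> = 1/1600000000"
    define S where "S = (\<Union>K\<in>{K1, K2, K3}. {x \<in> torsion_points. norm (bop_apply K (e x)) \<ge> \<delta>})"
    have "\<delta> > 0" by (simp add: \<delta>_def)
    then have "finite S" unfolding S_def
      by (intro finite_UN_I) (use K in \<open>auto intro: finite_compact_op_large\<close>)
    moreover have "S \<subseteq> torsion_points" by (auto simp: S_def)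
    ultimately obtain F where F: "finite F" "F \<noteq> {}" "F \<subseteq> torsion_points" "S \<inter> F = {}"
      and Finv: "\<And>R. R \<in> torus_involutions \<Longrightarrow> R ` F \<subseteq> F"
      using finite_invariant_set_avoiding by metis
    have small: "norm (bop_apply K (e z)) \<le> \<delta>" if "K \<in> {K1, K2, K3}" "z \<in> F" for K z
    proof (rule ccontr)
      assume "\<not> ?thesis"
      then have "z \<in> S" using that F(3) unfolding S_def by auto
      then show False using F(4) that by blast
    qed
    let ?n = "card F"
    have n: "?n \<ge> 1" using F by (simp add: Suc_le_eq card_gt_0_iff)
    obtain h where h: "bij_betw h {..<?n} F"
      using ex_bij_betw_nat_finite[OF F(1)] by (auto simp: atLeast0LessThan)
    let ?k = "inv_into {..<?n} h"
    have kF: "?k y < ?n" and hk: "h (?k y) = y" if "y \<in> F" for y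
      using that h bij_betw_inv_into[OF h] by (auto dest: bij_betwE simp: bij_betw_inv_into_right[OF h])
    define f where "f i = e (h i)" for i
    have hF: "h i \<in> F" if "i < ?n" for i using h that by (auto dest: bij_betwE)
    have "compression ?n f \<in> UCP ?n"
    proof (rule compression_UCP)
      fix i j assume ij: "i < ?n" "j < ?n"
      have "h i = h j \<longleftrightarrow> i = j" using h ij by (auto simp: bij_betw_def inj_on_eq_iff)
      then show "cinner (f i) (f j) = (if i = j then 1 else 0)"
        using hF[OF ij(1)] hF[OF ij(2)] F(3) unfolding f_def by (subst orthonormal) auto
    qed
    then have mem: "map (compression ?n f) [A - B + K1, C + K2, D + K3] \<in> matrix_range ?n [A - B + K1, C + K2, D + K3]"
      unfolding matrix_range_def by blast
    have "matrix_range ?n [calkin_proj A - calkin_proj B, calkin_proj C, calkin_proj D]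
        \<noteq> matrix_range ?n [A - B + K1, C + K2, D + K3]"
    proof
      assume same: "matrix_range ?n [calkin_proj A - calkin_proj B, calkin_proj C, calkin_proj D]
        = matrix_range ?n [A - B + K1, C + K2, D + K3]"
      have "map (compression ?n f) [A - B + K1, C + K2, D + K3]
          \<in> matrix_range ?n [calkin_proj A - calkin_proj B, calkin_proj C, calkin_proj D]"
        unfolding same by (rule mem)
      then obtain \<Psi> where \<Psi>: "\<Psi> \<in> UCP ?n"
        and eq: "map (compression ?n f) [A - B + K1, C + K2, D + K3]
          = map \<Psi> [calkin_proj A - calkin_proj B, calkin_proj C, calkin_proj D]"
        unfolding matrix_range_def by blast
      define \<psi> where "\<psi> y z T = \<Psi> (calkin_proj T) $$ (?k y, ?k z)" for y z T
      have af: "amplified_functional e torsion_points F \<psi>"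
        unfolding \<psi>_def by (rule amplified_functional_of_UCP[OF F(1-3) h \<Psi>])
      interpret amplified_functional e torsion_points F \<psi> by (rule af)
      have comp: "compression ?n f T $$ (?k y, ?k z) = cinner (e y) (bop_apply T (e z))"
        if "y \<in> F" "z \<in> F" for T y z
        using that kF hk by (simp add: compression_def f_def)
      have val: "\<psi> y z U = cinner (e y) (bop_apply (U + K1) (e z))"
        "\<psi> y z C = cinner (e y) (bop_apply (C + K2) (e z))"
        "\<psi> y z D = cinner (e y) (bop_apply (D + K3) (e z))" if "y \<in> F" "z \<in> F" for y z
        unfolding comp[OF that, symmetric]
        using eq by (simp_all add: \<psi>_def minus_calkin.abs_eq AB)
      have err: "cmod (cinner (e y) (bop_apply K (e z))) \<le> \<delta>" if "K \<in> {K1, K2, K3}" "y \<in> F" "z \<in> F" for K y z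
      proof -
        have "cmod (cinner (e y) (bop_apply K (e z))) \<le> norm (e y) * norm (bop_apply K (e z))"
          by (rule Cauchy_Schwarz_cinner)
        also have "norm (e y) = 1" using that F(3) by (auto intro: norm_basis)
        finally show ?thesis using small[OF that(1,3)] by simp
      qed
      show False
      proof (rule no_functional_on_torus[OF af Finv])
        show "\<psi> y z T = 0" if "y \<in> F" "z \<in> F" "compact_op T" for y z T
        proof -
          have "calkin_proj T = calkin_proj 0" using that by (simp add: calkin_proj_eq_iff)
          then have "\<psi> y z T = \<psi> y z 0" by (simp only: \<psi>_def)
          then show ?thesis using \<psi>_zero that by simp
        qed
        fix \<kappa> R y z assume \<kappa>: "(\<kappa>, R) \<in> torus_symmetries" and yz: "y \<in> F" "z \<in> F"
        have on: "cinner (e y) (e z) = (if y = z then 1 else 0)"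
          using yz F(3) by (intro orthonormal) auto
        have "\<psi> y z V - cinner (e y) (bop_apply V (e z)) = 2 * cinner (e y) (bop_apply K2 (e z))"
          unfolding CV using yz by (simp add: \<psi>_add \<psi>_scaleC \<psi>_one val cinner_add_right cinner_scaleC_right
            on algebra_simps)
        moreover have "\<psi> y z W - cinner (e y) (bop_apply W (e z)) = 2 * cinner (e y) (bop_apply K3 (e z))"
          unfolding DW using yz by (simp add: \<psi>_add \<psi>_scaleC \<psi>_one val cinner_add_right cinner_scaleC_right
            on algebra_simps)
        moreover have "\<psi> y z U - cinner (e y) (bop_apply U (e z)) = cinner (e y) (bop_apply K1 (e z))"
          using yz by (simp add: val cinner_add_right)
        ultimately have "cmod (\<psi> y z T - cinner (e y) (bop_apply T (e z))) \<le> 2 * \<delta>" if "T \<in> {U, V, W}" for T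
          using that err[OF _ yz, of K1] err[OF _ yz, of K2] err[OF _ yz, of K3]
          by (auto simp: norm_mult \<delta>_def)
        moreover have "monomial \<kappa> R \<in> {U, V, W}" using \<kappa> by (auto simp: torus_symmetries_def U_def V_def W_def)
        ultimately show "cmod (\<psi> y z (monomial \<kappa> R) - cinner (e y) (bop_apply (monomial \<kappa> R) (e z))) \<le> 1/800000000"
          by (auto simp: \<delta>_def)
      qed
    qed
    then show ?thesis using n by blast
  qed
  then show ?thesis using proj orth by blast
qed

end
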